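(* Let $n\ge1$, $\lambda>0$, $m\in\mathbb Z$ with $m+n+\tfrac12<0$, and $k=\begin{pmatrix}P&Q\\ \bar Q&\bar P\end{pmatrix}\in S$. Let $B_k(Z,W)$ be the kernel of the operator $\pi_\chi((0,0),0,k)$ on $\mathcal H_\chi$. Then for $Z=a(y,0)$ and $W=a(v,0)$, with $y,v\in\mathbb C^n$, $$B_k(Z,W)=(\operatorname{Det}P)^m\exp\left(\tfrac{\lambda}{4}\left(y(\bar QP^{-1}y)+2y(P^t)^{-1}\bar v-\bar v(P^{-1}Q\bar v)\right)\right).$$
   Context: For $z,w\in\mathbb C^n$, $zw:=\sum_jz_jw_j$ (bilinear); for a matrix $M$, $zMw$ means $z(Mw)$. $S$ is the group of matrices $k=\begin{pmatrix}P&Q\\ \bar Q&\bar P\end{pmatrix}$ with $P,Q\in M_n(\mathbb C)$, $PP^*-QQ^*=I_n$, $PQ^t=QP^t$, acting by $k(z,\bar z)=(Pz+Q\bar z,\bar Qz+\bar P\bar z)$. The Jacobi group $G$ is the set of $((z,\bar z),c,k)$, $z\in\mathbb C^n$, $c\in\mathbb R$, $k\in S$, with product $((z,\bar z),c,k)((z',\bar z'),c',k')=((z,\bar z)+k(z',\bar z'),\,c+c'+\tfrac12\omega((z,\bar z),k(z',\bar z')),\,kk')$, where $\omega((z,w),(z',w'))=\tfrac i2(zw'-z'w)$. $\mathcal D=\{a(y,Y): y\in\mathbb C^n,\ Y\in M_n(\mathbb C),\ Y^t=Y,\ I_n-Y\bar Y>0\}$, where $a(y,Y)$ is just a name for the pair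 $(y,Y)$. $G$ acts on $\mathcal D$ by $g\cdot a(y,Y)=a(y',Y')$ for $g=((z_0,\bar z_0),c_0,\begin{pmatrix}P&Q\\ \bar Q&\bar P\end{pmatrix})$, with $Y'=(PY+Q)(\bar QY+\bar P)^{-1}$ and $y'=z_0+Py-(PY+Q)(\bar QY+\bar P)^{-1}(\bar z_0+\bar Qy)$. Let $\chi$ be the character $((0,0),c,\begin{pmatrix}P&0\\0&\bar P\end{pmatrix})\mapsto e^{i\lambda c}(\operatorname{Det}P)^m$ ($c\in\mathbb R$, $P\in U(n)$). The associated functions are, for $Z=a(y,Y)$, $W=a(v,V)$ in $\mathcal D$ and $g=((z_0,\bar z_0),c_0,\begin{pmatrix}P&Q\\ \bar Q&\bar P\end{pmatrix})\in G$, $$K_\chi(Z,W)=\operatorname{Det}(I_n-Y\bar V)^m\exp\left(\tfrac\lambda4\left(2y(I_n-\bar VY)^{-1}\bar v+y(I_n-\bar VY)^{-1}\bar Vy+\bar vY(I_n-\bar VY)^{-1}\bar v\right)\right),$$ $$J_\chi(g,Z)=e^{i\lambda c_0}\operatorname{Det}(\bar QY+\bar P)^{-m}\exp\left(\tfrac\lambda4\left(z_0\bar z_0+2\bar z_0Py+yP^t\bar Qy-(\bar z_0+\bar Qy)(PY+Q)(\bar QY+\bar P)^{-1}(\bar z_0+\bar Qy)\right)\right).$$ $\mathcal H_\chi$ is the Hilbert space of holomorphic functions $f$ on $\mathcal D$ with $\|f\|_\chi^2=\int_{\mathcal D}|f(Z)|^2K_\chi(Z,Z)^{-1}c_\chi\,d\mu(Z)<\infty$,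 where $d\mu(Z)=\operatorname{Det}(I_n-Y\bar Y)^{-(n+2)}d\mu_L(y,Y)$, $d\mu_L$ is Lebesgue measure, and $c_\chi^{-1}=\int_{\mathcal D}K_\chi(Z,Z)^{-1}d\mu(Z)$. For $m+n+\frac12<0$, $\mathcal H_\chi\ne0$ and $(\pi_\chi(g)f)(Z)=J_\chi(g^{-1},Z)^{-1}f(g^{-1}\cdot Z)$ defines a unitary representation of $G$ on $\mathcal H_\chi$. With $e_Z(W)=K_\chi(W,Z)$ one has $f(Z)=\langle f,e_Z\rangle_\chi$. The kernel of an operator $A$ on $\mathcal H_\chi$ is $k_A(Z,W)=\langle Ae_W,e_Z\rangle_\chi=(Ae_W)(Z)$. *)

theory Defs
  imports "HOL-Analysis.Analysis" "HOL-Algebra.Group"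
begin

section \<open>Complex vectors and matrices\<close>

text \<open>The dimension \<open>n\<close> is \<open>CARD('n)\<close>. The pairing \<open>z w\<close> is bilinear, unlike the
  real inner product that the library puts on \<open>complex^'n\<close>.\<close>

definition bil :: "complex^'n \<Rightarrow> complex^'n \<Rightarrow> complex"  (infixl "\<star>" 70)
  where "z \<star> w = (\<Sum>j\<in>UNIV. z $ j * w $ j)"

definition cnj_vec :: "complex^'n \<Rightarrow> complex^'n"
  where "cnj_vec z = (\<chi> i. cnj (z $ i))"

definition cnj_mat :: "complex^'n^'m \<Rightarrow> complex^'n^'m"
  where "cnj_mat M = (\<chi> i j. cnj (M $ i $ j))"

definition adj :: "complex^'n^'m \<Rightarrow> complex^'m^'n"
  where "adj M = transpose (cnj_mat M)"

text \<open>\<open>M > 0\<close>: the Hermitian form \<open>z\<^sup>* M z\<close> is real and positive for \<open>z \<noteq> 0\<close>; over the complex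
  numbers this already makes \<open>M\<close> Hermitian.\<close>

definition pos_def :: "complex^'n^'n \<Rightarrow> bool"
  where "pos_def M \<longleftrightarrow>
    (\<forall>z. z \<noteq> 0 \<longrightarrow> cnj_vec z \<star> (M *v z) \<in> \<real> \<and> Re (cnj_vec z \<star> (M *v z)) > 0)"

section \<open>The group \<open>S\<close> and the Jacobi group\<close>

type_synonym 'n block = "complex^('n + 'n)^('n + 'n)"

definition block_mat ::
    "complex^'n^'n \<Rightarrow> complex^'n^'n \<Rightarrow> complex^'n^'n \<Rightarrow> complex^'n^'n \<Rightarrow> 'n::finite block"
  where "block_mat A B C D = (\<chi> i j.
    case i of
      Inl a \<Rightarrow> (case j of Inl b \<Rightarrow> A $ a $ b | Inr b \<Rightarrow> B $ a $ b)
    | Inr a \<Rightarrow> (case j of Inl b \<Rightarrow> C $ a $ b | Inr b \<Rightarrow> D $ a $ b))"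

definition blk11 :: "'n::finite block \<Rightarrow> complex^'n^'n"
  where "blk11 k = (\<chi> i j. k $ Inl i $ Inl j)"

definition blk12 :: "'n::finite block \<Rightarrow> complex^'n^'n"
  where "blk12 k = (\<chi> i j. k $ Inl i $ Inr j)"

definition blk21 :: "'n::finite block \<Rightarrow> complex^'n^'n"
  where "blk21 k = (\<chi> i j. k $ Inr i $ Inl j)"

definition blk22 :: "'n::finite block \<Rightarrow> complex^'n^'n"
  where "blk22 k = (\<chi> i j. k $ Inr i $ Inr j)"

definition S_group :: "'n::finite block set"
  where "S_group = {block_mat P Q (cnj_mat Q) (cnj_mat P) | P Q.
    P ** adj P - Q ** adj Q = mat 1 \<and> P ** transpose Q = Q ** transpose P}"

definition S_act :: "'n::finite block \<Rightarrow> (complex^'n) \<times> (complex^'n) \<Rightarrow> (complex^'n) \<times> (complex^'n)"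
  where "S_act k = (\<lambda>(z, w). (blk11 k *v z + blk12 k *v w, blk21 k *v z + blk22 k *v w))"

definition omega :: "(complex^'n) \<times> (complex^'n) \<Rightarrow> (complex^'n) \<times> (complex^'n) \<Rightarrow> complex"
  where "omega = (\<lambda>(z, w) (z', w'). \<i> / 2 * (z \<star> w' - z' \<star> w))"

type_synonym 'n jacobi = "((complex^'n) \<times> (complex^'n)) \<times> real \<times> 'n block"

text \<open>\<open>omega\<close> is real-valued on pairs \<open>((z, cnj z), (z', cnj z'))\<close>; the real part below only
  turns its value into an element of type \<open>real\<close>.\<close>

definition jacobi_group :: "'n::finite jacobi monoid"
  where "jacobi_group = \<lparr>
    carrier = {((z, cnj_vec z), c, k) | z c k. k \<in> S_group},
    monoid.mult = (\<lambda>(x, c, k) (x', c', k').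
      (x + S_act k x', c + c' + Re (1 / 2 * omega x (S_act k x')), k ** k')),
    one = (0, 0, mat 1) \<rparr>"

section \<open>The domain, the action, and the functions \<open>K\<close> and \<open>J\<close>\<close>

text \<open>The point \<open>a(y,Y)\<close> is the pair \<open>(y, Y)\<close>.\<close>

type_synonym 'n point = "(complex^'n) \<times> (complex^'n^'n)"

definition jacobi_dom :: "'n::finite point set"
  where "jacobi_dom = {(y, Y). transpose Y = Y \<and> pos_def (mat 1 - Y ** cnj_mat Y)}"

definition jacobi_act :: "'n::finite jacobi \<Rightarrow> 'n point \<Rightarrow> 'n point"
  where "jacobi_act = (\<lambda>((z0, w0), c0, k) (y, Y).
    let P = blk11 k; Q = blk12 k;
        Y' = (P ** Y + Q) ** matrix_inv (cnj_mat Q ** Y + cnj_mat P)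
    in (z0 + P *v y - Y' *v (cnj_vec z0 + cnj_mat Q *v y), Y'))"

definition K_chi :: "real \<Rightarrow> int \<Rightarrow> 'n::finite point \<Rightarrow> 'n point \<Rightarrow> complex"
  where "K_chi lam m = (\<lambda>(y, Y) (v, V).
    let V' = cnj_mat V; v' = cnj_vec v; R = matrix_inv (mat 1 - V' ** Y)
    in det (mat 1 - Y ** V') powi m *
       exp (of_real lam / 4 *
         (2 * (y \<star> (R *v v')) + y \<star> ((R ** V') *v y) + v' \<star> ((Y ** R) *v v'))))"

definition J_chi :: "real \<Rightarrow> int \<Rightarrow> 'n::finite jacobi \<Rightarrow> 'n point \<Rightarrow> complex"
  where "J_chi lam m = (\<lambda>((z0, w0), c0, k) (y, Y).
    let P = blk11 k; Q = blk12 k; z0' = cnj_vec z0; Q' = cnj_mat Q; P' = cnj_mat P;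
        u = z0' + Q' *v y
    in exp (\<i> * of_real lam * of_real c0) * det (Q' ** Y + P') powi (- m) *
       exp (of_real lam / 4 *
         (z0 \<star> z0' + 2 * (z0' \<star> (P *v y)) + y \<star> ((transpose P ** Q') *v y)
          - u \<star> (((P ** Y + Q) ** matrix_inv (Q' ** Y + P')) *v u))))"

section \<open>The Hilbert space\<close>

text \<open>A symmetric matrix is given by one complex coordinate for each unordered pair \<open>{i, j}\<close>
  (with \<open>i = j\<close> allowed), so Lebesgue measure on symmetric matrices is the product of the
  Lebesgue measures of these coordinates. The normalisation does not matter: it cancels
  against the one in \<open>c_chi\<close>.\<close>

definition sym_pairs :: "'n set set"
  where "sym_pairs = {{i, j} | i j. True}"

definition sym_lebesgue :: "(complex^'n^'n) measure"
  where "sym_lebesgue =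
    distr (\<Pi>\<^sub>M p\<in>sym_pairs. (lborel :: complex measure)) borel (\<lambda>s. \<chi> i j. s {i, j})"

definition mu_L :: "'n::finite point measure"
  where "mu_L = lborel \<Otimes>\<^sub>M sym_lebesgue"

text \<open>On \<open>jacobi_dom\<close> the determinant and \<open>K_chi lam m Z Z\<close> are positive reals. The measure
  lives on \<open>jacobi_dom\<close>, so integrals with respect to it are integrals over \<open>jacobi_dom\<close>.\<close>

definition mu :: "'n::finite point measure"
  where "mu = density (restrict_space mu_L jacobi_dom)
    (\<lambda>(y, Y). ennreal (Re (det (mat 1 - Y ** cnj_mat Y)) powi (- (int CARD('n) + 2))))"

definition c_chi :: "'n::finite itself \<Rightarrow> real \<Rightarrow> int \<Rightarrow> complex"
  where "c_chi _ lam m = inverse (LINT Z|(mu :: 'n point measure). inverse (K_chi lam m Z Z))"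

text \<open>\<open>jacobi_dom\<close> is open in the complex vector space of pairs \<open>(y, Y)\<close> with \<open>Y\<close> symmetric,
  but not in the ambient type. Holomorphic means having at each point a complex-linear derivative along
  \<open>jacobi_dom\<close>; a complex-linear map on the subspace always extends to the ambient space.\<close>

definition holomorphic_on_dom :: "('n::finite point \<Rightarrow> complex) \<Rightarrow> bool"
  where "holomorphic_on_dom f \<longleftrightarrow>
    (\<forall>Z\<in>jacobi_dom. \<exists>f'. (f has_derivative f') (at Z within jacobi_dom) \<and>
       (\<forall>c u U. f' (c *s u, \<chi> i. c *s (U $ i)) = c * f' (u, U)))"

text \<open>Functions on \<open>jacobi_dom\<close> are extensional, i.e. \<open>undefined\<close> outside \<open>jacobi_dom\<close>,
  so that equality in \<open>H_chi\<close> is equality of functions on \<open>jacobi_dom\<close>.\<close>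

definition H_chi :: "real \<Rightarrow> int \<Rightarrow> ('n::finite point \<Rightarrow> complex) set"
  where "H_chi lam m = {f \<in> extensional jacobi_dom. holomorphic_on_dom f \<and>
    integrable mu (\<lambda>Z. of_real ((cmod (f Z))\<^sup>2) * inverse (K_chi lam m Z Z))}"

definition inner_chi ::
    "real \<Rightarrow> int \<Rightarrow> ('n::finite point \<Rightarrow> complex) \<Rightarrow> ('n point \<Rightarrow> complex) \<Rightarrow> complex"
  where "inner_chi lam m f g =
    (LINT Z|mu. f Z * cnj (g Z) * inverse (K_chi lam m Z Z) * c_chi TYPE('n) lam m)"

definition e_chi :: "real \<Rightarrow> int \<Rightarrow> 'n::finite point \<Rightarrow> 'n point \<Rightarrow> complex"
  where "e_chi lam m Z = (\<lambda>W\<in>jacobi_dom. K_chi lam m W Z)"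

section \<open>The representation and kernels of operators\<close>

text \<open>An operator on \<open>H_chi\<close> is a function that is \<open>undefined\<close> outside \<open>H_chi\<close>.\<close>

definition pi_chi ::
    "real \<Rightarrow> int \<Rightarrow> 'n::finite jacobi \<Rightarrow> ('n point \<Rightarrow> complex) \<Rightarrow> ('n point \<Rightarrow> complex)"
  where "pi_chi lam m g = (\<lambda>f\<in>H_chi lam m. \<lambda>Z\<in>jacobi_dom.
    inverse (J_chi lam m (inv\<^bsub>jacobi_group\<^esub> g) Z) * f (jacobi_act (inv\<^bsub>jacobi_group\<^esub> g) Z))"

definition kernel_chi ::
    "real \<Rightarrow> int \<Rightarrow> (('n::finite point \<Rightarrow> complex) \<Rightarrow> ('n point \<Rightarrow> complex)) \<Rightarrow>
     'n point \<Rightarrow> 'n point \<Rightarrow> complex"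
  where "kernel_chi lam m A Z W = inner_chi lam m (A (e_chi lam m W)) (e_chi lam m Z)"

end

theory Submission
  imports Defs "HOL-Complex_Analysis.Cauchy_Integral_Formula"
begin

text \<open>
  In the coordinates \<open>(x, Y)\<close> with \<open>y = x - Y cnj x\<close> the exponent of \<open>K(Z, Z)\<close> becomes
  \<open>lam/2 (|x|\<^sup>2 - Re (cnj x Y cnj x))\<close>, and the Jacobian of this substitution is \<open>Det(1 - Y cnj Y)\<close>.
  With the Jacobian, the exponent of the determinant in \<open>K(Z, Z)\<^sup>-\<^sup>1 d\<mu>\<close> is \<open>- m - n - 1 \<ge> 0\<close>, so that
  finiteness of the measure reduces to a Gaussian estimate. That estimate is obtained by integrating
  over \<open>Y\<close> first, which leaves a decay of order \<open>|x|\<close> to the power \<open>-(2n + 1)\<close>.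

  Lebesgue measure in \<open>(x, Y)\<close> is invariant under the translations \<open>x \<mapsto> x + x\<^sub>0\<close> and the rotations
  \<open>(x, Y) \<mapsto> (c x, c\<^sup>2 Y)\<close> with \<open>|c| = 1\<close>. The rotations and the mean value property of holomorphic
  functions give the reproducing property at the origin, and a translation moves it to \<open>a(y, 0)\<close>. Applied
  to \<open>\<pi>(k) e\<^sub>W\<close>, whose absolute value is at most a constant times \<open>K(Z, Z)\<^sup>1\<^sup>/\<^sup>2\<close> up to the determinant
  factors, it shows that the kernel is the value \<open>(\<pi>(k) e\<^sub>W)(a(y, 0))\<close>, which is explicit.
\<close>

section \<open>Linear changes of variables\<close>

text \<open>\<open>kernel_chi\<close> is an inner product, so the closed formula rests on the
  identity \<open><f, e_Z> = f Z\<close> for \<open>f = pi(k) e_W\<close>; it is proved here for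
  this \<open>f\<close> and for \<open>Z = (y, 0)\<close>, the points that translations reach from
  the origin. The coordinate \<open>x\<close> is the one on which the group acts without fractions:
  \<open>S\<close> acts by \<open>x \<mapsto> P x + Q cnj x\<close> and the Heisenberg part by
  translations. In \<open>(y, Y)\<close> the exponent of \<open>K(Z, Z)\<close> contains the inverse
  of \<open>1 - cnj Y Y\<close>, singular at the boundary; in \<open>(x, Y)\<close> it is quadratic
  in \<open>x\<close> and affine in \<open>Y\<close>. The obstacle is that this form degenerates as
  \<open>Y\<close> approaches a boundary point with \<open>Y cnj x = x\<close>, so no Gaussian bound
  in \<open>x\<close> is uniform in \<open>Y\<close>. In the extreme case \<open>m = - n - 1\<close>
  the determinant power is \<open>0\<close> and gives no help; only the smallness of the set of bad
  \<open>Y\<close> for a given \<open>x\<close> saves the integral. Translation to the origin works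
  because the conjugate factor \<open>cnj (e_Z)\<close> absorbs precisely the antiholomorphic part
  of the change of the weight, so that what remains is holomorphic.\<close>

lemma prod_Basis_vec:
  fixes g :: "real^'n \<Rightarrow> 'b::comm_monoid_mult"
  shows "(\<Prod>b\<in>Basis. g b) = (\<Prod>i\<in>UNIV. g (axis i 1))"
proof -
  have "bij_betw (\<lambda>i::'n. axis i (1::real)) UNIV Basis"
    by (auto simp: bij_betw_def inj_on_def axis_eq_axis Basis_vec_def)
  from prod.reindex_bij_betw[OF this, of g] show ?thesis by simp
qed

text \<open>Vacuous for singular matrices: in the induction over elementary matrices the zero-row
  case is then trivial, and a product with nonzero determinant has two nonsingular factors.\<close>

definition scales_lborel :: "real^'n^'n \<Rightarrow> bool" where
  "scales_lborel A \<longleftrightarrow> (det A \<noteq> 0 \<longrightarrow> (\<forall>h\<in>borel_measurable borel.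
     integral\<^sup>N lborel h = ennreal \<bar>det A\<bar> * (\<integral>\<^sup>+x. h (A *v x) \<partial>lborel)))"

lemma measurable_matrix_vector_mul [measurable]:
  "(\<lambda>x. (A::real^'n^'m) *v x) \<in> borel_measurable borel"
  by (intro borel_measurable_continuous_onI matrix_vector_mult_linear_continuous_on)

lemma scales_lborel_mult:
  fixes A B :: "real^'n^'n"
  assumes "scales_lborel A" "scales_lborel B" shows "scales_lborel (A ** B)"
  unfolding scales_lborel_def
proof (intro impI ballI)
  fix h :: "real^'n \<Rightarrow> ennreal"
  assume d: "det (A ** B) \<noteq> 0" and h [measurable]: "h \<in> borel_measurable borel"
  have "integral\<^sup>N lborel h = ennreal \<bar>det A\<bar> * (\<integral>\<^sup>+x. h (A *v x) \<partial>lborel)"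
    using assms(1)[unfolded scales_lborel_def, THEN mp, THEN bspec, OF _ h] d by (simp add: det_mul)
  also have "(\<integral>\<^sup>+x. h (A *v x) \<partial>lborel) = ennreal \<bar>det B\<bar> * (\<integral>\<^sup>+x. h (A *v (B *v x)) \<partial>lborel)"
  proof -
    have "(\<lambda>x. h (A *v x)) \<in> borel_measurable borel" by measurable
    from assms(2)[unfolded scales_lborel_def, THEN mp, THEN bspec, OF _ this] d
    show ?thesis by (simp add: det_mul)
  qed
  finally show "integral\<^sup>N lborel h = ennreal \<bar>det (A ** B)\<bar> * (\<integral>\<^sup>+x. h (A ** B *v x) \<partial>lborel)"
    by (simp add: det_mul abs_mult ennreal_mult mult.assoc matrix_vector_mul_assoc)
qed

lemma scales_lborel_diagonal:
  fixes A :: "real^'n^'n"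
  assumes "\<And>i j. i \<noteq> j \<Longrightarrow> A$i$j = 0" shows "scales_lborel A"
  unfolding scales_lborel_def
proof (intro impI ballI)
  fix h :: "real^'n \<Rightarrow> ennreal"
  assume d: "det A \<noteq> 0" and h [measurable]: "h \<in> borel_measurable borel"
  have dA: "det A = (\<Prod>i\<in>UNIV. A$i$i)" using assms by (rule det_diagonal)
  then have nz: "A$i$i \<noteq> 0" for i using d by auto
  have col: "(A *v axis i 1) \<bullet> axis i 1 = A$i$i" for i
    by (simp add: matrix_vector_mul_component inner_axis cart_eq_inner_axis[symmetric])
  define c where "c j = (A *v j) \<bullet> j" for j
  have c0: "c j \<noteq> 0" if "j \<in> Basis" for j
    using that nz col by (auto simp: c_def Basis_vec_def)
  have Ax: "A *v x = 0 + (\<Sum>j\<in>Basis. (c j * (x \<bullet> j)) *\<^sub>R j)" for x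
  proof -
    have "(A *v x) $ i = A$i$i * x$i" for i
      using assms by (simp add: matrix_vector_mult_def) (subst sum.remove[of _ i], auto)
    moreover have "(\<Sum>j\<in>Basis. (c j * (x \<bullet> j)) *\<^sub>R j) $ i = A$i$i * x$i" for i
    proof -
      have "(\<Sum>j\<in>Basis. (c j * (x \<bullet> j)) *\<^sub>R j) $ i = (\<Sum>j\<in>Basis. (c j * (x \<bullet> j)) *\<^sub>R j) \<bullet> axis i 1"
        by (simp add: inner_axis)
      also have "\<dots> = c (axis i 1) * (x \<bullet> axis i 1)"
        by (subst inner_sum_left_Basis) (auto simp: Basis_vec_def)
      finally have "(\<Sum>j\<in>Basis. (c j * (x \<bullet> j)) *\<^sub>R j) $ i = c (axis i 1) * (x \<bullet> axis i 1)" .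
      moreover have "c (axis i 1) = A$i$i" by (simp only: c_def col)
      moreover have "x \<bullet> axis i 1 = x $ i" by (simp add: inner_axis)
      ultimately show ?thesis by simp
    qed
    ultimately show ?thesis by (simp add: vec_eq_iff)
  qed
  have pr: "(\<Prod>j\<in>Basis. \<bar>c j\<bar>) = \<bar>det A\<bar>"
    by (simp add: prod_Basis_vec c_def col dA abs_prod)
  have "integral\<^sup>N lborel h = (\<integral>\<^sup>+x. h x \<partial>(density (distr lborel borel (\<lambda>x. A *v x)) (\<lambda>_. ennreal \<bar>det A\<bar>)))"
    using lborel_affine_euclidean[of c 0] c0 unfolding Ax[symmetric] pr by simp
  also have "\<dots> = ennreal \<bar>det A\<bar> * (\<integral>\<^sup>+x. h (A *v x) \<partial>lborel)"
    by (simp add: nn_integral_density nn_integral_cmult nn_integral_distr)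
  finally show "integral\<^sup>N lborel h = ennreal \<bar>det A\<bar> * (\<integral>\<^sup>+x. h (A *v x) \<partial>lborel)" .
qed

text \<open>The preimage of a box is a box with two sides exchanged, and boxes determine
  \<open>lborel\<close>.\<close>

lemma lborel_distr_transpose:
  fixes m n :: "'n::finite"
  defines "f \<equiv> \<lambda>x::real^'n. \<chi> i. x $ Transposition.transpose m n i"
  shows "lborel = distr lborel borel f"
proof (rule lborel_eqI)
  fix l u :: "real^'n" assume le: "\<And>b. b \<in> Basis \<Longrightarrow> l \<bullet> b \<le> u \<bullet> b"
  have f: "f \<in> borel_measurable borel"
    unfolding f_def by (intro borel_measurable_continuous_onI continuous_intros)
  have le': "l $ i \<le> u $ i" for i
    using le[of "axis i 1"] by (simp add: inner_axis)
  have "f -` box l u = box (f l) (f u)"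
    unfolding f_def mem_box_cart set_eq_iff vimage_eq
    by auto (metis transpose_involutory)+
  then have "emeasure (distr lborel borel f) (box l u) = emeasure lborel (box (f l) (f u))"
    using f by (simp add: emeasure_distr)
  also have "\<dots> = ennreal (\<Prod>b\<in>Basis. (f u - f l) \<bullet> b)"
    by (rule emeasure_lborel_box) (auto simp: Basis_vec_def inner_axis f_def le')
  also have "(\<Prod>b\<in>Basis. (f u - f l) \<bullet> b) = (\<Prod>i\<in>UNIV. (u - l) $ Transposition.transpose m n i)"
    by (simp add: prod_Basis_vec inner_axis f_def)
  also have "\<dots> = (\<Prod>i\<in>UNIV. (u - l) $ i)"
    by (rule prod.permute[where g = "\<lambda>i. (u - l) $ i" and p = "Transposition.transpose m n" and S = UNIV, unfolded o_def, symmetric])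
      (simp add: permutes_swap_id)
  also have "\<dots> = (\<Prod>b\<in>Basis. (u - l) \<bullet> b)"
    by (simp add: prod_Basis_vec inner_axis)
  finally show "emeasure (distr lborel borel f) (box l u) = (\<Prod>b\<in>Basis. (u - l) \<bullet> b)" .
qed simp

lemma scales_lborel_swap:
  fixes m n :: "'n::finite"
  assumes "m \<noteq> n"
  shows "scales_lborel (\<chi> i j. mat 1 $ i $ Transposition.transpose m n j :: real^'n^'n)" (is "scales_lborel ?A")
  unfolding scales_lborel_def
proof (intro impI ballI)
  fix h :: "real^'n \<Rightarrow> ennreal"
  assume h [measurable]: "h \<in> borel_measurable borel"
  have "det ?A = of_int (sign (Transposition.transpose m n)) * det (mat 1 :: real^'n^'n)"
    by (rule det_permute_columns) (simp add: permutes_swap_id)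
  then have d: "\<bar>det ?A\<bar> = 1" by (simp add: sign_swap_id)
  have A: "?A *v x = (\<chi> i. x $ Transposition.transpose m n i)" for x
  proof -
    have "(\<Sum>j\<in>UNIV. mat 1 $ i $ Transposition.transpose m n j * x $ j) = x $ Transposition.transpose m n i" for i
      by (subst sum.remove[of _ "Transposition.transpose m n i"])
        (auto simp: mat_def intro!: sum.neutral, metis transpose_involutory)
    then show ?thesis by (simp add: vec_eq_iff matrix_vector_mult_def)
  qed
  have meas: "(\<lambda>x::real^'n. \<chi> i. x $ Transposition.transpose m n i) \<in> borel_measurable borel"
    by (intro borel_measurable_continuous_onI continuous_intros)
  have "integral\<^sup>N lborel h = (\<integral>\<^sup>+x. h (\<chi> i. x $ Transposition.transpose m n i) \<partial>lborel)"
    by (subst lborel_distr_transpose[of m n]) (simp add: nn_integral_distr meas)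
  then show "integral\<^sup>N lborel h = ennreal \<bar>det ?A\<bar> * (\<integral>\<^sup>+x. h (?A *v x) \<partial>lborel)"
    by (simp only: A d) simp
qed

text \<open>The matrix adds \<open>x $ n\<close> to coordinate \<open>m\<close>. Integrating over
  coordinate \<open>m\<close> first, with the others fixed in \<open>s\<close>, leaves a translation
  of the real line, because \<open>x $ n\<close> is constant along that line.\<close>

lemma scales_lborel_idplus:
  fixes m n :: "'n::finite"
  assumes mn: "m \<noteq> n"
  shows "scales_lborel (\<chi> i j. of_bool (i = m \<and> j = n \<or> i = j) :: real^'n^'n)" (is "scales_lborel ?A")
  unfolding scales_lborel_def
proof (intro impI ballI)
  fix h :: "real^'n \<Rightarrow> ennreal"
  assume h [measurable]: "h \<in> borel_measurable borel"
  have A': "?A = (\<chi> k. if k = m then row m (mat 1) + 1 *s row n (mat 1) else row k (mat 1))"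
    using mn by (auto simp: vec_eq_iff row_def mat_def)
  have "det ?A = det (mat 1 :: real^'n^'n)"
    unfolding A' by (rule det_row_operation[OF mn])
  then have d: "\<bar>det ?A\<bar> = 1" by simp
  define bm where "bm = (axis m 1 :: real^'n)"
  define I where "I = (Basis :: (real^'n) set) - {bm}"
  have I: "finite I" "bm \<notin> I" "insert bm I = Basis"
    by (auto simp: I_def bm_def Basis_vec_def)
  interpret product_sigma_finite "\<lambda>_::real^'n. lborel :: real measure"
    by standard
  have A: "?A *v x = x + (x $ n) *\<^sub>R bm" for x
  proof -
    have "(\<Sum>j\<in>UNIV. of_bool (i = m \<and> j = n \<or> i = j) * x $ j) = x $ i + (if i = m then x $ n else 0)" for i
    proof -
      have "(\<Sum>j\<in>UNIV. of_bool (i = m \<and> j = n \<or> i = j) * x $ j)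
          = (\<Sum>j\<in>UNIV. (if j = i then x $ j else 0) + (if j = n then (if i = m then x $ j else 0) else 0))"
        using mn by (intro sum.cong) auto
      then show ?thesis by (simp add: sum.distrib)
    qed
    then show ?thesis
      by (simp add: vec_eq_iff matrix_vector_mult_def bm_def axis_def)
  qed
  define T where "T s = (\<Sum>b\<in>Basis. s b *\<^sub>R b)" for s :: "real^'n \<Rightarrow> real"
  have T [measurable]: "T \<in> (\<Pi>\<^sub>M b\<in>Basis. lborel) \<rightarrow>\<^sub>M borel"
    unfolding T_def by measurable
  have T' [measurable]: "T \<in> (\<Pi>\<^sub>M b\<in>insert bm I. lborel) \<rightarrow>\<^sub>M borel"
    using T by (simp add: I)
  have lT: "(lborel :: (real^'n) measure) = distr (\<Pi>\<^sub>M b\<in>Basis. lborel) borel T"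
    unfolding T_def[abs_def] by (rule lborel_eq)
  have Tupd: "T (s(bm := t)) = (\<Sum>b\<in>I. s b *\<^sub>R b) + t *\<^sub>R bm" for s t
    unfolding T_def I(3)[symmetric] using I(1,2)
    by (simp add: add.commute) (rule sum.cong, auto)
  have Tn: "(T (s(bm := t))) $ n = (\<Sum>b\<in>I. s b *\<^sub>R b) $ n" for s t
  proof -
    have "bm $ n = 0" using mn by (simp add: bm_def axis_def)
    then show ?thesis by (simp add: Tupd)
  qed
  have lb: "integral\<^sup>N lborel g = (\<integral>\<^sup>+s. \<integral>\<^sup>+t. g (T (s(bm := t))) \<partial>lborel \<partial>(\<Pi>\<^sub>M b\<in>I. lborel))"
    if [measurable]: "g \<in> borel_measurable borel" for g :: "real^'n \<Rightarrow> ennreal"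
  proof -
    have "integral\<^sup>N lborel g = (\<integral>\<^sup>+s. g (T s) \<partial>(\<Pi>\<^sub>M b\<in>Basis. lborel))"
      by (subst lT) (simp add: nn_integral_distr)
    also have "\<dots> = (\<integral>\<^sup>+s. g (T s) \<partial>(\<Pi>\<^sub>M b\<in>insert bm I. lborel))"
      by (simp add: I)
    also have "\<dots> = (\<integral>\<^sup>+s. \<integral>\<^sup>+t. g (T (s(bm := t))) \<partial>lborel \<partial>(\<Pi>\<^sub>M b\<in>I. lborel))"
      by (rule product_nn_integral_insert[OF I(1,2)]) measurable
    finally show ?thesis .
  qed
  have "(\<integral>\<^sup>+x. h (?A *v x) \<partial>lborel)
      = (\<integral>\<^sup>+s. \<integral>\<^sup>+t. h (?A *v T (s(bm := t))) \<partial>lborel \<partial>(\<Pi>\<^sub>M b\<in>I. lborel))"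
    by (rule lb) measurable
  also have "\<dots> = (\<integral>\<^sup>+s. \<integral>\<^sup>+t. h (T (s(bm := t))) \<partial>lborel \<partial>(\<Pi>\<^sub>M b\<in>I. lborel))"
  proof (rule nn_integral_cong)
    fix s :: "real^'n \<Rightarrow> real"
    define r where "r = (\<Sum>b\<in>I. s b *\<^sub>R b) $ n"
    have [measurable]: "(\<lambda>t. T (s(bm := t))) \<in> borel_measurable borel"
      unfolding Tupd by measurable
    have eq: "?A *v T (s(bm := t)) = T (s(bm := r + 1 * t))" for t
      unfolding A Tn r_def[symmetric] by (simp add: Tupd scaleR_add_left)
    show "(\<integral>\<^sup>+t. h (?A *v T (s(bm := t))) \<partial>lborel) = (\<integral>\<^sup>+t. h (T (s(bm := t))) \<partial>lborel)"
      unfolding eq using nn_integral_real_affine[of "\<lambda>t. h (T (s(bm := t)))" 1 r] by simp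
  qed
  also have "\<dots> = integral\<^sup>N lborel h"
    by (rule lb[symmetric]) measurable
  finally show "integral\<^sup>N lborel h = ennreal \<bar>det ?A\<bar> * (\<integral>\<^sup>+x. h (?A *v x) \<partial>lborel)"
    unfolding d by simp
qed

lemma scales_lborel_matrix: "scales_lborel (A :: real^'n^'n)"
proof -
  have zr: "scales_lborel A" if "row i A = 0" for A :: "real^'n^'n" and i
    using det_zero_row(1)[OF that] unfolding scales_lborel_def by blast
  show ?thesis
  proof (rule induct_matrix_elementary_alt[of scales_lborel])
    show "scales_lborel (\<chi> i j. of_bool (i = m \<and> j = n \<or> i = j) :: real^'n^'n)" if "m \<noteq> n" for m n
      by (rule scales_lborel_idplus[OF that])
    show "scales_lborel (\<chi> i j. mat 1 $ i $ Transposition.transpose m n j :: real^'n^'n)" if "m \<noteq> n" for m n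
      by (rule scales_lborel_swap[OF that])
  qed (fact scales_lborel_mult zr scales_lborel_diagonal)+
qed

text \<open>Determinants live on \<open>real^'k\<close>; this carries them to spaces such as
  \<open>complex^'n\<close>, whose real basis is indexed by \<open>'n + 'n\<close>. The coordinate
  map matches boxes with boxes of the same side lengths.\<close>

lemma lborel_distr_coordinates:
  fixes b :: "'k::finite \<Rightarrow> 'a::euclidean_space"
  assumes b: "bij_betw b UNIV Basis"
  shows "lborel = distr lborel borel (\<lambda>x::real^'k. \<Sum>k\<in>UNIV. x $ k *\<^sub>R b k)" (is "_ = distr _ _ ?T")
proof (rule lborel_eqI)
  fix l u :: 'a assume le: "\<And>c. c \<in> Basis \<Longrightarrow> l \<bullet> c \<le> u \<bullet> c"
  have bB: "b k \<in> Basis" for k using b by (auto simp: bij_betw_def)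
  have inj: "b k = b j \<longleftrightarrow> k = j" for k j using b by (auto simp: bij_betw_def inj_on_def)
  have T: "?T x \<bullet> b k = x $ k" for x k
    by (simp add: inner_sum_left inner_Basis bB inj if_distrib cong: if_cong)
  have meas: "?T \<in> borel_measurable borel"
    by (intro borel_measurable_continuous_onI continuous_intros)
  have ball: "(\<forall>c\<in>Basis. P c) \<longleftrightarrow> (\<forall>k. P (b k))" for P
  proof -
    have "Basis = range b" using b by (simp add: bij_betw_def)
    then show ?thesis by (metis rangeE rangeI)
  qed
  have "?T -` box l u = box (\<chi> k. l \<bullet> b k) (\<chi> k. u \<bullet> b k)"
  proof (rule Set.set_eqI)
    fix x :: "real^'k"
    have "x \<in> ?T -` box l u \<longleftrightarrow> (\<forall>c\<in>Basis. l \<bullet> c < ?T x \<bullet> c \<and> ?T x \<bullet> c < u \<bullet> c)"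
      by (simp only: vimage_eq mem_box)
    also have "\<dots> \<longleftrightarrow> x \<in> box (\<chi> k. l \<bullet> b k) (\<chi> k. u \<bullet> b k)"
      by (simp only: ball T mem_box_cart vec_lambda_beta)
    finally show "x \<in> ?T -` box l u \<longleftrightarrow> x \<in> box (\<chi> k. l \<bullet> b k) (\<chi> k. u \<bullet> b k)" .
  qed
  then have "emeasure (distr lborel borel ?T) (box l u) = emeasure lborel (box (\<chi> k. l \<bullet> b k) (\<chi> k. u \<bullet> b k))"
    using meas by (simp add: emeasure_distr)
  also have "\<dots> = ennreal (\<Prod>c\<in>Basis. ((\<chi> k. u \<bullet> b k) - (\<chi> k. l \<bullet> b k)) \<bullet> c)"
    by (rule emeasure_lborel_box) (auto simp: Basis_vec_def inner_axis le bB)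
  also have "\<dots> = ennreal (\<Prod>k\<in>UNIV. (u - l) \<bullet> b k)"
    by (simp add: prod_Basis_vec inner_axis inner_diff_left)
  also have "\<dots> = (\<Prod>c\<in>Basis. (u - l) \<bullet> c)"
    by (simp add: prod.reindex_bij_betw[OF b, symmetric])
  finally show "emeasure (distr lborel borel ?T) (box l u) = (\<Prod>c\<in>Basis. (u - l) \<bullet> c)" .
qed simp

lemma nn_integral_linear_change:
  fixes b :: "'k::finite \<Rightarrow> 'a::euclidean_space" and L :: "'a \<Rightarrow> 'a"
  defines "A \<equiv> (\<chi> k l. b k \<bullet> L (b l)) :: real^'k^'k"
  assumes b: "bij_betw b UNIV Basis" and L: "linear L" and d: "det A \<noteq> 0"
    and h [measurable]: "h \<in> borel_measurable borel"
  shows "integral\<^sup>N lborel h = ennreal \<bar>det A\<bar> * (\<integral>\<^sup>+x. h (L x) \<partial>lborel)"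
proof -
  define T where "T x = (\<Sum>k\<in>UNIV. x $ k *\<^sub>R b k)" for x :: "real^'k"
  have T [measurable]: "T \<in> borel_measurable borel"
    unfolding T_def by (intro borel_measurable_continuous_onI continuous_intros)
  have Lm [measurable]: "L \<in> borel_measurable borel"
    using L by (intro borel_measurable_continuous_onI linear_continuous_on) (simp add: linear_conv_bounded_linear)
  have lT: "lborel = distr lborel borel T"
    unfolding T_def[abs_def] by (rule lborel_distr_coordinates[OF b])
  have rep: "(\<Sum>k\<in>UNIV. (y \<bullet> b k) *\<^sub>R b k) = y" for y
    using sum.reindex_bij_betw[OF b, of "\<lambda>c. (y \<bullet> c) *\<^sub>R c"] by (simp add: euclidean_representation)
  have LT: "T (A *v x) = L (T x)" for x
  proof -
    have "T (A *v x) = (\<Sum>k\<in>UNIV. \<Sum>l\<in>UNIV. x $ l *\<^sub>R ((L (b l) \<bullet> b k) *\<^sub>R b k))"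
      by (simp add: T_def matrix_vector_mult_def A_def scaleR_sum_left inner_commute mult.commute)
    also have "\<dots> = (\<Sum>l\<in>UNIV. x $ l *\<^sub>R (\<Sum>k\<in>UNIV. (L (b l) \<bullet> b k) *\<^sub>R b k))"
      by (subst sum.swap) (simp add: scaleR_sum_right)
    also have "\<dots> = L (T x)"
      by (simp add: rep T_def linear_sum[OF L] linear_scale[OF L])
    finally show ?thesis .
  qed
  have "integral\<^sup>N lborel h = (\<integral>\<^sup>+x. h (T x) \<partial>lborel)"
    by (subst lT) (simp add: nn_integral_distr)
  also have "\<dots> = ennreal \<bar>det A\<bar> * (\<integral>\<^sup>+x. h (T (A *v x)) \<partial>lborel)"
  proof -
    have "(\<lambda>x. h (T x)) \<in> borel_measurable borel" by measurable
    from scales_lborel_matrix[of A, unfolded scales_lborel_def, THEN mp, OF d, THEN bspec, OF this]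
    show ?thesis .
  qed
  also have "(\<integral>\<^sup>+x. h (T (A *v x)) \<partial>lborel) = (\<integral>\<^sup>+x. h (L x) \<partial>lborel)"
    unfolding LT by (subst lT) (simp add: nn_integral_distr)
  finally show ?thesis .
qed

section \<open>Isometries and multiplication by unimodular numbers\<close>

lemma nn_integral_isometry:
  fixes b :: "'k::finite \<Rightarrow> 'a::euclidean_space" and L :: "'a \<Rightarrow> 'a"
  assumes b: "bij_betw b UNIV Basis" and L: "linear L" and n: "\<And>x. norm (L x) = norm x"
    and h: "h \<in> borel_measurable borel"
  shows "(\<integral>\<^sup>+x. h (L x) \<partial>lborel) = integral\<^sup>N lborel h"
proof -
  define A where "A = (\<chi> k l. b k \<bullet> L (b l) :: real^'k^'k)"
  have bB: "b k \<in> Basis" for k using b by (auto simp: bij_betw_def)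
  have inj: "b k = b j \<longleftrightarrow> k = j" for k j using b by (auto simp: bij_betw_def inj_on_def)
  have inn: "L x \<bullet> L y = x \<bullet> y" for x y
    using orthogonal_transformation[of L] L n unfolding orthogonal_transformation_def by blast
  have "transpose A ** A = mat 1"
  proof -
    have "(\<Sum>k\<in>UNIV. (b k \<bullet> L (b i)) * (b k \<bullet> L (b j))) = L (b i) \<bullet> L (b j)" for i j
      using sum.reindex_bij_betw[OF b, of "\<lambda>c. (c \<bullet> L (b i)) * (c \<bullet> L (b j))"]
      by (simp add: euclidean_inner[of "L (b i)"] inner_commute)
    then show ?thesis
      by (simp add: vec_eq_iff matrix_matrix_mult_def transpose_def A_def inn inner_Basis bB inj mat_def)
  qed
  then have "det A * det A = 1"
    by (metis det_I det_mul det_transpose)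
  then have "det A \<noteq> 0" "\<bar>det A\<bar> = 1"
    by (auto simp: square_eq_1_iff)
  then show ?thesis
    using nn_integral_linear_change[OF b L _ h] by (simp add: A_def)
qed

definition complex_vec_basis :: "'n + 'n \<Rightarrow> complex^'n" where
  "complex_vec_basis = case_sum (\<lambda>i. axis i 1) (\<lambda>i. axis i \<i>)"

lemma bij_complex_vec_basis: "bij_betw complex_vec_basis UNIV (Basis :: (complex^'n) set)"
proof -
  have "inj (complex_vec_basis :: 'n + 'n \<Rightarrow> _)"
    by (rule injI) (auto simp: complex_vec_basis_def axis_eq_axis split: sum.splits)
  moreover have "range complex_vec_basis = (Basis :: (complex^'n) set)"
  proof -
    have "range complex_vec_basis = range (\<lambda>i. axis i 1) \<union> range (\<lambda>i::'n. axis i \<i>)"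
      unfolding UNIV_Plus_UNIV[symmetric] Plus_def image_Un image_image complex_vec_basis_def by simp
    also have "\<dots> = Basis"
      by (auto simp: Basis_vec_def Basis_complex_def)
    finally show ?thesis .
  qed
  ultimately show ?thesis by (simp add: bij_betw_def)
qed

lemma nn_integral_complex_vec_rotate:
  fixes h :: "complex^'n \<Rightarrow> ennreal"
  assumes "norm c = 1" "h \<in> borel_measurable borel"
  shows "(\<integral>\<^sup>+x. h (c *s x) \<partial>lborel) = integral\<^sup>N lborel h"
proof (rule nn_integral_isometry[OF bij_complex_vec_basis _ _ assms(2)])
  show "linear ((*s) c)"
    by (rule linearI) (simp_all add: vec_eq_iff algebra_simps)
  show "norm (c *s x) = norm x" for x :: "complex^'n"
    using assms(1) by (simp add: norm_vec_def norm_mult)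
qed

lemma nn_integral_complex_rotate:
  fixes h :: "complex \<Rightarrow> ennreal"
  assumes "norm c = 1" "h \<in> borel_measurable borel"
  shows "(\<integral>\<^sup>+x. h (c * x) \<partial>lborel) = integral\<^sup>N lborel h"
proof (rule nn_integral_isometry[where b = "\<lambda>t::bool. if t then 1 else \<i>", OF _ _ _ assms(2)])
  show "bij_betw (\<lambda>t. if t then 1 else \<i>) UNIV Basis"
    by (auto simp: bij_betw_def inj_on_def Basis_complex_def complex_eq_iff UNIV_bool)
  show "linear ((*) c)"
    by (rule linearI) (simp_all add: algebra_simps)
  show "norm (c * x) = norm x" for x :: complex
    using assms(1) by (simp add: norm_mult)
qed

section \<open>Block determinants and the Jacobian of the shear\<close>

lemma sum_UNIV_Plus: "(\<Sum>k\<in>(UNIV :: ('n::finite + 'n) set). g k) = (\<Sum>i\<in>UNIV. g (Inl i)) + (\<Sum>i\<in>UNIV. g (Inr i))"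
proof -
  have "(\<Sum>k\<in>(UNIV :: ('n::finite + 'n) set). g k) = (\<Sum>k\<in>(UNIV :: 'n set) <+> (UNIV :: 'n set). g k)" by (simp only: UNIV_Plus_UNIV)
  also have "\<dots> = (\<Sum>i\<in>UNIV. g (Inl i)) + (\<Sum>i\<in>UNIV. g (Inr i))" by (subst sum.Plus) (simp_all only: finite o_def)
  finally show ?thesis .
qed
lemma prod_UNIV_Plus: "(\<Prod>k\<in>(UNIV :: ('n::finite + 'n) set). g k) = (\<Prod>i\<in>UNIV. g (Inl i)) * (\<Prod>i\<in>UNIV. g (Inr i))"
proof -
  have "(\<Prod>k\<in>(UNIV :: ('n::finite + 'n) set). g k) = (\<Prod>k\<in>(UNIV :: 'n set) <+> (UNIV :: 'n set). g k)" by (simp only: UNIV_Plus_UNIV)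
  also have "\<dots> = (\<Prod>i\<in>UNIV. g (Inl i)) * (\<Prod>i\<in>UNIV. g (Inr i))" by (subst prod.Plus) (simp_all only: finite o_def)
  finally show ?thesis .
qed
lemma block_mat_1: "block_mat (mat 1) 0 0 (mat 1) = mat 1"
  by (auto simp add: vec_eq_iff block_mat_def mat_def split: sum.split)

lemma transpose_block_mat:
  "transpose (block_mat A B C D) = block_mat (transpose A) (transpose C) (transpose B) (transpose D)"
  by (auto simp add: vec_eq_iff block_mat_def transpose_def split: sum.split)
lemma block_mat_mult:
  "block_mat A B C D ** block_mat A' B' C' D' =
    block_mat (A ** A' + B ** C') (A ** B' + B ** D') (C ** A' + D ** C') (C ** B' + D ** D')"
proof -
  have "(block_mat A B C D ** block_mat A' B' C' D') $ i $ j =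
    block_mat (A ** A' + B ** C') (A ** B' + B ** D') (C ** A' + D ** C') (C ** B' + D ** D') $ i $ j" for i j
   by (cases i; cases j) (simp_all add: matrix_matrix_mult_def block_mat_def sum_UNIV_Plus)
  then show ?thesis by (simp add: vec_eq_iff)
qed

lemma mat_mult_component:
  fixes M :: "complex^'n^'n"
  shows "(mat c ** M) $ i $ j = c * M $ i $ j" "(M ** mat c) $ i $ j = c * M $ i $ j"
  by (simp_all add: matrix_matrix_mult_def mat_def if_distrib if_distribR mult.commute cong: if_cong)

text \<open>In the Leibniz sum a permutation that moves some \<open>Inr a\<close> meets a zero entry
  in row \<open>Inr a\<close>. The remaining ones permute the \<open>Inl\<close> indices only and
  have the same sign as the corresponding permutations of \<open>'n\<close>.\<close>

lemma det_block_diag: "det (block_mat A 0 0 (mat 1)) = det (A :: complex^'n^'n)"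
proof -
  define M where "M = block_mat A 0 0 (mat 1)"
  define F where "F p = of_int (sign p) * (\<Prod>k\<in>UNIV. M $ k $ p k)" for p
  let ?S = "{p. p permutes range (Inl :: 'n \<Rightarrow> 'n + 'n)}"
  have "det M = (\<Sum>p\<in>{p. p permutes UNIV}. F p)"
    by (simp add: det_def F_def)
  also have "\<dots> = (\<Sum>p\<in>?S. F p)"
  proof (rule sum.mono_neutral_right)
    show "?S \<subseteq> {p. p permutes UNIV}"
      by (auto intro: permutes_subset)
    show "\<forall>p\<in>{p. p permutes UNIV} - ?S. F p = 0"
    proof
      fix p assume p: "p \<in> {p. p permutes UNIV} - ?S"
      have "\<exists>a. p (Inr a) \<noteq> Inr a"
      proof (rule ccontr)
        assume "\<nexists>a. p (Inr a) \<noteq> Inr a"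
        then have fixp: "p x = x" if "x \<notin> range Inl" for x
          using that by (cases x) auto
        have "p permutes range Inl"
          unfolding permutes_def using p fixp by (auto simp: permutes_def)
        with p show False by simp
      qed
      then obtain a where a: "p (Inr a) \<noteq> Inr a" by blast
      then have "M $ Inr a $ p (Inr a) = 0"
        by (auto simp: M_def block_mat_def mat_def split: sum.split)
      then have "(\<Prod>k\<in>UNIV. M $ k $ p k) = 0"
        by (intro prod_zero) auto
      then show "F p = 0" by (simp add: F_def)
    qed
  qed simp
  also have "\<dots> = (\<Sum>q\<in>{q. q permutes UNIV}. of_int (sign q) * (\<Prod>i\<in>UNIV. A $ i $ q i))"
  proof (rule sum.reindex_bij_witness[where
        i = "map_permutation UNIV Inl" and j = "map_permutation (range Inl) (inv_into UNIV Inl)"])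
    fix p :: "'n + 'n \<Rightarrow> 'n + 'n" assume p: "p \<in> ?S"
    have bij: "bij_betw (inv_into UNIV Inl) (range (Inl :: 'n \<Rightarrow> 'n + 'n)) UNIV"
      by (intro bij_betw_inv_into) (simp add: bij_betw_def)
    show q: "map_permutation (range Inl) (inv_into UNIV Inl) p \<in> {q. q permutes UNIV}"
      using p bij by (auto intro: map_permutation_permutes)
    show eq: "map_permutation UNIV Inl (map_permutation (range Inl) (inv_into UNIV Inl) p) = p"
      using p bij by (intro map_permutation_compose_inv[where A = "range Inl"]) (auto simp: f_inv_into_f bij_betw_def)
    define q where "q = map_permutation (range Inl) (inv_into UNIV Inl) p"
    have qp: "p = map_permutation UNIV Inl q" and qq: "q permutes UNIV"
      using q eq by (auto simp: q_def)
    have 1: "sign p = sign q"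
      unfolding qp using qq by (intro sign_map_permutation) auto
    have 2: "p (Inl i) = Inl (q i)" for i
      unfolding qp by (rule map_permutation_apply) auto
    have 3: "p (Inr i) = Inr i" for i
      using p by (auto simp: permutes_def)
    show "of_int (sign (map_permutation (range Inl) (inv_into UNIV Inl) p)) *
         (\<Prod>i\<in>UNIV. A $ i $ map_permutation (range Inl) (inv_into UNIV Inl) p i) = F p"
      unfolding q_def[symmetric] F_def prod_UNIV_Plus 1 2 3
      by (simp add: M_def block_mat_def mat_def)
  next
    fix q :: "'n \<Rightarrow> 'n" assume q: "q \<in> {q. q permutes UNIV}"
    show "map_permutation UNIV Inl q \<in> ?S"
      using q by (auto intro!: map_permutation_permutes simp: bij_betw_def)
    show "map_permutation (range Inl) (inv_into UNIV Inl) (map_permutation UNIV Inl q) = q"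
      using q by (intro map_permutation_compose_inv) (auto simp: bij_betw_def)
  qed
  finally show ?thesis by (simp add: M_def det_def)
qed

text \<open>The determinant turns sums of \<open>C\<close> into products, and conjugation by \<open>diag(1, 2)\<close> replaces
  \<open>C\<close> by \<open>2 C\<close>; hence it equals its own square.\<close>
lemma det_block_lower_unit:
  fixes C :: "complex^'n^'n"
  shows "det (block_mat (mat 1) 0 C (mat 1)) = 1"
proof -
  define L where "L C = block_mat (mat 1) 0 C (mat 1)" for C :: "complex^'n^'n"
  define E :: "'n block" where "E = block_mat (mat 1) 0 0 (mat 2)"
  have mat_mult: "mat 2 ** M = M + M" "M ** mat 2 = M + M" for M :: "complex^'n^'n"
    by (simp_all add: vec_eq_iff matrix_matrix_mult_def mat_def if_distrib if_distribR cong: if_cong)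
  have LL: "L C ** L C' = L (C + C')" for C C'
    by (simp add: L_def block_mat_mult add.commute)
  have "E ** L C = L (C + C) ** E"
    by (simp add: L_def E_def block_mat_mult mat_mult(1)[of C])
  then have "det E * det (L C) = det (L C) * det (L C) * det E"
    by (metis det_mul LL)
  moreover have "det E \<noteq> 0"
  proof -
    have "(mat 2 :: complex^'n^'n) ** mat (1/2) = mat 1"
      by (simp add: vec_eq_iff mat_mult_component, simp add: mat_def)
    then have "E ** block_mat (mat 1) 0 0 (mat (1/2)) = mat 1"
      by (simp add: E_def block_mat_mult block_mat_1)
    then have "det E * det (block_mat (mat 1) 0 0 (mat (1/2)) :: 'n block) = 1"
      by (metis det_I det_mul)
    then show ?thesis by auto
  qed
  moreover have "det (L C) \<noteq> 0"
  proof -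
    have "L C ** L (- C) = mat 1" using LL[of C "- C"] by (simp add: L_def block_mat_1)
    then have "det (L C) * det (L (- C)) = 1" by (metis det_I det_mul)
    then show ?thesis by auto
  qed
  ultimately show ?thesis by (auto simp: L_def)
qed

lemma det_block_upper_unit:
  fixes B :: "complex^'n^'n"
  shows "det (block_mat (mat 1) B 0 (mat 1)) = 1"
proof -
  have t0: "transpose (0 :: complex^'n^'n) = 0" by (simp add: vec_eq_iff transpose_def)
  have "det (block_mat (mat 1) B 0 (mat 1)) = det (transpose (block_mat (mat 1) B 0 (mat 1)))"
    by (simp only: det_transpose)
  also have "\<dots> = 1"
    by (simp only: transpose_block_mat transpose_mat t0 det_block_lower_unit)
  finally show ?thesis .
qed

lemma matrix_mult_minus_left: "(- A) ** B = - (A ** B :: complex^'n^'m)"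
  by (simp add: vec_eq_iff matrix_matrix_mult_def sum_negf)

lemma matrix_mult_minus_right: "A ** (- B) = - (A ** B :: complex^'n^'m)"
  by (simp add: vec_eq_iff matrix_matrix_mult_def sum_negf)

text \<open>Schur complement: one block row operation clears \<open>B\<close>, and what is left
  factors into a block diagonal and a unipotent matrix.\<close>

lemma det_block_unit_diag:
  fixes B C :: "complex^'n^'n"
  shows "det (block_mat (mat 1) B C (mat 1)) = det (mat 1 - B ** C)"
proof -
  have "block_mat (mat 1) (- B) 0 (mat 1) ** block_mat (mat 1) B C (mat 1) =
    block_mat (mat 1 - B ** C) 0 0 (mat 1) ** block_mat (mat 1) 0 C (mat 1)"
    by (simp add: block_mat_mult matrix_mult_minus_left)
  then have "det (block_mat (mat 1) (- B) 0 (mat 1)) * det (block_mat (mat 1) B C (mat 1)) =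
    det (block_mat (mat 1 - B ** C) 0 0 (mat 1)) * det (block_mat (mat 1) 0 C (mat 1))"
    by (simp only: det_mul[symmetric])
  then show ?thesis
    by (simp only: det_block_lower_unit det_block_upper_unit det_block_diag) simp
qed

text \<open>Over the complex numbers, the real matrix of \<open>x \<mapsto> x - Y cnj x\<close> is conjugate to the block matrix
  \<open>(1, - Y; - cnj Y, 1)\<close> by the change of coordinates to \<open>(x, cnj x)\<close>.\<close>
lemma nn_integral_shear_conj:
  fixes Y :: "complex^'n^'n"
  assumes d: "det (mat 1 - Y ** cnj_mat Y) \<noteq> 0" and h: "h \<in> borel_measurable borel"
  shows "integral\<^sup>N lborel h =
    ennreal (cmod (det (mat 1 - Y ** cnj_mat Y))) * (\<integral>\<^sup>+x. h (x - Y *v cnj_vec x) \<partial>lborel)"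
proof -
  define L where "L x = x - Y *v cnj_vec x" for x :: "complex^'n"
  have L: "linear L"
    by (rule linearI) (simp_all add: L_def vec_eq_iff matrix_vector_mult_def cnj_vec_def
        algebra_simps sum.distrib scaleR_sum_right)
  define A where "A = (\<chi> k l. complex_vec_basis k \<bullet> L (complex_vec_basis l) :: real^('n + 'n)^('n + 'n))"
  define AC where "AC = (\<chi> k l. complex_of_real (A $ k $ l))"
  have "det AC = of_real (det A)"
    by (simp add: det_def AC_def)
  have axis_inner: "axis i 1 \<bullet> v = Re (v $ i)" "axis i \<i> \<bullet> v = Im (v $ i)" for i and v :: "complex^'n"
    by (simp_all add: inner_axis' inner_complex_def)
  have Lb: "L (axis j 1) $ i = (if i = j then 1 else 0) - Y $ i $ j"
    "L (axis j \<i>) $ i = (if i = j then \<i> else 0) + \<i> * Y $ i $ j" for i j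
    by (simp_all add: L_def matrix_vector_mult_def cnj_vec_def axis_def if_distrib cong: if_cong)
  define S :: "'n block" where "S = block_mat (mat 1) (mat \<i>) (mat 1) (mat (- \<i>))"
  have AC: "AC = block_mat (\<chi> i j. (if i = j then 1 else 0) - of_real (Re (Y $ i $ j))) (\<chi> i j. - of_real (Im (Y $ i $ j)))
     (\<chi> i j. - of_real (Im (Y $ i $ j))) (\<chi> i j. (if i = j then 1 else 0) + of_real (Re (Y $ i $ j)))"
    by (simp add: vec_eq_iff AC_def A_def complex_vec_basis_def block_mat_def axis_inner Lb split: sum.split)
  have "S ** AC = block_mat (mat 1) (- Y) (- cnj_mat Y) (mat 1) ** S"
    unfolding AC S_def block_mat_mult
    by (intro arg_cong4[where f = block_mat])
      (auto simp: vec_eq_iff mat_mult_component complex_eq_iff cnj_mat_def, simp_all add: mat_def)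
  then have "det (S ** AC) = det (block_mat (mat 1) (- Y) (- cnj_mat Y) (mat 1) ** S)"
    by simp
  then have "det S * det AC = det (mat 1 - Y ** cnj_mat Y) * det S"
    by (simp add: det_mul det_block_unit_diag matrix_mult_minus_left matrix_mult_minus_right)
  moreover have "det S \<noteq> 0"
  proof -
    have "S ** block_mat (mat (1/2)) (mat (1/2)) (mat (-\<i>/2)) (mat (\<i>/2)) = mat 1"
      unfolding S_def block_mat_mult block_mat_1[symmetric]
      by (intro arg_cong4[where f = block_mat]) (auto simp: vec_eq_iff mat_mult_component, simp_all add: mat_def)
    then have "det S * det (block_mat (mat (1/2)) (mat (1/2)) (mat (-\<i>/2)) (mat (\<i>/2)) :: 'n block) = 1"
      by (metis det_I det_mul)
    then show ?thesis by auto
  qed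
  ultimately have "of_real (det A) = det (mat 1 - Y ** cnj_mat Y)"
    using \<open>det AC = of_real (det A)\<close> by simp
  then have "det A \<noteq> 0" "\<bar>det A\<bar> = cmod (det (mat 1 - Y ** cnj_mat Y))"
    using d by (auto simp flip: norm_of_real[where 'a = complex])
  with nn_integral_linear_change[OF bij_complex_vec_basis L _ h]
  show ?thesis by (simp add: A_def L_def)
qed

section \<open>The bilinear pairing and the disc of symmetric contractions\<close>

lemma bil_commute: "z \<star> w = w \<star> z"
  by (simp add: bil_def mult.commute)

lemma bil_add_left: "(z + z') \<star> w = z \<star> w + z' \<star> w"
  by (simp add: bil_def sum.distrib algebra_simps)

lemma bil_add_right: "w \<star> (z + z') = w \<star> z + w \<star> z'"
  by (simp add: bil_def sum.distrib algebra_simps)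

lemma bil_diff_left: "(z - z') \<star> w = z \<star> w - z' \<star> w"
  by (simp add: bil_def sum_subtractf algebra_simps)

lemma bil_diff_right: "w \<star> (z - z') = w \<star> z - w \<star> z'"
  by (simp add: bil_def sum_subtractf algebra_simps)

lemma bil_minus_right: "w \<star> (- z) = - (w \<star> z)"
  by (simp add: bil_def sum_negf)

lemma bil_scale_left: "(c *s z) \<star> w = c * (z \<star> w)"
  by (simp add: bil_def sum_distrib_left mult.assoc)

lemma bil_scale_right: "w \<star> (c *s z) = c * (w \<star> z)"
  by (simp add: bil_def sum_distrib_left mult_ac)

lemma bil_0 [simp]: "0 \<star> w = 0" "w \<star> 0 = 0"
  by (simp_all add: bil_def)

lemma bil_mv: "z \<star> (M *v w) = (transpose M *v z) \<star> w"
proof -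
  have "z \<star> (M *v w) = (\<Sum>i\<in>UNIV. \<Sum>j\<in>UNIV. z $ i * (M $ i $ j * w $ j))"
    by (simp add: bil_def matrix_vector_mult_def sum_distrib_left)
  also have "\<dots> = (\<Sum>j\<in>UNIV. \<Sum>i\<in>UNIV. z $ i * (M $ i $ j * w $ j))"
    by (rule sum.swap)
  also have "\<dots> = (transpose M *v z) \<star> w"
    by (simp add: bil_def matrix_vector_mult_def transpose_def sum_distrib_left sum_distrib_right mult_ac)
  finally show ?thesis .
qed

lemma cnj_vec_simps [simp]:
  "cnj_vec (cnj_vec z) = z" "cnj_vec 0 = 0" "cnj_vec (z + w) = cnj_vec z + cnj_vec w"
  "cnj_vec (z - w) = cnj_vec z - cnj_vec w" "cnj_vec (- z) = - cnj_vec z"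
  "cnj_vec (c *s z) = cnj c *s cnj_vec z" "norm (cnj_vec z) = norm z"
  by (simp_all add: vec_eq_iff cnj_vec_def norm_vec_def)

lemma cnj_vec_eq_0_iff [simp]: "cnj_vec z = 0 \<longleftrightarrow> z = 0"
  by (simp add: vec_eq_iff cnj_vec_def)

lemma cnj_vec_mv: "cnj_vec (M *v z) = cnj_mat M *v cnj_vec z"
  by (simp add: vec_eq_iff cnj_vec_def cnj_mat_def matrix_vector_mult_def)

lemma cnj_mat_simps [simp]:
  "cnj_mat (cnj_mat M) = M" "cnj_mat 0 = 0" "cnj_mat (M + N) = cnj_mat M + cnj_mat N"
  "cnj_mat (M - N) = cnj_mat M - cnj_mat N" "cnj_mat (- M) = - cnj_mat M"
  "cnj_mat (mat 1) = mat 1"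
  by (simp_all add: vec_eq_iff cnj_mat_def mat_def)

lemma cnj_mat_mult: "cnj_mat (M ** N) = cnj_mat M ** cnj_mat N"
  by (simp add: vec_eq_iff cnj_mat_def matrix_matrix_mult_def)

lemma cnj_mat_transpose: "cnj_mat (transpose M) = transpose (cnj_mat M)"
  by (simp add: vec_eq_iff cnj_mat_def transpose_def)

lemma transpose_diff: "transpose (M - N) = transpose M - transpose (N :: complex^'n^'m)"
  by (simp add: vec_eq_iff transpose_def)

lemma transpose_add: "transpose (M + N) = transpose M + transpose (N :: complex^'n^'m)"
  by (simp add: vec_eq_iff transpose_def)

lemma transpose_minus: "transpose (- M) = - transpose (M :: complex^'n^'m)"
  by (simp add: vec_eq_iff transpose_def)

lemma det_cnj_mat: "det (cnj_mat M) = cnj (det M)"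
  by (simp add: det_def cnj_mat_def)

lemma cnj_bil: "cnj (z \<star> w) = cnj_vec z \<star> cnj_vec w"
  by (simp add: bil_def cnj_vec_def)

lemma bil_cnj_self: "z \<star> cnj_vec z = of_real ((norm z)\<^sup>2)"
proof -
  have "z \<star> cnj_vec z = of_real (\<Sum>j\<in>UNIV. (cmod (z $ j))\<^sup>2)"
    by (simp add: bil_def cnj_vec_def complex_norm_square flip: of_real_power)
  also have "(\<Sum>j\<in>UNIV. (cmod (z $ j))\<^sup>2) = (norm z)\<^sup>2"
    by (simp add: norm_vec_def L2_set_def sum_nonneg)
  finally show ?thesis .
qed

lemma Re_bil_cnj: "Re (z \<star> cnj_vec w) = z \<bullet> w"
  by (simp add: bil_def cnj_vec_def inner_vec_def inner_complex_def)

lemma cmod_bil_le: "cmod (z \<star> w) \<le> norm z * norm w"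
proof -
  have "cmod (z \<star> w) \<le> (\<Sum>j\<in>UNIV. \<bar>cmod (z $ j)\<bar> * \<bar>cmod (w $ j)\<bar>)"
    unfolding bil_def by (rule order_trans[OF norm_sum]) (simp add: norm_mult)
  also have "\<dots> \<le> norm z * norm w"
    unfolding norm_vec_def by (rule L2_set_mult_ineq)
  finally show ?thesis .
qed

lemma mv_bound: "\<exists>K>0. \<forall>z. norm ((M :: complex^'n^'m) *v z) \<le> K * norm z"
proof -
  have "bounded_linear ((*v) M)" by simp
  from bounded_linear.pos_bounded[OF this] show ?thesis
    by (auto simp: mult.commute)
qed

lemma mv_minus: "(- M) *v z = - (M *v (z :: complex^'n))"
  by (simp add: vec_eq_iff matrix_vector_mult_def sum_negf)

lemma mv_scale: "M *v (c *s z) = c *s (M *v (z :: complex^'n))"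
  by (simp add: vec_eq_iff matrix_vector_mult_def sum_distrib_left mult_ac)

lemma cmod_det_le:
  fixes M :: "complex^'n^'n"
  assumes "\<And>i j. cmod (M $ i $ j) \<le> B"
  shows "cmod (det M) \<le> fact CARD('n) * B ^ CARD('n)"
proof -
  have "cmod (det M) \<le> (\<Sum>p\<in>{p. p permutes (UNIV :: 'n set)}. cmod (of_int (sign p) * (\<Prod>i\<in>UNIV. M $ i $ p i)))"
    unfolding det_def by (rule norm_sum)
  also have "\<dots> \<le> (\<Sum>p\<in>{p. p permutes (UNIV :: 'n set)}. B ^ CARD('n))"
  proof (rule sum_mono)
    fix p :: "'n \<Rightarrow> 'n"
    have "cmod (\<Prod>i\<in>UNIV. M $ i $ p i) \<le> (\<Prod>i\<in>(UNIV :: 'n set). B)"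
      unfolding prod_norm[symmetric] by (rule prod_mono) (simp add: assms)
    moreover have "cmod (of_int (sign p)) = 1"
      by (simp add: sign_def)
    ultimately show "cmod (of_int (sign p) * (\<Prod>i\<in>UNIV. M $ i $ p i)) \<le> B ^ CARD('n)"
      by (simp add: norm_mult)
  qed
  also have "\<dots> = fact CARD('n) * B ^ CARD('n)"
    by (simp add: card_permutations[of UNIV "CARD('n)"])
  finally show ?thesis .
qed

lemma cmod_component_le:
  fixes M :: "complex^'n^'n"
  assumes "\<And>z. norm (M *v z) \<le> K * norm z"
  shows "cmod (M $ i $ j) \<le> K"
proof -
  have "M $ i $ j = (M *v axis j 1) $ i"
    by (simp add: matrix_vector_mult_def axis_def if_distrib cong: if_cong)
  then have "cmod (M $ i $ j) \<le> norm (M *v axis j 1)"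
    by (metis Finite_Cartesian_Product.norm_nth_le)
  also have "\<dots> \<le> K" using assms[of "axis j 1"] by simp
  finally show ?thesis .
qed

lemma matrix_inv_mult:
  fixes M :: "complex^'n^'n"
  assumes "det M \<noteq> 0"
  shows "matrix_inv M ** M = mat 1" "M ** matrix_inv M = mat 1"
proof -
  have "\<exists>N. M ** N = mat 1 \<and> N ** M = mat 1"
    using assms by (simp add: invertible_det_nz[symmetric] invertible_def)
  from someI_ex[OF this] show "matrix_inv M ** M = mat 1" "M ** matrix_inv M = mat 1"
    by (simp_all add: matrix_inv_def)
qed

lemma matrix_inv_unique:
  fixes M :: "complex^'n^'n"
  assumes "M ** N = mat 1"
  shows "matrix_inv M = N"
proof -
  have "det M * det N = 1" using assms by (metis det_I det_mul)
  then have "det M \<noteq> 0" by auto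
  then show ?thesis
    by (metis assms matrix_inv_mult(1) matrix_mul_assoc matrix_mul_lid matrix_mul_rid)
qed

lemma det_nz_if_injective:
  fixes M :: "complex^'n^'n"
  assumes "\<And>z. M *v z = 0 \<Longrightarrow> z = 0"
  shows "det M \<noteq> 0"
proof -
  have "\<exists>N. N ** M = mat 1" using assms by (simp add: matrix_left_invertible_ker)
  then obtain N where "N ** M = mat 1" ..
  then have "det N * det M = 1" by (metis det_I det_mul)
  then show ?thesis by auto
qed

section \<open>Symmetric strict contractions\<close>

definition sym_disc :: "(complex^'n^'n) set" where
  "sym_disc = {Y. transpose Y = Y \<and> (\<forall>z. z \<noteq> 0 \<longrightarrow> norm (Y *v z) < norm z)}"

lemma sym_discD:
  assumes "Y \<in> sym_disc"
  shows "transpose Y = Y" "z \<noteq> 0 \<Longrightarrow> norm (Y *v z) < norm z" "norm (Y *v z) \<le> norm z"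
  using assms by (auto simp: sym_disc_def) (cases "z = 0"; force)

lemma sym_disc_symmetric: "Y \<in> sym_disc \<Longrightarrow> Y $ i $ j = Y $ j $ i"
  by (metis sym_discD(1) transpose_def vec_lambda_beta)

text \<open>For symmetric \<open>Y\<close> the matrix \<open>cnj_mat Y\<close> is the adjoint of
  \<open>Y\<close>, so the form at \<open>z\<close> is the difference of the squared norms of
  \<open>z\<close> and \<open>Y *v cnj_vec z\<close>; the conjugation is harmless as
  \<open>z\<close> runs over all vectors. The norm condition is the one that scaling and the group
  action respect visibly.\<close>

lemma pos_def_sym_disc:
  assumes Y: "transpose Y = (Y :: complex^'n^'n)"
  shows "pos_def (mat 1 - Y ** cnj_mat Y) \<longleftrightarrow> (\<forall>z. z \<noteq> 0 \<longrightarrow> norm (Y *v z) < norm z)"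
proof -
  have eq: "cnj_vec z \<star> ((mat 1 - Y ** cnj_mat Y) *v z) = of_real ((norm z)\<^sup>2 - (norm (Y *v cnj_vec z))\<^sup>2)" for z
  proof -
    have "cnj_vec z \<star> ((mat 1 - Y ** cnj_mat Y) *v z) = cnj_vec z \<star> z - cnj_vec z \<star> (Y *v (cnj_mat Y *v z))"
      by (simp add: matrix_vector_mult_diff_rdistrib bil_diff_right matrix_vector_mul_assoc)
    also have "cnj_vec z \<star> (Y *v (cnj_mat Y *v z)) = (Y *v cnj_vec z) \<star> cnj_vec (Y *v cnj_vec z)"
      unfolding bil_mv[of "cnj_vec z"] Y by (simp add: cnj_vec_mv)
    finally show ?thesis by (simp add: bil_cnj_self bil_commute[of "cnj_vec z" z])
  qed
  have "pos_def (mat 1 - Y ** cnj_mat Y) \<longleftrightarrow> (\<forall>z. z \<noteq> 0 \<longrightarrow> norm (Y *v cnj_vec z) < norm z)"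
    unfolding pos_def_def eq Re_complex_of_real diff_gt_0_iff_gt
    by (simp add: power_mono_iff not_le[symmetric])
  also have "\<dots> \<longleftrightarrow> (\<forall>z. z \<noteq> 0 \<longrightarrow> norm (Y *v z) < norm z)"
    by (metis cnj_vec_simps(1,7) cnj_vec_eq_0_iff)
  finally show ?thesis .
qed

lemma jacobi_dom_eq: "jacobi_dom = UNIV \<times> sym_disc"
  using pos_def_sym_disc by (auto simp: jacobi_dom_def sym_disc_def)

text \<open>Compactness of the unit sphere upgrades the pointwise strict inequality to a uniform
  factor.\<close>

lemma sym_disc_contraction:
  assumes Y: "Y \<in> sym_disc"
  shows "\<exists>r<1. 0 \<le> r \<and> (\<forall>z. norm (Y *v z) \<le> r * norm z)"
proof -
  have "compact (sphere (0::complex^'n) 1)" "sphere (0::complex^'n) 1 \<noteq> {}" by auto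
  moreover have "continuous_on (sphere 0 1) (\<lambda>z. norm (Y *v z))"
    by (intro continuous_intros)
  ultimately obtain w where w: "w \<in> sphere 0 1" "\<And>z. z \<in> sphere 0 1 \<Longrightarrow> norm (Y *v z) \<le> norm (Y *v w)"
    using continuous_attains_sup by metis
  have w1: "norm w = 1" using w by simp
  then have "norm (Y *v w) < 1" using sym_discD(2)[OF Y, of w] by fastforce
  moreover have "norm (Y *v z) \<le> norm (Y *v w) * norm z" for z
  proof (cases "z = 0")
    case False
    have "norm (Y *v (z /\<^sub>R norm z)) \<le> norm (Y *v w)"
      using False by (intro w(2)) simp
    then show ?thesis using False
      by (simp add: scaleR_matrix_vector_assoc[symmetric] linear_scale[OF matrix_vector_mul_linear] field_simps)
  qed simp
  ultimately show ?thesis by (intro exI[of _ "norm (Y *v w)"]) auto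
qed

text \<open>The defining condition is a strict inequality for uncountably many \<open>z\<close>. By
  \<open>sym_disc_contraction\<close> it holds with some factor \<open>1 - 1 / real (Suc k)\<close>,
  which presents the disc as a countable union of closed sets.\<close>

lemma sym_disc_borel [measurable]: "sym_disc \<in> sets borel"
proof -
  have eq: "sym_disc = {Y. transpose Y = (Y :: complex^'n^'n)} \<inter>
    (\<Union>k::nat. {Y. \<forall>z. norm (Y *v z) \<le> (1 - 1 / real (Suc k)) * norm z})" (is "_ = ?S \<inter> (\<Union>k. ?T k)")
  proof safe
    fix Y :: "complex^'n^'n" assume Y: "Y \<in> sym_disc"
    show "transpose Y = Y" using Y by (rule sym_discD)
    obtain r where r: "r < 1" "\<And>z. norm (Y *v z) \<le> r * norm z"
      using sym_disc_contraction[OF Y] by blast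
    obtain k where k: "1 / real (Suc k) < 1 - r"
      using r(1) nat_approx_posE[of "1 - r"] by auto
    have "norm (Y *v z) \<le> (1 - 1 / real (Suc k)) * norm z" for z
      by (rule order_trans[OF r(2)]) (use k in \<open>intro mult_right_mono, auto\<close>)
    then show "Y \<in> (\<Union>k. ?T k)" by blast
  next
    fix Y :: "complex^'n^'n" and k
    assume Y: "transpose Y = Y" and b: "\<forall>z. norm (Y *v z) \<le> (1 - 1 / real (Suc k)) * norm z"
    have "norm (Y *v z) < norm z" if "z \<noteq> 0" for z
    proof -
      have "norm (Y *v z) \<le> (1 - 1 / real (Suc k)) * norm z" using b by blast
      also have "\<dots> < 1 * norm z" using that by (intro mult_strict_right_mono) auto
      finally show ?thesis by simp
    qed
    then show "Y \<in> sym_disc" using Y by (simp add: sym_disc_def)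
  qed
  have "closed ?S"
    unfolding transpose_def by (intro closed_Collect_eq continuous_intros)
  moreover have "closed (?T k)" for k
    unfolding matrix_vector_mult_def by (intro closed_Collect_all closed_Collect_le continuous_intros)
  ultimately have "?S \<inter> (\<Union>k. ?T k) \<in> sets borel"
    by (intro sets.Int sets.countable_UN) (auto intro: borel_closed)
  then show ?thesis unfolding eq .
qed

lemma det_sym_disc_nz:
  assumes Y: "Y \<in> sym_disc"
  shows "det (mat 1 - Y ** cnj_mat Y) \<noteq> 0"
proof (rule det_nz_if_injective)
  fix z assume "(mat 1 - Y ** cnj_mat Y) *v z = 0"
  then have z: "z = Y *v (cnj_mat Y *v z)"
    by (simp add: matrix_vector_mult_diff_rdistrib matrix_vector_mul_assoc)
  show "z = 0"
  proof (rule ccontr)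
    assume nz: "z \<noteq> 0"
    have "norm z = norm (Y *v (cnj_mat Y *v z))" using z by simp
    also have "\<dots> \<le> norm (cnj_mat Y *v z)" by (rule sym_discD(3)[OF Y])
    also have "\<dots> = norm (Y *v cnj_vec z)"
      by (metis cnj_vec_mv cnj_vec_simps(1,7))
    also have "\<dots> < norm z" using sym_discD(2)[OF Y, of "cnj_vec z"] nz by simp
    finally show False by simp
  qed
qed

lemma transpose_one_minus:
  assumes Y: "transpose Y = (Y :: complex^'n^'n)"
  shows "transpose (mat 1 - Y ** cnj_mat Y) = mat 1 - cnj_mat Y ** Y"
  using Y by (simp add: transpose_diff matrix_transpose_mul transpose_mat cnj_mat_transpose[symmetric])

lemma det_sym_disc_real:
  assumes Y: "Y \<in> sym_disc"
  shows "det (mat 1 - Y ** cnj_mat Y) \<in> \<real>"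
proof -
  have "cnj (det (mat 1 - Y ** cnj_mat Y)) = det (transpose (mat 1 - Y ** cnj_mat Y))"
    unfolding transpose_one_minus[OF sym_discD(1)[OF Y]]
    by (simp add: det_cnj_mat[symmetric] cnj_mat_mult)
  then show ?thesis by (simp add: Reals_cnj_iff)
qed

definition scale_mat :: "complex \<Rightarrow> complex^'n^'n \<Rightarrow> complex^'n^'n" where
  "scale_mat c Y = (\<chi> i j. c * Y $ i $ j)"

lemma scale_mat_mv: "scale_mat c Y *v z = c *s (Y *v z)"
  by (simp add: vec_eq_iff scale_mat_def matrix_vector_mult_def sum_distrib_left mult_ac)

lemma norm_scale: "norm (c *s (z :: complex^'n)) = cmod c * norm z"
  by (simp add: norm_vec_def norm_mult L2_set_right_distrib)

lemma scale_mat_sym_disc: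
  assumes "Y \<in> sym_disc" "cmod c \<le> 1"
  shows "scale_mat c Y \<in> sym_disc"
proof -
  have "transpose (scale_mat c Y) = scale_mat c Y"
    using sym_disc_symmetric[OF assms(1)] by (simp add: vec_eq_iff transpose_def scale_mat_def)
  moreover have "norm (scale_mat c Y *v z) < norm z" if "z \<noteq> 0" for z
  proof -
    have "norm (scale_mat c Y *v z) \<le> 1 * norm (Y *v z)"
      unfolding scale_mat_mv norm_scale using assms(2) by (intro mult_right_mono) auto
    also have "\<dots> < norm z" using sym_discD(2)[OF assms(1) that] by simp
    finally show ?thesis .
  qed
  ultimately show ?thesis by (simp add: sym_disc_def)
qed

lemma continuous_on_det [continuous_intros]:
  fixes f :: "'a::topological_space \<Rightarrow> complex^'n^'n"
  assumes "continuous_on S f"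
  shows "continuous_on S (\<lambda>x. det (f x))"
  unfolding det_def using assms by (intro continuous_intros)

definition disc_det :: "complex^'n^'n \<Rightarrow> real" where
  "disc_det Y = Re (det (mat 1 - Y ** cnj_mat Y))"

lemma det_eq_disc_det: "Y \<in> sym_disc \<Longrightarrow> det (mat 1 - Y ** cnj_mat Y) = of_real (disc_det Y)"
  unfolding disc_det_def by (rule of_real_Re[symmetric, OF det_sym_disc_real])

lemma continuous_disc_det: "continuous_on UNIV (disc_det :: complex^'n^'n \<Rightarrow> real)"
  unfolding disc_det_def[abs_def] matrix_matrix_mult_def cnj_mat_def
  by (intro continuous_intros)

lemma disc_det_measurable [measurable]: "disc_det \<in> borel_measurable borel"
  by (intro borel_measurable_continuous_onI continuous_disc_det)

text \<open>The determinant is real and does not vanish along the segment from \<open>0\<close> to \<open>Y\<close>.\<close>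
lemma disc_det_pos:
  assumes Y: "Y \<in> sym_disc"
  shows "disc_det Y > 0"
proof (rule ccontr)
  assume neg: "\<not> disc_det Y > 0"
  define g where "g t = disc_det (scale_mat (of_real t) Y)" for t
  have "continuous_on UNIV (\<lambda>t. scale_mat (complex_of_real t) Y)"
    unfolding scale_mat_def by (intro continuous_intros)
  then have c: "continuous_on {0..1} g"
    unfolding g_def using continuous_on_compose2[OF continuous_disc_det] continuous_on_subset by blast
  have "scale_mat 0 Y = 0" "scale_mat 1 Y = Y" by (simp_all add: scale_mat_def vec_eq_iff)
  then have g01: "g 0 = 1" "g 1 = disc_det Y" by (simp_all add: g_def disc_det_def)
  obtain t where t: "0 \<le> t" "t \<le> 1" "g t = 0"
    using IVT2'[of g 1 0 0] c g01 neg by auto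
  have "scale_mat (of_real t) Y \<in> sym_disc"
    using Y t by (intro scale_mat_sym_disc) auto
  then show False
    using det_sym_disc_nz det_eq_disc_det t(3) by (metis g_def of_real_0)
qed

lemma sym_disc_component_le: "Y \<in> sym_disc \<Longrightarrow> cmod (Y $ i $ j) \<le> 1"
  by (rule cmod_component_le) (simp add: sym_discD)

lemma disc_det_bound: "\<exists>B>0. \<forall>Y\<in>(sym_disc :: (complex^'n^'n) set). disc_det Y \<le> B"
proof -
  define B where "B = fact CARD('n) * (1 + real CARD('n)) ^ CARD('n)"
  have "disc_det Y \<le> B" if Y: "Y \<in> sym_disc" for Y :: "complex^'n^'n"
  proof -
    have "cmod ((mat 1 - Y ** cnj_mat Y) $ i $ j) \<le> 1 + real CARD('n)" for i j
    proof -
      have "cmod ((Y ** cnj_mat Y) $ i $ j) \<le> (\<Sum>k\<in>(UNIV :: 'n set). 1)"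
        unfolding matrix_matrix_mult_def cnj_mat_def vec_lambda_beta
        by (rule order_trans[OF norm_sum], rule sum_mono)
          (use sym_disc_component_le[OF Y] in \<open>auto simp: norm_mult intro!: mult_le_one\<close>)
      moreover have "cmod (mat 1 $ i $ j) \<le> 1" by (simp add: mat_def)
      ultimately show ?thesis
        using norm_triangle_ineq4[of "mat 1 $ i $ j" "(Y ** cnj_mat Y) $ i $ j"] by simp
    qed
    from cmod_det_le[OF this] show ?thesis
      unfolding B_def disc_det_def using complex_Re_le_cmod order_trans by blast
  qed
  moreover have "B > 0" by (simp add: B_def)
  ultimately show ?thesis by blast
qed

section \<open>The coordinates \<open>(x, Y)\<close> and the diagonal of the kernel\<close>

definition shear_conj :: "'n::finite point \<Rightarrow> 'n point" where
  "shear_conj = (\<lambda>(x, Y). (x - Y *v cnj_vec x, Y))"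

definition quad :: "complex^'n \<Rightarrow> complex^'n^'n \<Rightarrow> real" where
  "quad x Y = (norm x)\<^sup>2 - Re (cnj_vec x \<star> (Y *v cnj_vec x))"

lemma quad_eq: "quad x Y = Re ((x - Y *v cnj_vec x) \<star> cnj_vec x)"
  by (simp add: quad_def bil_diff_left bil_cnj_self) (simp add: bil_commute)

text \<open>Polarisation: the mixed term of \<open>quad\<close> is the real inner product of
  \<open>x\<close> and \<open>Y *v cnj_vec x\<close>. Since \<open>Y\<close> is a contraction on the
  disc, this shows that \<open>quad\<close> is nonnegative and dominates half the squared norm of
  \<open>x - Y *v cnj_vec x\<close>.\<close>

lemma quad_expand:
  "quad x Y = ((norm (x - Y *v cnj_vec x))\<^sup>2 + (norm x)\<^sup>2 - (norm (Y *v cnj_vec x))\<^sup>2) / 2"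
proof -
  have "Re (cnj_vec x \<star> (Y *v cnj_vec x)) = (Y *v cnj_vec x) \<bullet> x"
    by (simp add: Re_bil_cnj[symmetric] bil_commute)
  then show ?thesis
    by (simp add: quad_def power2_norm_eq_inner inner_diff_left inner_diff_right inner_commute)
qed

lemma quad_ge:
  assumes "Y \<in> sym_disc"
  shows "quad x Y \<ge> (norm (x - Y *v cnj_vec x))\<^sup>2 / 2" "quad x Y \<ge> 0"
proof -
  have "norm (Y *v cnj_vec x) \<le> norm x"
    using sym_discD(3)[OF assms, of "cnj_vec x"] by simp
  then have "(norm (Y *v cnj_vec x))\<^sup>2 \<le> (norm x)\<^sup>2"
    by (intro power_mono) auto
  then show 1: "quad x Y \<ge> (norm (x - Y *v cnj_vec x))\<^sup>2 / 2"
    by (simp add: quad_expand)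
  show "quad x Y \<ge> 0"
    by (rule order_trans[OF _ 1]) simp
qed

text \<open>The vectors \<open>cnj_vec y + cnj_mat Y *v y\<close> and
  \<open>y + Y *v cnj_vec y\<close> are \<open>mat 1 - cnj_mat Y ** Y\<close> and its transpose
  applied to \<open>cnj_vec x\<close> and \<open>x\<close>. Grouping the exponent accordingly makes
  every inverse \<open>R\<close> cancel and leaves \<open>y \<star> cnj_vec x\<close> plus its
  conjugate.\<close>

lemma K_chi_diag:
  fixes x :: "complex^'n"
  assumes Y: "Y \<in> sym_disc"
  shows "K_chi lam m (shear_conj (x, Y)) (shear_conj (x, Y)) =
    of_real (disc_det Y powi m * exp (lam / 2 * quad x Y))"
proof -
  define y where "y = x - Y *v cnj_vec x"
  define R where "R = matrix_inv (mat 1 - cnj_mat Y ** Y)"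
  note tY = sym_discD(1)[OF Y]
  have dR: "det (mat 1 - cnj_mat Y ** Y) \<noteq> 0"
    using det_sym_disc_nz[OF Y] transpose_one_minus[OF tY] det_transpose by metis
  have R: "R ** (mat 1 - cnj_mat Y ** Y) = mat 1" "(mat 1 - cnj_mat Y ** Y) ** R = mat 1"
    using matrix_inv_mult[OF dR] by (simp_all add: R_def)
  have "cnj_vec y + cnj_mat Y *v y = (mat 1 - cnj_mat Y ** Y) *v cnj_vec x"
    by (simp add: y_def cnj_vec_mv matrix_vector_mult_diff_rdistrib matrix_vector_mult_diff_distrib
        matrix_vector_mul_assoc)
  then have Rx: "R *v (cnj_vec y + cnj_mat Y *v y) = cnj_vec x"
    by (simp add: matrix_vector_mul_assoc R)
  have "y + Y *v cnj_vec y = (mat 1 - Y ** cnj_mat Y) *v x"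
    by (simp add: y_def cnj_vec_mv matrix_vector_mult_diff_rdistrib matrix_vector_mult_diff_distrib
        matrix_vector_mul_assoc)
  also have "mat 1 - Y ** cnj_mat Y = transpose (mat 1 - cnj_mat Y ** Y)"
    by (metis transpose_one_minus[OF tY] transpose_transpose)
  finally have tx: "y + Y *v cnj_vec y = transpose (mat 1 - cnj_mat Y ** Y) *v x" .
  have "2 * (y \<star> (R *v cnj_vec y)) + y \<star> ((R ** cnj_mat Y) *v y) + cnj_vec y \<star> ((Y ** R) *v cnj_vec y)
    = y \<star> (R *v (cnj_vec y + cnj_mat Y *v y)) + (y + Y *v cnj_vec y) \<star> (R *v cnj_vec y)"
    by (simp add: matrix_vector_right_distrib bil_add_right bil_add_left matrix_vector_mul_assoc[symmetric]
        bil_mv[of "cnj_vec y" Y] tY)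
  also have "\<dots> = y \<star> cnj_vec x + x \<star> cnj_vec y"
    unfolding Rx tx bil_mv[symmetric] by (simp add: matrix_vector_mul_assoc R)
  also have "x \<star> cnj_vec y = cnj (y \<star> cnj_vec x)"
    by (simp add: cnj_bil bil_commute)
  also have "y \<star> cnj_vec x + cnj (y \<star> cnj_vec x) = of_real (2 * quad x Y)"
    by (simp add: quad_eq y_def complex_add_cnj)
  finally have q: "2 * (y \<star> (R *v cnj_vec y)) + y \<star> ((R ** cnj_mat Y) *v y) + cnj_vec y \<star> ((Y ** R) *v cnj_vec y)
    = of_real (2 * quad x Y)" .
  have "K_chi lam m (y, Y) (y, Y) = of_real (disc_det Y) powi m * exp (of_real lam / 4 * of_real (2 * quad x Y))"
    unfolding K_chi_def Let_def prod.case R_def[symmetric] q det_eq_disc_det[OF Y] ..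
  also have "\<dots> = of_real (disc_det Y powi m * exp (lam / 2 * quad x Y))"
    by (simp flip: exp_of_real)
  finally show ?thesis by (simp add: shear_conj_def y_def)
qed

section \<open>Integrability over the domain\<close>

lemma nn_integral_powr_decay_finite:
  fixes p :: real
  assumes p: "p > 1"
  shows "(\<integral>\<^sup>+u. ennreal ((1 + \<bar>u\<bar>) powr (- p)) \<partial>lborel) < \<infinity>"
proof -
  let ?f = "\<lambda>u::real. (1 + \<bar>u\<bar>) powr (- p)"
  have half: "(\<integral>\<^sup>+u. ennreal (?f u) * indicator {0..} u \<partial>lborel) < \<infinity>"
  proof -
    have "(\<integral>\<^sup>+u. ennreal (?f u) * indicator {0..} u \<partial>lborel) = ennreal (0 - (- ((1 + 0) powr (1 - p)) / (p - 1)))"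
    proof (rule nn_integral_FTC_atLeast)
      fix u :: real assume u: "0 \<le> u"
      have "((\<lambda>u. - ((1 + u) powr (1 - p)) / (p - 1)) has_real_derivative - ((1 - p) * (1 + u) powr (1 - p - 1)) / (p - 1)) (at u)"
        using u p by (auto intro!: derivative_eq_intros)
      moreover have "- ((1 - p) * (1 + u) powr (1 - p - 1)) / (p - 1) = ?f u"
        using u p by (simp add: divide_simps) (simp add: algebra_simps)
      ultimately show "((\<lambda>u. - ((1 + u) powr (1 - p)) / (p - 1)) has_real_derivative ?f u) (at u)"
        by simp
    next
      have "((\<lambda>u::real. (1 + u) powr (1 - p)) \<longlongrightarrow> 0) at_top"
        by (rule tendsto_neg_powr) (use p in \<open>auto intro: filterlim_tendsto_add_at_top filterlim_ident\<close>)
      from tendsto_divide[OF tendsto_minus[OF this] tendsto_const[of "p - 1"]] p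
      show "((\<lambda>u. - ((1 + u) powr (1 - p)) / (p - 1)) \<longlongrightarrow> 0) at_top" by simp
    qed auto
    then show ?thesis by simp
  qed
  have "(\<integral>\<^sup>+u. ennreal (?f u) \<partial>lborel) \<le>
      (\<integral>\<^sup>+u. ennreal (?f u) * indicator {0..} u + ennreal (?f (0 + (-1) * u)) * indicator {0..} (0 + (-1) * u) \<partial>lborel)"
    by (rule nn_integral_mono) (auto split: split_indicator)
  also have "\<dots> = (\<integral>\<^sup>+u. ennreal (?f u) * indicator {0..} u \<partial>lborel)
      + (\<integral>\<^sup>+u. ennreal (?f (0 + (-1) * u)) * indicator {0..} (0 + (-1) * u) \<partial>lborel)"
    by (rule nn_integral_add) measurable
  also have "(\<integral>\<^sup>+u. ennreal (?f (0 + (-1) * u)) * indicator {0..} (0 + (-1) * u) \<partial>lborel)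
      = (\<integral>\<^sup>+u. ennreal (?f u) * indicator {0..} u \<partial>lborel)"
    using nn_integral_real_affine[of "\<lambda>u. ennreal (?f u) * indicator {0..} u" "-1" 0] by simp
  finally show ?thesis
    by (rule le_less_trans) (use half in simp)
qed

text \<open>A common integrable majorant for the Gaussian and for the one-sided exponential. The
  factor 2 serves both comparisons. Being even, it replaces \<open>exp (- u)\<close>, which grows
  for negative \<open>u\<close>, by a function that can be integrated over the whole line after any
  affine substitution.\<close>

definition decay :: "real \<Rightarrow> real" where
  "decay u = 2 * (1 + \<bar>u\<bar>) powr (- 2)"

definition decay_mass :: ennreal where
  "decay_mass = (\<integral>\<^sup>+u. ennreal (decay u) \<partial>lborel)"

lemma decay_measurable [measurable]: "decay \<in> borel_measurable borel"
  unfolding decay_def[abs_def] by measurable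

lemma decay_eq: "decay u = 2 / (1 + \<bar>u\<bar>)\<^sup>2"
  by (simp add: decay_def powr_minus powr_numeral divide_inverse)

lemma decay_nonneg [simp]: "decay u \<ge> 0"
  by (simp add: decay_def)

lemma decay_mass_finite: "decay_mass < \<infinity>"
proof -
  have eq: "decay_mass = ennreal 2 * (\<integral>\<^sup>+u. ennreal ((1 + \<bar>u\<bar>) powr (- 2)) \<partial>lborel)"
    unfolding decay_mass_def decay_def by (simp add: ennreal_mult nn_integral_cmult)
  then show ?thesis
    unfolding eq using nn_integral_powr_decay_finite[of 2] by (simp add: ennreal_mult_less_top)
qed

lemma exp_neg_square_le_decay: "exp (- (u\<^sup>2)) \<le> decay u"
proof -
  have "(1 + \<bar>u\<bar>)\<^sup>2 \<le> 2 * (1 + u\<^sup>2)"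
  proof -
    have "0 \<le> (1 - \<bar>u\<bar>)\<^sup>2" by simp
    then show ?thesis by (simp add: power2_eq_square algebra_simps)
  qed
  also have "\<dots> \<le> 2 * exp (u\<^sup>2)" by (rule mult_left_mono[OF exp_ge_add_one_self]) simp
  finally show ?thesis
    by (simp add: decay_eq exp_minus field_simps add_pos_nonneg)
qed

lemma exp_neg_le_decay:
  assumes "0 \<le> u" shows "exp (- u) \<le> decay u"
proof -
  have "(1 + u)\<^sup>2 \<le> 2 * (1 + u + u\<^sup>2 / 2)"
    using assms by (simp add: power2_eq_square algebra_simps)
  also have "\<dots> \<le> 2 * exp u"
    using exp_lower_Taylor_quadratic[OF assms] by simp
  finally show ?thesis
    using assms by (simp add: decay_eq exp_minus field_simps add_pos_nonneg)
qed

lemma nn_integral_decay_affine: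
  assumes "a \<noteq> 0"
  shows "(\<integral>\<^sup>+u. ennreal (decay (t + a * u)) \<partial>lborel) = decay_mass / ennreal \<bar>a\<bar>"
proof -
  have eq: "decay_mass = ennreal \<bar>a\<bar> * (\<integral>\<^sup>+u. ennreal (decay (t + a * u)) \<partial>lborel)"
    unfolding decay_mass_def using assms by (intro nn_integral_real_affine) auto
  then show ?thesis
    unfolding eq using assms by (simp add: ennreal_mult_divide_eq mult.commute[of "ennreal \<bar>a\<bar>"])
qed

lemma nn_integral_decay_complex:
  assumes "a \<noteq> 0" "b \<noteq> 0"
  shows "(\<integral>\<^sup>+z. ennreal (decay (t + a * Re z) * decay (b * Im z)) \<partial>lborel)
    = (decay_mass / ennreal \<bar>a\<bar>) * (decay_mass / ennreal \<bar>b\<bar>)"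
proof -
  define f where "f = (\<lambda>e u. if e = (1::complex) then ennreal (decay (t + a * u)) else ennreal (decay (b * u)))"
  have ne: "(1::complex) \<noteq> \<i>" "\<i> \<noteq> 1" by (auto simp: complex_eq_iff)
  have "(\<integral>\<^sup>+z. ennreal (decay (t + a * Re z) * decay (b * Im z)) \<partial>lborel)
      = (\<integral>\<^sup>+z. (\<Prod>e\<in>Basis. f e (z \<bullet> e)) \<partial>lborel)"
    using ne by (simp add: Basis_complex_def f_def inner_complex_def ennreal_mult)
  also have "\<dots> = (\<Prod>e\<in>Basis. \<integral>\<^sup>+u. f e u \<partial>lborel)"
    by (rule nn_integral_lborel_prod) (auto simp: f_def)
  also have "\<dots> = (decay_mass / ennreal \<bar>a\<bar>) * (decay_mass / ennreal \<bar>b\<bar>)"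
    using ne assms nn_integral_decay_affine[of b 0]
    by (simp add: Basis_complex_def f_def nn_integral_decay_affine)
  finally show ?thesis .
qed

lemma nn_integral_complex_affine:
  fixes h :: "complex \<Rightarrow> ennreal"
  assumes [measurable]: "h \<in> borel_measurable borel" and a: "a \<noteq> 0"
  shows "(\<integral>\<^sup>+z. h (t + a * z) \<partial>lborel) = integral\<^sup>N lborel h / ennreal ((cmod a)\<^sup>2)"
proof -
  define r where "r = cmod a"
  have r: "r > 0" using a by (simp add: r_def)
  define c where "c = a / of_real r"
  have c: "cmod c = 1" "a = of_real r * c" using r by (auto simp: c_def norm_divide r_def)
  have "(\<integral>\<^sup>+z. h (t + a * z) \<partial>lborel) = (\<integral>\<^sup>+z. h (t + of_real r * (c * z)) \<partial>lborel)"
    by (simp add: c(2) mult.assoc)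
  also have "\<dots> = (\<integral>\<^sup>+z. h (t + of_real r * z) \<partial>lborel)"
    by (rule nn_integral_complex_rotate[of c "\<lambda>z. h (t + of_real r * z)"]) (use c in auto)
  finally have 1: "(\<integral>\<^sup>+z. h (t + a * z) \<partial>lborel) = (\<integral>\<^sup>+z. h (t + r *\<^sub>R z) \<partial>lborel)"
    by (simp add: scaleR_conv_of_real)
  have eq: "integral\<^sup>N lborel h = ennreal (r\<^sup>2) * (\<integral>\<^sup>+z. h (t + r *\<^sub>R z) \<partial>lborel)"
  proof -
    have "integral\<^sup>N lborel h = (\<integral>\<^sup>+z. h z \<partial>density (distr lborel borel (\<lambda>x. t + r *\<^sub>R x)) (\<lambda>_. ennreal (\<bar>r\<bar> ^ DIM(complex))))"
      using lborel_affine[of r t] r by simp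
    also have "\<dots> = ennreal (r\<^sup>2) * (\<integral>\<^sup>+z. h (t + r *\<^sub>R z) \<partial>lborel)"
      by (simp add: nn_integral_density nn_integral_cmult nn_integral_distr)
    finally show ?thesis .
  qed
  show ?thesis
    unfolding 1 eq r_def[symmetric] using r by (simp add: ennreal_mult_divide_eq mult.commute[of "ennreal (r\<^sup>2)"])
qed

section \<open>Lebesgue measure on symmetric matrices\<close>

lemma finite_sym_pairs [simp]: "finite (sym_pairs :: 'n::finite set set)"
  by (rule finite_subset[of _ UNIV]) auto

lemma sym_pairsI [simp]: "{i, j} \<in> sym_pairs"
  by (auto simp: sym_pairs_def)

definition sym_of :: "('n set \<Rightarrow> complex) \<Rightarrow> complex^'n^'n" where
  "sym_of s = (\<chi> i j. s {i, j})"

abbreviation cprod :: "'n set set \<Rightarrow> ('n set \<Rightarrow> complex) measure" where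
  "cprod I \<equiv> \<Pi>\<^sub>M p\<in>I. (lborel :: complex measure)"

lemma sym_of_measurable [measurable]: "sym_of \<in> cprod sym_pairs \<rightarrow>\<^sub>M (borel :: (complex^'n::finite^'n) measure)"
proof (rule borel_measurable_euclidean_space[THEN iffD2], rule ballI)
  fix e :: "complex^'n^'n" assume "e \<in> Basis"
  then obtain i j b where e: "e = axis i (axis j b)"
    by (auto simp: Basis_vec_def)
  have "(\<lambda>s. s {i, j} \<bullet> b) \<in> borel_measurable (cprod sym_pairs)"
    by (intro borel_measurable_inner borel_measurable_const) measurable
  then show "(\<lambda>s. sym_of s \<bullet> e) \<in> borel_measurable (cprod sym_pairs)"
    by (simp add: e inner_axis sym_of_def)
qed

lemma sym_lebesgue_eq: "sym_lebesgue = distr (cprod sym_pairs) borel sym_of"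
  unfolding sym_lebesgue_def sym_of_def[abs_def] ..

lemma space_sym_lebesgue [simp]: "space sym_lebesgue = UNIV"
  and sets_sym_lebesgue [simp, measurable_cong]: "sets sym_lebesgue = sets borel"
  by (simp_all add: sym_lebesgue_eq)

interpretation cp: product_sigma_finite "\<lambda>_::'n set. lborel :: complex measure"
  by standard

text \<open>Integrates out one matrix entry at a time: the entry \<open>p\<close> is confined to the
  factor \<open>f\<close>, whose integral is bounded by \<open>C\<close> uniformly in the other
  entries.\<close>

lemma nn_integral_insert_le:
  fixes F :: "('n::finite set \<Rightarrow> complex) \<Rightarrow> ennreal"
  assumes I: "finite I" "p \<notin> I" and F: "F \<in> borel_measurable (cprod (insert p I))"
    and G: "G \<in> borel_measurable (cprod I)"
    and le: "\<And>s z. F (s(p := z)) \<le> G s * f s z"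
    and f: "\<And>s. f s \<in> borel_measurable borel" and C: "\<And>s. (\<integral>\<^sup>+z. f s z \<partial>lborel) \<le> C"
  shows "(\<integral>\<^sup>+s. F s \<partial>cprod (insert p I)) \<le> C * (\<integral>\<^sup>+s. G s \<partial>cprod I)"
proof -
  have "(\<integral>\<^sup>+s. F s \<partial>cprod (insert p I)) = (\<integral>\<^sup>+s. \<integral>\<^sup>+z. F (s(p := z)) \<partial>lborel \<partial>cprod I)"
    by (rule cp.product_nn_integral_insert[OF I F])
  also have "\<dots> \<le> (\<integral>\<^sup>+s. C * G s \<partial>cprod I)"
  proof (rule nn_integral_mono)
    fix s
    have "(\<integral>\<^sup>+z. F (s(p := z)) \<partial>lborel) \<le> (\<integral>\<^sup>+z. G s * f s z \<partial>lborel)"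
      by (intro nn_integral_mono le)
    also have "\<dots> = G s * (\<integral>\<^sup>+z. f s z \<partial>lborel)"
      using f by (intro nn_integral_cmult) simp
    also have "\<dots> \<le> C * G s" by (subst mult.commute[of C], rule mult_left_mono[OF C]) simp
    finally show "(\<integral>\<^sup>+z. F (s(p := z)) \<partial>lborel) \<le> C * G s" .
  qed
  also have "\<dots> = C * (\<integral>\<^sup>+s. G s \<partial>cprod I)" using G by (rule nn_integral_cmult)
  finally show ?thesis .
qed

text \<open>With \<open>z = cnj_vec x \<star> (Y *v cnj_vec x)\<close>, contractivity gives
  \<open>cmod z \<le> (norm x)^2\<close>. So \<open>(Im z)^2\<close> is at most
  \<open>((norm x)^2 - Re z) * ((norm x)^2 + Re z)\<close>, whose first factor is
  \<open>quad x Y\<close>. The first bound omits component \<open>i\<close>, because the matrix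
  entry that would control it is used for \<open>z\<close> instead.\<close>

lemma quad_lower_bounds:
  fixes x :: "complex^'n"
  assumes Y: "Y \<in> sym_disc"
  shows "quad x Y \<ge> (\<Sum>j\<in>-{i}. (cmod ((x - Y *v cnj_vec x) $ j))\<^sup>2) / 2"
    and "(Im (cnj_vec x \<star> (Y *v cnj_vec x)))\<^sup>2 \<le> 2 * (norm x)\<^sup>2 * quad x Y"
proof -
  have "(\<Sum>j\<in>-{i}. (cmod ((x - Y *v cnj_vec x) $ j))\<^sup>2) \<le> (\<Sum>j\<in>UNIV. (cmod ((x - Y *v cnj_vec x) $ j))\<^sup>2)"
    by (rule sum_mono2) auto
  also have "\<dots> = (norm (x - Y *v cnj_vec x))\<^sup>2"
    unfolding norm_vec_def L2_set_def by (simp add: sum_nonneg)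
  finally show "quad x Y \<ge> (\<Sum>j\<in>-{i}. (cmod ((x - Y *v cnj_vec x) $ j))\<^sup>2) / 2"
    using quad_ge(1)[OF Y, of x] by linarith
  define z where "z = cnj_vec x \<star> (Y *v cnj_vec x)"
  have "cmod z \<le> norm x * norm (Y *v cnj_vec x)"
    unfolding z_def using cmod_bil_le[of "cnj_vec x"] by simp
  also have "\<dots> \<le> norm x * norm x"
    using sym_discD(3)[OF Y, of "cnj_vec x"] by (intro mult_left_mono) auto
  finally have z: "cmod z \<le> (norm x)\<^sup>2" by (simp add: power2_eq_square)
  then have "(cmod z)\<^sup>2 \<le> ((norm x)\<^sup>2)\<^sup>2" by (intro power_mono) auto
  then have 1: "(Im z)\<^sup>2 \<le> ((norm x)\<^sup>2 - Re z) * ((norm x)\<^sup>2 + Re z)"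
  proof -
    have "((norm x)\<^sup>2 - Re z) * ((norm x)\<^sup>2 + Re z) = ((norm x)\<^sup>2)\<^sup>2 - (Re z)\<^sup>2"
      by (simp add: power2_eq_square algebra_simps)
    with \<open>(cmod z)\<^sup>2 \<le> ((norm x)\<^sup>2)\<^sup>2\<close> show ?thesis
      using cmod_power2[of z] by linarith
  qed
  have "Re z \<le> (norm x)\<^sup>2" using z complex_Re_le_cmod[of z] by linarith
  then have "((norm x)\<^sup>2 - Re z) * ((norm x)\<^sup>2 + Re z) \<le> ((norm x)\<^sup>2 - Re z) * (2 * (norm x)\<^sup>2)"
    by (intro mult_left_mono) auto
  with 1 show "(Im (cnj_vec x \<star> (Y *v cnj_vec x)))\<^sup>2 \<le> 2 * (norm x)\<^sup>2 * quad x Y"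
    by (simp add: quad_def z_def algebra_simps)
qed

lemma sym_disc_indicator_prod:
  assumes "sym_of s \<in> sym_disc" "R \<subseteq> sym_pairs"
  shows "(\<Prod>p\<in>R. indicator (cball 0 1) (s p)) = (1 :: ennreal)"
proof (rule prod.neutral, rule ballI)
  fix p assume "p \<in> R"
  with assms(2) obtain j k where "p = {j, k}" by (auto simp: sym_pairs_def)
  then have "cmod (s p) \<le> 1"
    using sym_disc_component_le[OF assms(1), of j k] by (simp add: sym_of_def)
  then show "indicator (cball 0 1) (s p) = (1 :: ennreal)" by simp
qed

lemma gauss_decay_sum:
  fixes J :: "'a set"
  assumes "finite J" "a > 0"
  shows "exp (- (\<Sum>j\<in>J. a * (cmod (w j))\<^sup>2)) \<le> (\<Prod>j\<in>J. decay (sqrt a * Re (w j)) * decay (sqrt a * Im (w j)))"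
proof -
  have "exp (- (\<Sum>j\<in>J. a * (cmod (w j))\<^sup>2)) = (\<Prod>j\<in>J. exp (- (sqrt a * Re (w j))\<^sup>2) * exp (- (sqrt a * Im (w j))\<^sup>2))"
    using assms by (simp add: sum_negf[symmetric] exp_sum exp_add[symmetric] power_mult_distrib cmod_power2 algebra_simps)
  also have "\<dots> \<le> (\<Prod>j\<in>J. decay (sqrt a * Re (w j)) * decay (sqrt a * Im (w j)))"
    by (intro prod_mono conjI mult_mono exp_neg_square_le_decay) auto
  finally show ?thesis .
qed

text \<open>The one-sided decay in \<open>Re z\<close> is essential: Gaussian decay of all the components of \<open>x - Y cnj x\<close>
  alone would bound the integral over \<open>Y\<close> only by \<open>|x|\<close> to the power \<open>-2n\<close>, which is not integrable.\<close>
lemma quad_exp_bound: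
  fixes x :: "complex^'n"
  assumes Y: "Y \<in> sym_disc" and c: "c > 0" and x: "x \<noteq> 0"
  defines "z \<equiv> cnj_vec x \<star> (Y *v cnj_vec x)"
  shows "exp (- c * quad x Y) \<le>
    (\<Prod>j\<in>-{i}. decay (sqrt (c/6) * Re ((x - Y *v cnj_vec x) $ j)) * decay (sqrt (c/6) * Im ((x - Y *v cnj_vec x) $ j)))
    * (decay (c/3 * (norm x)\<^sup>2 + (-c/3) * Re z) * decay (sqrt (c/6) / norm x * Im z))"
proof -
  let ?w = "\<lambda>j. (x - Y *v cnj_vec x) $ j"
  \<comment> \<open>The exponent \<open>c * quad x Y\<close> is divided into three equal shares: for
    the components other than \<open>i\<close>, for \<open>Re z\<close>, and for
    \<open>Im z\<close>. The constant \<open>c/6\<close> arises from the share \<open>c/3\<close>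
    and the factor 2 in each part of \<open>quad_lower_bounds\<close>.\<close>
  have 1: "exp (- (\<Sum>j\<in>-{i}. c/6 * (cmod (?w j))\<^sup>2)) \<le>
      (\<Prod>j\<in>-{i}. decay (sqrt (c/6) * Re (?w j)) * decay (sqrt (c/6) * Im (?w j)))"
    by (rule gauss_decay_sum) (use c in auto)
  have q: "quad x Y = (norm x)\<^sup>2 - Re z" by (simp add: quad_def z_def)
  have 2: "exp (- (c/3 * quad x Y)) \<le> decay (c/3 * (norm x)\<^sup>2 + (-c/3) * Re z)"
    using exp_neg_le_decay[of "c/3 * quad x Y"] c quad_ge(2)[OF Y, of x] by (simp add: q algebra_simps)
  have 3: "exp (- (sqrt (c/6) / norm x * Im z)\<^sup>2) \<le> decay (sqrt (c/6) / norm x * Im z)"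
    by (rule exp_neg_square_le_decay)
  have "(\<Sum>j\<in>-{i}. c/6 * (cmod (?w j))\<^sup>2) \<le> c/3 * quad x Y"
    using mult_left_mono[OF quad_lower_bounds(1)[OF Y, where i = i and x = x], of "c/3"] c
    unfolding sum_distrib_left[symmetric] by simp
  moreover have "(sqrt (c/6) / norm x * Im z)\<^sup>2 \<le> c/3 * quad x Y"
  proof -
    have "(sqrt (c/6) / norm x * Im z)\<^sup>2 = c / 6 / (norm x)\<^sup>2 * (Im z)\<^sup>2"
      using c by (simp add: power_mult_distrib power_divide)
    also have "\<dots> \<le> c / 6 / (norm x)\<^sup>2 * (2 * (norm x)\<^sup>2 * quad x Y)"
      unfolding z_def using c by (intro mult_left_mono quad_lower_bounds(2)[OF Y]) auto
    also have "\<dots> = c/3 * quad x Y" using x by simp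
    finally show ?thesis .
  qed
  ultimately have "- c * quad x Y \<le> - (\<Sum>j\<in>-{i}. c/6 * (cmod (?w j))\<^sup>2) + (- (c/3 * quad x Y) + - (sqrt (c/6) / norm x * Im z)\<^sup>2)"
    by simp
  then have "exp (- c * quad x Y) \<le> exp (- (\<Sum>j\<in>-{i}. c/6 * (cmod (?w j))\<^sup>2))
      * (exp (- (c/3 * quad x Y)) * exp (- (sqrt (c/6) / norm x * Im z)\<^sup>2))"
    unfolding exp_add[symmetric] by simp
  also have "\<dots> \<le> (\<Prod>j\<in>-{i}. decay (sqrt (c/6) * Re (?w j)) * decay (sqrt (c/6) * Im (?w j)))
    * (decay (c/3 * (norm x)\<^sup>2 + (-c/3) * Re z) * decay (sqrt (c/6) / norm x * Im z))"
    by (intro mult_mono 1 2 3) (auto intro!: prod_nonneg mult_nonneg_nonneg)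
  finally show ?thesis .
qed

text \<open>Row \<open>i\<close> of \<open>Y\<close> supplies the integration variables. For
  \<open>j \<noteq> i\<close> the component \<open>j\<close> of \<open>x - Y *v cnj_vec x\<close> is
  affine in the entry \<open>{i, j}\<close> with slope \<open>- cnj (x $ i)\<close>, and
  \<open>cnj_vec x \<star> (Y *v cnj_vec x)\<close> is affine in the entry \<open>{i}\<close> with
  slope \<open>(cnj (x $ i))^2\<close>; an area integral is divided by the squared modulus of the
  slope. The system is triangular: \<open>{i}\<close> is integrated out first, then the entries
  \<open>{i, j}\<close> one by one, and the entries outside row \<open>i\<close>, collected in
  \<open>R\<close>, are merely confined to the unit disc.\<close>

lemma inner_integral_bound:
  fixes x :: "complex^'n" and i :: 'n
  assumes c: "c > 0" and xi: "x $ i \<noteq> 0"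
  defines "a \<equiv> sqrt (c/6)"
  shows "(\<integral>\<^sup>+s. indicator sym_disc (sym_of s) * ennreal (exp (- c * quad x (sym_of s))) \<partial>cprod sym_pairs) \<le>
    (decay_mass / ennreal (c/3) * (decay_mass / ennreal (a / norm x)) / ennreal ((cmod (x $ i)) ^ 4))
    * ((decay_mass / ennreal a * (decay_mass / ennreal a) / ennreal ((cmod (x $ i))\<^sup>2)) ^ (CARD('n) - 1)
    * (emeasure lborel (cball (0::complex) 1)) ^ card {p\<in>sym_pairs. i \<notin> p})"
proof -
  have x0: "x \<noteq> 0" using xi by auto
  have a: "a > 0" using c by (simp add: a_def)
  define \<alpha> where "\<alpha> = - cnj (x $ i)"
  have \<alpha>: "cmod \<alpha> = cmod (x $ i)" "\<alpha> \<noteq> 0" using xi by (simp_all add: \<alpha>_def)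
  define R where "R = {p\<in>sym_pairs. i \<notin> p}"
  define b where "b s j = x $ j - (\<Sum>k\<in>-{i}. s {j, k} * cnj (x $ k))" for s :: "'n set \<Rightarrow> complex" and j
  define B where "B s = (\<Sum>j\<in>UNIV. \<Sum>k\<in>UNIV. if j = i \<and> k = i then 0 else cnj (x $ j) * s {j, k} * cnj (x $ k))" for s :: "'n set \<Rightarrow> complex"
  define Gf where "Gf w = ennreal (decay (0 + a * Re w) * decay (a * Im w))" for w
  define Hf where "Hf z = ennreal (decay (c/3 * (norm x)\<^sup>2 + (-c/3) * Re z) * decay (a / norm x * Im z))" for z
  define F0 where "F0 s = (\<Prod>p\<in>R. indicator (cball 0 1) (s p) :: ennreal)" for s :: "'n set \<Rightarrow> complex"
  define F1 where "F1 J s = F0 s * (\<Prod>j\<in>J. Gf (b s j + \<alpha> * s {i, j}))" for s :: "'n set \<Rightarrow> complex" and J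
  define F2 where "F2 s = F1 (-{i}) s * Hf (B s + (cnj (x $ i))\<^sup>2 * s {i})" for s :: "'n set \<Rightarrow> complex"
  have [measurable]: "Gf \<in> borel_measurable borel" "Hf \<in> borel_measurable borel"
    unfolding Gf_def[abs_def] Hf_def[abs_def] by measurable
  have R: "finite R" "i \<notin> p" if "p \<in> R" for p using that by (auto simp: R_def)
  have finR: "finite R" by (simp add: R_def)
  have bound: "indicator sym_disc (sym_of s) * ennreal (exp (- c * quad x (sym_of s))) \<le> F2 s" for s
  proof (cases "sym_of s \<in> sym_disc")
    case True
    have "F0 s = 1"
      unfolding F0_def by (rule sym_disc_indicator_prod[OF True]) (auto simp: R_def)
    moreover have w: "b s j + \<alpha> * s {i, j} = (x - sym_of s *v cnj_vec x) $ j" for j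
    proof -
      have "(\<Sum>k\<in>UNIV. s {j, k} * cnj (x $ k)) = s {j, i} * cnj (x $ i) + (\<Sum>k\<in>-{i}. s {j, k} * cnj (x $ k))"
        by (simp add: sum.remove[of UNIV i] Compl_eq_Diff_UNIV)
      then show ?thesis
        by (simp add: matrix_vector_mult_def sym_of_def cnj_vec_def b_def \<alpha>_def insert_commute)
    qed
    moreover have z: "B s + (cnj (x $ i))\<^sup>2 * s {i} = cnj_vec x \<star> (sym_of s *v cnj_vec x)"
    proof -
      have "cnj_vec x \<star> (sym_of s *v cnj_vec x) = (\<Sum>j\<in>UNIV. \<Sum>k\<in>UNIV. cnj (x $ j) * s {j, k} * cnj (x $ k))"
        by (simp add: bil_def matrix_vector_mult_def sym_of_def cnj_vec_def sum_distrib_left mult.assoc)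
      also have "\<dots> = (\<Sum>j\<in>UNIV. \<Sum>k\<in>UNIV. (if j = i \<and> k = i then 0 else cnj (x $ j) * s {j, k} * cnj (x $ k))
          + (if k = i then (if j = i then cnj (x $ i) * s {i} * cnj (x $ i) else 0) else 0))"
        by (intro sum.cong refl) auto
      also have "\<dots> = B s + (cnj (x $ i))\<^sup>2 * s {i}"
        by (simp add: sum.distrib B_def power2_eq_square)
      finally show ?thesis by simp
    qed
    ultimately have "F2 s = (\<Prod>j\<in>-{i}. Gf ((x - sym_of s *v cnj_vec x) $ j)) * Hf (cnj_vec x \<star> (sym_of s *v cnj_vec x))"
      by (simp only: F2_def F1_def mult_1)
    also have "(\<Prod>j\<in>-{i}. Gf ((x - sym_of s *v cnj_vec x) $ j)) = ennreal (\<Prod>j\<in>-{i}. decay (a * Re ((x - sym_of s *v cnj_vec x) $ j)) * decay (a * Im ((x - sym_of s *v cnj_vec x) $ j)))"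
      unfolding Gf_def add_0_left by (rule prod_ennreal) simp
    finally have "F2 s = ennreal ((\<Prod>j\<in>-{i}. decay (a * Re ((x - sym_of s *v cnj_vec x) $ j)) * decay (a * Im ((x - sym_of s *v cnj_vec x) $ j)))
    * (decay (c/3 * (norm x)\<^sup>2 + (-c/3) * Re (cnj_vec x \<star> (sym_of s *v cnj_vec x))) * decay (a / norm x * Im (cnj_vec x \<star> (sym_of s *v cnj_vec x)))))"
      unfolding Hf_def by (subst ennreal_mult) (auto intro!: prod_nonneg)
    then show ?thesis
      using quad_exp_bound[OF True c x0, of i] True by (simp add: a_def ennreal_leI)
  qed simp
  have pairs: "sym_pairs = insert {i} (R \<union> (\<lambda>j. {i, j}) ` (-{i}))"
    by (auto simp: R_def sym_pairs_def)
  have comp: "(\<lambda>s. s p) \<in> borel_measurable (cprod I)" if "p \<in> I" for p :: "'n set" and I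
    using measurable_component_singleton[OF that, of "\<lambda>_. lborel :: complex measure"] by simp
  have F0m: "F0 \<in> borel_measurable (cprod I)" if "R \<subseteq> I" for I
  proof -
    have "(\<lambda>s. indicator (cball 0 1) (s p) :: ennreal) \<in> borel_measurable (cprod I)" if "p \<in> R" for p
      using that \<open>R \<subseteq> I\<close> by (intro measurable_compose[OF comp] borel_measurable_indicator) auto
    then show ?thesis unfolding F0_def[abs_def] by (intro borel_measurable_prod_ennreal)
  qed
  have F1m: "F1 J \<in> borel_measurable (cprod I)" if I: "R \<subseteq> I" "(\<lambda>j. {i, j}) ` J \<subseteq> I" and J: "i \<notin> J" for I J
  proof -
    have "(\<lambda>s. Gf (b s j + \<alpha> * s {i, j})) \<in> borel_measurable (cprod I)" if "j \<in> J" for j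
    proof -
      have "(\<lambda>s. s {i, j}) \<in> borel_measurable (cprod I)" using that I by (intro comp) auto
      moreover have "(\<lambda>s. b s j) \<in> borel_measurable (cprod I)"
        unfolding b_def
      proof (intro borel_measurable_diff borel_measurable_const borel_measurable_sum borel_measurable_times)
        fix k assume "k \<in> -{i}"
        moreover have "j \<noteq> i" using J that by auto
        ultimately have "{j, k} \<in> R" by (auto simp: R_def)
        then show "(\<lambda>s. s {j, k}) \<in> borel_measurable (cprod I)" using I by (intro comp) auto
      qed
      ultimately show ?thesis by measurable
    qed
    then show ?thesis
      unfolding F1_def[abs_def] using F0m[OF I(1)] by (intro borel_measurable_times_ennreal borel_measurable_prod_ennreal)
  qed
  have F2m: "F2 \<in> borel_measurable (cprod sym_pairs)"
  proof -
    have "F1 (-{i}) \<in> borel_measurable (cprod sym_pairs)"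
      by (rule F1m) (auto simp: R_def)
    moreover have "(\<lambda>s. s {i}) \<in> borel_measurable (cprod sym_pairs)"
      by (rule comp) (metis insert_absorb2 sym_pairsI)
    moreover have "B \<in> borel_measurable (cprod sym_pairs)"
    proof -
      have "(\<lambda>s. if j = i \<and> k = i then 0 else cnj (x $ j) * s {j, k} * cnj (x $ k)) \<in> borel_measurable (cprod sym_pairs)" for j k
        by (cases "j = i \<and> k = i") (simp, simp only: if_False, intro borel_measurable_times borel_measurable_const comp sym_pairsI)
      then show ?thesis unfolding B_def[abs_def] by (intro borel_measurable_sum)
    qed
    ultimately show ?thesis unfolding F2_def[abs_def] by measurable
  qed
  have upd0: "F0 (s(p := z)) = F0 s" if "i \<in> p" for s p z
    unfolding F0_def using that R(2) by (intro prod.cong) auto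
  \<comment> \<open>For \<open>j \<noteq> i\<close>, \<open>b s j\<close> reads only entries
    \<open>{j, k}\<close> that avoid \<open>i\<close>, so changing an entry of row \<open>i\<close>
    leaves it alone. Component \<open>i\<close>, for which this fails, does not occur in the
    product.\<close>
  have updb: "b (s(p := z)) j = b s j" if "i \<in> p" "j \<noteq> i" for s p z j
  proof -
    have "(s(p := z)) {j, k} = s {j, k}" if "k \<in> -{i}" for k
      using that \<open>i \<in> p\<close> \<open>j \<noteq> i\<close> by auto
    then show ?thesis unfolding b_def by (intro arg_cong2[where f = "(-)"] sum.cong) auto
  qed
  have updB: "B (s({i} := z)) = B s" for s z
  proof -
    have "{j, k} \<noteq> {i}" if "\<not> (j = i \<and> k = i)" for j k using that by auto
    then show ?thesis unfolding B_def by (intro sum.cong refl) auto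
  qed
  define V where "V = emeasure lborel (cball (0::complex) 1)"
  define CG where "CG = integral\<^sup>N lborel Gf / ennreal ((cmod (x $ i))\<^sup>2)"
  define CH where "CH = integral\<^sup>N lborel Hf / ennreal ((cmod (x $ i)) ^ 4)"
  have S0: "(\<integral>\<^sup>+s. F0 s \<partial>cprod R) = V ^ card R"
    unfolding F0_def V_def by (subst cp.product_nn_integral_prod) (auto simp: finR intro!: borel_measurable_indicator)
  have S1: "(\<integral>\<^sup>+s. F1 J s \<partial>cprod (R \<union> (\<lambda>j. {i, j}) ` J)) \<le> CG ^ card J * V ^ card R"
    if "i \<notin> J" for J
  proof -
    have "finite J" by simp
    then show ?thesis using that
    proof (induction J rule: finite_induct)
      case empty
      then show ?case by (simp add: F1_def S0)
    next
      case (insert j J)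
      have ji: "j \<noteq> i" "i \<notin> J" using insert.prems by auto
      have nin: "{i, j} \<notin> R \<union> (\<lambda>j. {i, j}) ` J"
        using insert.hyps ji by (auto simp: R_def doubleton_eq_iff)
      have "(\<integral>\<^sup>+s. F1 (insert j J) s \<partial>cprod (R \<union> (\<lambda>j. {i, j}) ` insert j J))
         = (\<integral>\<^sup>+s. F1 (insert j J) s \<partial>cprod (insert {i, j} (R \<union> (\<lambda>j. {i, j}) ` J)))"
        by simp
      also have "\<dots> \<le> CG * (\<integral>\<^sup>+s. F1 J s \<partial>cprod (R \<union> (\<lambda>j. {i, j}) ` J))"
      proof (rule nn_integral_insert_le[where f = "\<lambda>s z. Gf (b s j + \<alpha> * z)"])
        show "F1 (insert j J) \<in> borel_measurable (cprod (insert {i, j} (R \<union> (\<lambda>j. {i, j}) ` J)))"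
          using insert.prems by (intro F1m) auto
        show "F1 J \<in> borel_measurable (cprod (R \<union> (\<lambda>j. {i, j}) ` J))"
          using ji by (intro F1m) auto
        fix s z
        have "(\<Prod>l\<in>J. Gf (b (s({i, j} := z)) l + \<alpha> * (s({i, j} := z)) {i, l}))
           = (\<Prod>l\<in>J. Gf (b s l + \<alpha> * s {i, l}))"
        proof (rule prod.cong[OF refl])
          fix l assume l: "l \<in> J"
          then have "l \<noteq> i" "{i, l} \<noteq> {i, j}" using ji insert.hyps by (auto simp: doubleton_eq_iff)
          then show "Gf (b (s({i, j} := z)) l + \<alpha> * (s({i, j} := z)) {i, l})
            = Gf (b s l + \<alpha> * s {i, l})" by (simp add: updb)
        qed
        then have "F1 (insert j J) (s({i, j} := z)) = F1 J s * Gf (b s j + \<alpha> * z)"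
          using insert.hyps ji by (simp add: F1_def upd0 updb mult_ac)
        then show "F1 (insert j J) (s({i, j} := z)) \<le> F1 J s * Gf (b s j + \<alpha> * z)" by simp
        show "(\<lambda>z. Gf (b s j + \<alpha> * z)) \<in> borel_measurable borel" by measurable
        show "(\<integral>\<^sup>+z. Gf (b s j + \<alpha> * z) \<partial>lborel) \<le> CG"
          by (subst nn_integral_complex_affine) (auto simp: CG_def \<alpha>)
      qed (use nin finR in auto)
      also have "\<dots> \<le> CG * (CG ^ card J * V ^ card R)"
        using ji by (intro mult_left_mono insert.IH) auto
      finally show ?case using insert.hyps by (simp add: mult_ac)
    qed
  qed
  have "(\<integral>\<^sup>+s. indicator sym_disc (sym_of s) * ennreal (exp (- c * quad x (sym_of s))) \<partial>cprod sym_pairs)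
      \<le> (\<integral>\<^sup>+s. F2 s \<partial>cprod sym_pairs)"
    by (intro nn_integral_mono bound)
  also have "\<dots> = (\<integral>\<^sup>+s. F2 s \<partial>cprod (insert {i} (R \<union> (\<lambda>j. {i, j}) ` (-{i}))))"
    by (simp only: pairs[symmetric])
  also have "\<dots> \<le> CH * (\<integral>\<^sup>+s. F1 (-{i}) s \<partial>cprod (R \<union> (\<lambda>j. {i, j}) ` (-{i})))"
  proof (rule nn_integral_insert_le[where f = "\<lambda>s z. Hf (B s + (cnj (x $ i))\<^sup>2 * z)"])
    show "{i} \<notin> R \<union> (\<lambda>j. {i, j}) ` (-{i})" by (auto simp: R_def)
    show "F2 \<in> borel_measurable (cprod (insert {i} (R \<union> (\<lambda>j. {i, j}) ` (-{i}))))"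
      using F2m by (simp only: pairs[symmetric])
    show "F1 (-{i}) \<in> borel_measurable (cprod (R \<union> (\<lambda>j. {i, j}) ` (-{i})))"
      by (rule F1m) auto
    fix s z
    have "(\<Prod>l\<in>-{i}. Gf (b (s({i} := z)) l + \<alpha> * (s({i} := z)) {i, l}))
       = (\<Prod>l\<in>-{i}. Gf (b s l + \<alpha> * s {i, l}))"
      by (rule prod.cong[OF refl]) (auto simp: updb)
    then show "F2 (s({i} := z)) \<le> F1 (-{i}) s * Hf (B s + (cnj (x $ i))\<^sup>2 * z)"
      by (simp add: F2_def F1_def upd0 updB)
    show "(\<lambda>z. Hf (B s + (cnj (x $ i))\<^sup>2 * z)) \<in> borel_measurable borel" by measurable
    show "(\<integral>\<^sup>+z. Hf (B s + (cnj (x $ i))\<^sup>2 * z) \<partial>lborel) \<le> CH"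
      using xi by (subst nn_integral_complex_affine) (auto simp: CH_def norm_power)
  qed (use finR in auto)
  also have "\<dots> \<le> CH * (CG ^ card (-{i}) * V ^ card R)"
    by (intro mult_left_mono S1) auto
  also have "card (-{i}) = CARD('n) - 1"
    by (simp add: Compl_eq_Diff_UNIV card_Diff_singleton)
  also have "CG = decay_mass / ennreal a * (decay_mass / ennreal a) / ennreal ((cmod (x $ i))\<^sup>2)"
    unfolding CG_def Gf_def using a by (subst nn_integral_decay_complex) auto
  also have "CH = decay_mass / ennreal (c/3) * (decay_mass / ennreal (a / norm x)) / ennreal ((cmod (x $ i)) ^ 4)"
    unfolding CH_def Hf_def using a c x0 by (subst nn_integral_decay_complex) auto
  finally show ?thesis by (simp add: V_def R_def)
qed

text \<open>The exponent is shared evenly among the coordinates: each receives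
  \<open>p / DIM('a) > 1\<close>, and \<open>1 + norm x\<close> dominates every
  \<open>1 + \<bar>x \<bullet> b\<bar>\<close>, so the integrand is bounded by a product of
  integrable functions.\<close>

lemma nn_integral_norm_decay_finite:
  assumes p: "p > real DIM('a::euclidean_space)"
  shows "(\<integral>\<^sup>+x. ennreal ((1 + norm (x :: 'a)) powr (- p)) \<partial>lborel) < \<infinity>"
proof -
  define q where "q = p / real DIM('a)"
  have q: "q > 1" "p = q * real DIM('a)" using p by (simp_all add: q_def divide_simps)
  have le: "(1 + norm x) powr (- p) \<le> (\<Prod>b\<in>Basis. (1 + \<bar>x \<bullet> b\<bar>) powr (- q))" for x :: 'a
  proof -
    have "0 < 1 + norm x" by (simp add: add_pos_nonneg)
    then have "(1 + norm x) powr (- p) = (\<Prod>b\<in>(Basis::'a set). (1 + norm x) powr (- q))"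
      by (simp add: q(2) powr_powr flip: powr_realpow)
    also have "\<dots> \<le> (\<Prod>b\<in>Basis. (1 + \<bar>x \<bullet> b\<bar>) powr (- q))"
      using q(1) by (intro prod_mono conjI powr_mono2') (auto simp: Basis_le_norm)
    finally show ?thesis .
  qed
  have "(\<integral>\<^sup>+x. ennreal ((1 + norm (x :: 'a)) powr (- p)) \<partial>lborel) \<le>
      (\<integral>\<^sup>+x. (\<Prod>b\<in>Basis. ennreal ((1 + \<bar>(x :: 'a) \<bullet> b\<bar>) powr (- q))) \<partial>lborel)"
    using le by (intro nn_integral_mono) (simp add: prod_ennreal ennreal_leI)
  also have "\<dots> = (\<Prod>b\<in>(Basis::'a set). \<integral>\<^sup>+u. ennreal ((1 + \<bar>u\<bar>) powr (- q)) \<partial>lborel)"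
    by (rule nn_integral_lborel_prod) auto
  also have "\<dots> < \<infinity>"
    using nn_integral_powr_decay_finite[OF q(1)] by (simp add: power_less_top_ennreal)
  finally show ?thesis .
qed

lemma emeasure_unit_disc_finite: "emeasure lborel (cball (0::complex) r) < \<infinity>"
  by (rule emeasure_bounded_finite) simp

text \<open>The image of a sigma-finite measure need not be sigma-finite; here the matrices with
  entries bounded by \<open>k\<close> pull back into a product of discs, which has finite
  measure.\<close>

lemma sigma_finite_sym_lebesgue: "sigma_finite_measure (sym_lebesgue :: (complex^'n::finite^'n) measure)"
proof
  let ?A = "\<lambda>k::nat. {Y :: complex^'n^'n. \<forall>i j. cmod (Y $ i $ j) \<le> real k}"
  have closed: "closed (?A k)" for k
    by (intro closed_Collect_all closed_Collect_le continuous_intros)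
  have fin: "emeasure sym_lebesgue (?A k) \<noteq> \<infinity>" for k
  proof -
    have "emeasure sym_lebesgue (?A k) = emeasure (cprod sym_pairs) (sym_of -` ?A k \<inter> space (cprod sym_pairs))"
      unfolding sym_lebesgue_eq using closed by (intro emeasure_distr) auto
    also have "\<dots> \<le> emeasure (cprod (sym_pairs :: 'n set set)) (\<Pi>\<^sub>E p\<in>sym_pairs. cball 0 (real k))"
    proof (rule emeasure_mono)
      show "sym_of -` ?A k \<inter> space (cprod sym_pairs) \<subseteq> (\<Pi>\<^sub>E p\<in>sym_pairs. cball 0 (real k))"
        by (auto simp: space_PiM PiE_iff sym_of_def sym_pairs_def)
    qed (auto intro!: sets_PiM_I_finite)
    also have "\<dots> = (\<Prod>p\<in>(sym_pairs :: 'n set set). emeasure lborel (cball (0::complex) (real k)))"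
      by (rule cp.emeasure_PiM) auto
    also have "\<dots> < \<infinity>"
      using emeasure_unit_disc_finite[of "real k"] by (simp add: power_less_top_ennreal)
    finally show ?thesis by simp
  qed
  have "(\<Union>k. ?A k) = UNIV"
  proof safe
    fix Y :: "complex^'n^'n"
    obtain k :: nat where k: "norm Y \<le> real k" using real_arch_simple by blast
    have "cmod (Y $ i $ j) \<le> real k" for i j
      using k Finite_Cartesian_Product.norm_nth_le[of Y i] Finite_Cartesian_Product.norm_nth_le[of "Y $ i" j] by linarith
    then show "Y \<in> (\<Union>k. ?A k)" by blast
  qed auto
  then show "\<exists>A. countable A \<and> A \<subseteq> sets sym_lebesgue \<and> \<Union>A = space (sym_lebesgue :: (complex^'n^'n) measure) \<and> (\<forall>a\<in>A. emeasure sym_lebesgue a \<noteq> \<infinity>)"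
    using fin closed by (intro exI[of _ "range ?A"]) auto
qed

section \<open>Iterated integrals for \<open>mu_L\<close>\<close>

interpretation sl: sigma_finite_measure "sym_lebesgue :: (complex^'n::finite^'n) measure"
  by (rule sigma_finite_sym_lebesgue)

interpretation mL: pair_sigma_finite "lborel :: (complex^'n) measure" "sym_lebesgue :: (complex^'n::finite^'n) measure"
  by standard

lemma sets_mu_L [simp, measurable_cong]: "sets (mu_L :: 'n::finite point measure) = sets borel"
  unfolding mu_L_def borel_prod[symmetric] by (rule sets_pair_measure_cong) auto

lemma space_mu_L [simp]: "space mu_L = UNIV"
  by (simp add: mu_L_def space_pair_measure)

lemma nn_integral_mu_L:
  assumes "f \<in> borel_measurable borel"
  shows "(\<integral>\<^sup>+z. f z \<partial>(mu_L :: 'n::finite point measure)) = (\<integral>\<^sup>+x. \<integral>\<^sup>+Y. f (x, Y) \<partial>sym_lebesgue \<partial>lborel)" (is ?A)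
    and "(\<integral>\<^sup>+z. f z \<partial>(mu_L :: 'n::finite point measure)) = (\<integral>\<^sup>+Y. \<integral>\<^sup>+x. f (x, Y) \<partial>lborel \<partial>sym_lebesgue)" (is ?B)
proof -
  have f: "f \<in> borel_measurable (lborel \<Otimes>\<^sub>M sym_lebesgue)"
    using assms by (simp add: mu_L_def[symmetric] measurable_cong_sets[OF sets_mu_L refl])
  show ?A
    unfolding mu_L_def by (rule sl.nn_integral_fst[symmetric, OF f])
  show ?B
    unfolding mu_L_def using f by (intro mL.nn_integral_snd[symmetric]) (simp add: case_prod_unfold)
qed

lemma quad_continuous: "continuous_on UNIV (\<lambda>z :: 'n::finite point. quad (fst z) (snd z))"
  unfolding quad_def bil_def cnj_vec_def matrix_vector_mult_def
  by (intro continuous_intros)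

lemma quad_measurable [measurable]: "(\<lambda>z :: 'n::finite point. quad (fst z) (snd z)) \<in> borel_measurable borel"
  by (intro borel_measurable_continuous_onI quad_continuous)

lemma snd_in_sym_disc_measurable [measurable]: "(\<lambda>z :: 'n::finite point. indicator sym_disc (snd z) :: ennreal) \<in> borel_measurable borel"
proof -
  have "snd \<in> (borel :: 'n point measure) \<rightarrow>\<^sub>M (borel :: (complex^'n^'n) measure)"
    by (intro borel_measurable_continuous_onI continuous_intros)
  then show ?thesis
    by (rule measurable_compose) (rule borel_measurable_indicator[OF sym_disc_borel])
qed

text \<open>For \<open>norm x \<le> 1\<close> the volume of the disc is enough. Otherwise
  \<open>i\<close> is chosen with \<open>x $ i\<close> of largest modulus, so that
  \<open>norm x \<le> n * cmod (x $ i)\<close> and the powers of \<open>cmod (x $ i)\<close> in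
  \<open>inner_integral_bound\<close> turn into powers of \<open>norm x\<close>.\<close>

lemma inner_integral_decay:
  assumes c: "c > 0"
  shows "\<exists>K\<ge>0. \<forall>x :: complex^'n.
    (\<integral>\<^sup>+Y. indicator sym_disc Y * ennreal (exp (- c * quad x Y)) \<partial>sym_lebesgue)
      \<le> ennreal (K * (1 + norm x) powr - (2 * real CARD('n) + 1))"
proof -
  define n where "n = CARD('n)"
  have n: "n \<ge> 1" by (simp add: n_def Suc_le_eq)
  define p where "p = 2 * real n + 1"
  have p: "(1 + norm x) powr - p = 1 / (1 + norm x) ^ (2 * n + 1)" for x :: "complex^'n"
  proof -
    have "0 < 1 + norm x" by (simp add: add_pos_nonneg)
    then have "(1 + norm x) powr p = (1 + norm x) ^ (2 * n + 1)"
      using powr_realpow[of "1 + norm x" "2 * n + 1"] by (simp add: p_def add_ac)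
    then show ?thesis by (simp add: powr_minus divide_inverse)
  qed
  obtain d where d: "d \<ge> 0" "decay_mass = ennreal d"
    using decay_mass_finite by (cases decay_mass) auto
  obtain v where v: "v \<ge> 0" "emeasure lborel (cball (0::complex) 1) = ennreal v"
    using emeasure_unit_disc_finite[of 1] by (cases "emeasure lborel (cball (0::complex) 1)") auto
  define a where "a = sqrt (c/6)"
  have a: "a > 0" using c by (simp add: a_def)
  have trans: "(\<integral>\<^sup>+Y. indicator sym_disc Y * ennreal (exp (- c * quad x Y)) \<partial>sym_lebesgue)
     = (\<integral>\<^sup>+s. indicator sym_disc (sym_of s) * ennreal (exp (- c * quad x (sym_of s))) \<partial>cprod sym_pairs)" for x :: "complex^'n"
  proof -
    have "(\<lambda>Y. quad x Y) \<in> borel_measurable borel"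
      unfolding quad_def bil_def cnj_vec_def matrix_vector_mult_def
      by (intro borel_measurable_continuous_onI continuous_intros)
    then have "(\<lambda>Y. indicator sym_disc Y * ennreal (exp (- c * quad x Y))) \<in> borel_measurable borel"
      by measurable
    then show ?thesis unfolding sym_lebesgue_eq by (intro nn_integral_distr) auto
  qed
  define k where "k = (\<lambda>i::'n. card {p\<in>sym_pairs. i \<notin> p})"
  define m where "m = card (sym_pairs :: 'n set set)"
  \<comment> \<open>The powers of 2 come from \<open>1 + r \<le> 2\<close> for
    \<open>r \<le> 1\<close> and from \<open>1 + r \<le> 2 * r\<close> for \<open>r > 1\<close>; the
    power of \<open>n\<close> in \<open>A\<close> comes from \<open>r \<le> n * \<rho>\<close>.
    Summing \<open>A\<close> over all \<open>i\<close> makes \<open>K\<close> independent of the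
    index chosen for \<open>x\<close>.\<close>
  define K0 where "K0 = v ^ m * 2 ^ (2 * n + 1)"
  define A where "A i = 3 * d\<^sup>2 / (c * a) * (d\<^sup>2 / a\<^sup>2) ^ (n - 1) * v ^ k i * real n ^ (2 * n + 2) * 2 ^ (2 * n + 1)" for i
  define K where "K = K0 + (\<Sum>i\<in>UNIV. A i)"
  have A0: "A i \<ge> 0" for i using d v c a by (simp add: A_def)
  have K0: "K0 \<ge> 0" using v by (simp add: K0_def)
  have KA: "A i \<le> K" for i
    using member_le_sum[of i UNIV A] A0 K0 by (simp add: K_def)
  have KK: "K0 \<le> K" using sum_nonneg[of UNIV A] A0 by (simp add: K_def)
  have "(\<integral>\<^sup>+s. indicator sym_disc (sym_of s) * ennreal (exp (- c * quad x (sym_of s))) \<partial>cprod sym_pairs)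
     \<le> ennreal (K * (1 + norm x) powr - p)" (is "?I \<le> _") for x :: "complex^'n"
  proof (cases "norm x \<le> 1")
    case True
    have "?I \<le> (\<integral>\<^sup>+s. (\<Prod>p\<in>sym_pairs. indicator (cball 0 1) (s p)) \<partial>cprod (sym_pairs :: 'n set set))"
    proof (rule nn_integral_mono)
      fix s :: "'n set \<Rightarrow> complex"
      show "indicator sym_disc (sym_of s) * ennreal (exp (- c * quad x (sym_of s))) \<le> (\<Prod>p\<in>sym_pairs. indicator (cball 0 1) (s p))"
      proof (cases "sym_of s \<in> sym_disc")
        case True
        have "(\<Prod>p\<in>sym_pairs. indicator (cball 0 1) (s p)) = (1::ennreal)"
          by (rule sym_disc_indicator_prod[OF True order_refl])
        moreover have "exp (- c * quad x (sym_of s)) \<le> 1"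
          using quad_ge(2)[OF True, of x] c by simp
        ultimately show ?thesis using True by simp
      qed simp
    qed
    also have "\<dots> = ennreal v ^ m"
      unfolding m_def v(2)[symmetric]
      by (subst cp.product_nn_integral_prod) (auto intro!: borel_measurable_indicator)
    also have "\<dots> = ennreal (v ^ m)" using v by (simp add: ennreal_power)
    also have "\<dots> \<le> ennreal (K * (1 + norm x) powr - p)"
    proof (rule ennreal_leI)
      have "(1 + norm x) ^ (2 * n + 1) \<le> 2 ^ (2 * n + 1)"
        using True by (intro power_mono) auto
      moreover have "0 < (1 + norm x) ^ (2 * n + 1)" by (intro zero_less_power) (simp add: add_pos_nonneg)
      ultimately have "v ^ m \<le> K0 / (1 + norm x) ^ (2 * n + 1)"
        using v by (simp add: K0_def pos_le_divide_eq mult_left_mono del: power_Suc)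
      also have "\<dots> \<le> K / (1 + norm x) ^ (2 * n + 1)"
        using KK by (intro divide_right_mono) auto
      finally show "v ^ m \<le> K * (1 + norm x) powr - p" by (simp add: p)
    qed
    finally show ?thesis .
  next
    case False
    define r where "r = norm x"
    have r: "r > 1" using False by (simp add: r_def)
    obtain i where i: "\<And>j. cmod (x $ j) \<le> cmod (x $ i)"
    proof -
      have "Max (range (\<lambda>j. cmod (x $ j))) \<in> range (\<lambda>j. cmod (x $ j))" by (intro Max_in) auto
      then obtain i where i: "Max (range (\<lambda>j. cmod (x $ j))) = cmod (x $ i)" by (rule rangeE)
      have "cmod (x $ j) \<le> cmod (x $ i)" for j unfolding i[symmetric] by (intro Max_ge) auto
      then show ?thesis by (rule that)
    qed
    define \<rho> where "\<rho> = cmod (x $ i)"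
    have "norm x \<le> (\<Sum>j\<in>UNIV. cmod (x $ j))"
      unfolding norm_vec_def by (rule L2_set_le_sum) simp
    also have "\<dots> \<le> real n * \<rho>"
      using sum_bounded_above[of UNIV "\<lambda>j. cmod (x $ j)" \<rho>] i by (simp add: n_def \<rho>_def)
    finally have rn: "r \<le> real n * \<rho>" by (simp add: r_def)
    then have \<rho>: "\<rho> > 0" using r by (cases "\<rho> > 0") (auto simp: \<rho>_def)
    have "?I \<le> (decay_mass / ennreal (c/3) * (decay_mass / ennreal (a / norm x)) / ennreal (\<rho> ^ 4))
      * ((decay_mass / ennreal a * (decay_mass / ennreal a) / ennreal (\<rho>\<^sup>2)) ^ (n - 1)
      * (emeasure lborel (cball (0::complex) 1)) ^ k i)"
      unfolding \<rho>_def n_def k_def a_def using \<rho> c by (intro inner_integral_bound) (auto simp: \<rho>_def)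
    also have "\<dots> = ennreal ((d / (c/3) * (d / (a / r)) / \<rho> ^ 4) * ((d / a * (d / a) / \<rho>\<^sup>2) ^ (n - 1) * v ^ k i))"
      using d v c a r \<rho> unfolding d(2) v(2) r_def[symmetric]
      by (simp add: divide_ennreal ennreal_mult[symmetric] ennreal_power)
    also have "\<dots> \<le> ennreal (K * (1 + norm x) powr - p)"
    proof (rule ennreal_leI)
      \<comment> \<open>The entry \<open>{i}\<close> contributes \<open>\<rho> ^ 4\<close> and each
        of the \<open>n - 1\<close> other entries of row \<open>i\<close> contributes
        \<open>\<rho>^2\<close>. Against the single \<open>r\<close> in the numerator, which stems
        from the width in the direction of \<open>Im z\<close>, this leaves the power
        \<open>-(2n + 1)\<close>.\<close>
      have pw: "\<rho> ^ 4 * (\<rho>\<^sup>2) ^ (n - 1) = \<rho> ^ (2 * n + 2)"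
      proof -
        have "4 + 2 * (n - 1) = 2 * n + 2" using n by simp
        then show ?thesis by (simp only: power_mult[symmetric] power_add[symmetric])
      qed
      have "(d / (c/3) * (d / (a / r)) / \<rho> ^ 4) * ((d / a * (d / a) / \<rho>\<^sup>2) ^ (n - 1) * v ^ k i)
        = 3 * d\<^sup>2 / (c * a) * (d\<^sup>2 / a\<^sup>2) ^ (n - 1) * v ^ k i * r / (\<rho> ^ 4 * (\<rho>\<^sup>2) ^ (n - 1))"
        using a c r \<rho> by (simp add: power_divide power2_eq_square power_mult_distrib) (simp add: mult_ac)
      also have "\<dots> = (3 * d\<^sup>2 / (c * a) * (d\<^sup>2 / a\<^sup>2) ^ (n - 1) * v ^ k i) * (r / \<rho> ^ (2 * n + 2))"
        unfolding pw by simp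
      also have "\<dots> \<le> (3 * d\<^sup>2 / (c * a) * (d\<^sup>2 / a\<^sup>2) ^ (n - 1) * v ^ k i) * (real n ^ (2 * n + 2) * 2 ^ (2 * n + 1) / (1 + r) ^ (2 * n + 1))"
      proof (rule mult_left_mono)
        have "r ^ (2 * n + 2) \<le> (real n * \<rho>) ^ (2 * n + 2)"
          using rn r by (intro power_mono) auto
        moreover have "(1 + r) ^ (2 * n + 1) \<le> (2 * r) ^ (2 * n + 1)"
          using r by (intro power_mono) auto
        ultimately have "(1 + r) ^ (2 * n + 1) * (r * r ^ (2 * n + 1)) \<le> (2 * r) ^ (2 * n + 1) * (real n * \<rho>) ^ (2 * n + 2)"
          using r by (intro mult_mono) auto
        then have "r ^ (2 * n + 1) * ((1 + r) ^ (2 * n + 1) * r) \<le> r ^ (2 * n + 1) * (2 ^ (2 * n + 1) * (real n ^ (2 * n + 2) * \<rho> ^ (2 * n + 2)))"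
          by (simp only: power_mult_distrib mult_ac)
        then have "(1 + r) ^ (2 * n + 1) * r \<le> 2 ^ (2 * n + 1) * (real n ^ (2 * n + 2) * \<rho> ^ (2 * n + 2))"
          using r by (subst (asm) mult_le_cancel_left_pos) auto
        then show "r / \<rho> ^ (2 * n + 2) \<le> real n ^ (2 * n + 2) * 2 ^ (2 * n + 1) / (1 + r) ^ (2 * n + 1)"
          using r \<rho> by (simp add: divide_le_eq le_divide_eq zero_less_power mult_ac del: power_Suc)
      qed (use d v c a in auto)
      also have "\<dots> = A i / (1 + r) ^ (2 * n + 1)" by (simp add: A_def)
      also have "\<dots> \<le> K / (1 + r) ^ (2 * n + 1)"
        using KA r by (intro divide_right_mono) auto
      finally show "(d / (c/3) * (d / (a / r)) / \<rho> ^ 4) * ((d / a * (d / a) / \<rho>\<^sup>2) ^ (n - 1) * v ^ k i) \<le> K * (1 + norm x) powr - p"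
        by (simp add: p r_def)
    qed
    finally show ?thesis .
  qed
  moreover have "K \<ge> 0" using KK K0 by simp
  ultimately show ?thesis unfolding trans p_def n_def by blast
qed

text \<open>The decay exponent \<open>2n + 1\<close> exceeds the real dimension \<open>2n\<close> of
  \<open>complex^'n\<close> by one, which is just enough.\<close>

lemma gauss_finite:
  assumes c: "c > 0"
  shows "(\<integral>\<^sup>+z. indicator sym_disc (snd z) * ennreal (exp (- c * quad (fst z) (snd z))) \<partial>(mu_L :: 'n::finite point measure)) < \<infinity>"
proof -
  obtain K where K: "K \<ge> 0" "\<And>x :: complex^'n.
    (\<integral>\<^sup>+Y. indicator sym_disc Y * ennreal (exp (- c * quad x Y)) \<partial>sym_lebesgue)
      \<le> ennreal (K * (1 + norm x) powr - (2 * real CARD('n) + 1))"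
    using inner_integral_decay[OF c, where 'n = 'n] by blast
  have "(\<integral>\<^sup>+z. indicator sym_disc (snd z) * ennreal (exp (- c * quad (fst z) (snd z))) \<partial>(mu_L :: 'n point measure))
    = (\<integral>\<^sup>+x. \<integral>\<^sup>+Y. indicator sym_disc Y * ennreal (exp (- c * quad (x :: complex^'n) Y)) \<partial>sym_lebesgue \<partial>lborel)"
    by (subst nn_integral_mu_L(1)) simp_all
  also have "\<dots> \<le> (\<integral>\<^sup>+x. ennreal K * ennreal ((1 + norm (x :: complex^'n)) powr - (2 * real CARD('n) + 1)) \<partial>lborel)"
    using K by (intro nn_integral_mono) (simp add: ennreal_mult)
  also have "\<dots> = ennreal K * (\<integral>\<^sup>+x. ennreal ((1 + norm (x :: complex^'n)) powr - (2 * real CARD('n) + 1)) \<partial>lborel)"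
    by (rule nn_integral_cmult) measurable
  also have "\<dots> < \<infinity>"
    using nn_integral_norm_decay_finite[where p = "2 * real CARD('n) + 1" and 'a = "complex^'n"]
    by (simp add: ennreal_mult_less_top)
  finally show ?thesis .
qed

section \<open>Fractional linear action and the transformed coherent states\<close>

lemma matrix_mult_add_left:
  fixes A B :: "complex^'n^'k" and C :: "complex^'m^'n"
  shows "(A + B) ** C = A ** C + B ** C"
  by (simp add: vec_eq_iff matrix_matrix_mult_def sum.distrib algebra_simps)

lemma matrix_mult_diff_left:
  fixes A B :: "complex^'n^'k" and C :: "complex^'m^'n"
  shows "(A - B) ** C = A ** C - B ** C"
  by (simp add: vec_eq_iff matrix_matrix_mult_def sum_subtractf algebra_simps)

lemma bil_mv_mv: "(M *v a) \<star> (N *v b) = a \<star> ((transpose M ** N) *v b)"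
proof -
  have "a \<star> (transpose M *v (N *v b)) = (M *v a) \<star> (N *v b)"
    by (simp only: bil_mv[of a] transpose_transpose)
  then show ?thesis by (simp only: matrix_vector_mul_assoc)
qed

text \<open>Unlike \<open>matrix_inv\<close>, which is a choice, the Cramer formula is visibly measurable and holomorphic
  in the entries.\<close>
definition adjugate :: "complex^'n^'n \<Rightarrow> complex^'n^'n" where
  "adjugate M = (\<chi> i j. det (\<chi> k l. if l = i then (if k = j then 1 else 0) else M $ k $ l))"

definition cramer_inv :: "complex^'n^'n \<Rightarrow> complex^'n^'n" where
  "cramer_inv M = scale_mat (inverse (det M)) (adjugate M)"

lemma cramer_inv_eq:
  assumes "det M \<noteq> 0"
  shows "cramer_inv M = matrix_inv M"
proof -
  have "matrix_inv M $ i $ j = cramer_inv M $ i $ j" for i j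
  proof -
    have "M *v (matrix_inv M *v axis j 1) = axis j 1"
      by (simp add: matrix_vector_mul_assoc matrix_inv_mult[OF assms])
    then have "matrix_inv M *v axis j 1 = (\<chi> k. det (\<chi> i l. if l = k then axis j 1 $ i else M $ i $ l) / det M)"
      using cramer[OF assms] by blast
    moreover have "matrix_inv M $ i $ j = (matrix_inv M *v axis j 1) $ i"
      by (simp add: matrix_vector_mult_def axis_def if_distrib cong: if_cong)
    ultimately show ?thesis
      by (simp add: cramer_inv_def scale_mat_def adjugate_def axis_def divide_inverse mult.commute cong: if_cong)
  qed
  then show ?thesis by (simp add: vec_eq_iff)
qed

lemma continuous_on_adjugate: "continuous_on UNIV (adjugate :: complex^'n^'n \<Rightarrow> _)"
proof -
  have "continuous_on UNIV (\<lambda>M :: complex^'n^'n. if l = i then (if k = j then 1 else 0) else M $ k $ l)" for i j k l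
    by (cases "l = i") (auto intro!: continuous_intros)
  then show ?thesis unfolding adjugate_def[abs_def] by (intro continuous_intros)
qed

section \<open>Measurability of the matrix operations\<close>

lemma borel_measurable_det [measurable (raw)]:
  "f \<in> borel_measurable N \<Longrightarrow> (\<lambda>x. det (f x :: complex^'n^'n)) \<in> borel_measurable N"
  by (rule measurable_compose[where g = det], assumption)
    (intro borel_measurable_continuous_onI continuous_intros)

lemma borel_measurable_adjugate:
  "f \<in> borel_measurable N \<Longrightarrow> (\<lambda>x. adjugate (f x :: complex^'n^'n)) \<in> borel_measurable N"
  by (rule measurable_compose[where g = adjugate], assumption)
    (intro borel_measurable_continuous_onI continuous_on_adjugate)

lemma borel_measurable_scale_mat [measurable (raw)]:
  assumes "c \<in> borel_measurable N" "f \<in> borel_measurable N"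
  shows "(\<lambda>x. scale_mat (c x) (f x :: complex^'n^'n)) \<in> borel_measurable N"
  using assms unfolding scale_mat_def
  by (rule borel_measurable_continuous_Pair) (intro continuous_intros)

lemma borel_measurable_cramer_inv [measurable (raw)]:
  "f \<in> borel_measurable N \<Longrightarrow> (\<lambda>x. cramer_inv (f x :: complex^'n^'n)) \<in> borel_measurable N"
  unfolding cramer_inv_def by (intro borel_measurable_scale_mat borel_measurable_adjugate borel_measurable_inverse borel_measurable_det)

lemma borel_measurable_mm [measurable (raw)]:
  assumes "f \<in> borel_measurable N" "g \<in> borel_measurable N"
  shows "(\<lambda>x. (f x :: complex^'n^'n) ** (g x :: complex^'n^'n)) \<in> borel_measurable N"
  using assms unfolding matrix_matrix_mult_def
  by (rule borel_measurable_continuous_Pair) (intro continuous_intros)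

lemma borel_measurable_mv [measurable (raw)]:
  assumes "f \<in> borel_measurable N" "g \<in> borel_measurable N"
  shows "(\<lambda>x. (f x :: complex^'n^'n) *v g x) \<in> borel_measurable N"
  using assms unfolding matrix_vector_mult_def
  by (rule borel_measurable_continuous_Pair) (intro continuous_intros)

lemma borel_measurable_bil [measurable (raw)]:
  assumes "f \<in> borel_measurable N" "g \<in> borel_measurable N"
  shows "(\<lambda>x. (f x :: complex^'n) \<star> g x) \<in> borel_measurable N"
  using assms unfolding bil_def
  by (rule borel_measurable_continuous_Pair) (intro continuous_intros)

lemma borel_measurable_cnj_vec [measurable (raw)]:
  "f \<in> borel_measurable N \<Longrightarrow> (\<lambda>x. cnj_vec (f x :: complex^'n)) \<in> borel_measurable N"
  by (rule measurable_compose[where g = cnj_vec], assumption)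
    (unfold cnj_vec_def, intro borel_measurable_continuous_onI continuous_intros)

lemma borel_measurable_cnj_mat [measurable (raw)]:
  "f \<in> borel_measurable N \<Longrightarrow> (\<lambda>x. cnj_mat (f x :: complex^'n^'n)) \<in> borel_measurable N"
  by (rule measurable_compose[where g = cnj_mat], assumption)
    (unfold cnj_mat_def, intro borel_measurable_continuous_onI continuous_intros)

lemma borel_measurable_power_int_complex [measurable (raw)]:
  "f \<in> borel_measurable N \<Longrightarrow> (\<lambda>x. (f x :: complex) powi m) \<in> borel_measurable N"
  by (cases "m \<ge> 0") (simp_all add: power_int_def)

text \<open>The term linear in \<open>y = x - Y *v cnj_vec x\<close> is absorbed by completing a
  square, using \<open>(norm y)^2 \<le> 2 * quad x Y\<close>. This costs only half of
  \<open>quad x Y\<close>; the constant 5 is 4 from the square and 1 from the term quadratic in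
  \<open>v\<close>.\<close>

lemma coherent_exponent_le:
  fixes x :: "complex^'n"
  assumes Y: "Y \<in> sym_disc"
  shows "Re (2 * ((x - Y *v cnj_vec x) \<star> cnj_vec v) + cnj_vec v \<star> (Y *v cnj_vec v)) \<le> quad x Y / 2 + 5 * (norm v)\<^sup>2"
proof -
  define y where "y = x - Y *v cnj_vec x"
  have "2 * Re (y \<star> cnj_vec v) \<le> 2 * (norm y * norm v)"
    using complex_Re_le_cmod[of "y \<star> cnj_vec v"] cmod_bil_le[of y "cnj_vec v"] by simp
  also have "\<dots> \<le> (norm y)\<^sup>2 / 4 + 4 * (norm v)\<^sup>2"
  proof -
    have "0 \<le> (norm y / 2 - 2 * norm v)\<^sup>2" by simp
    then show ?thesis by (simp add: power2_eq_square algebra_simps)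
  qed
  also have "(norm y)\<^sup>2 / 4 \<le> quad x Y / 2"
    using quad_ge(1)[OF Y, of x] by (simp add: y_def)
  finally have 1: "2 * Re (y \<star> cnj_vec v) \<le> quad x Y / 2 + 4 * (norm v)\<^sup>2" by simp
  have "Re (cnj_vec v \<star> (Y *v cnj_vec v)) \<le> norm v * norm (Y *v cnj_vec v)"
    using complex_Re_le_cmod order_trans cmod_bil_le[of "cnj_vec v" "Y *v cnj_vec v"] by fastforce
  also have "\<dots> \<le> norm v * norm v"
    using sym_discD(3)[OF Y, of "cnj_vec v"] by (intro mult_left_mono) auto
  finally have "Re (cnj_vec v \<star> (Y *v cnj_vec v)) \<le> (norm v)\<^sup>2" by (simp add: power2_eq_square)
  with 1 show ?thesis by (simp add: y_def)
qed

text \<open>Entrywise holomorphy in one parameter suffices, because the mean value property is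
  applied only along discs \<open>t \<mapsto> (t w, t^2 Y)\<close>.\<close>

definition hol_vec :: "complex set \<Rightarrow> (complex \<Rightarrow> complex^'n) \<Rightarrow> bool" where
  "hol_vec U v \<longleftrightarrow> (\<forall>i. (\<lambda>t. v t $ i) holomorphic_on U)"

definition hol_mat :: "complex set \<Rightarrow> (complex \<Rightarrow> complex^'n^'m) \<Rightarrow> bool" where
  "hol_mat U M \<longleftrightarrow> (\<forall>i j. (\<lambda>t. M t $ i $ j) holomorphic_on U)"

named_theorems hol_vm

lemma hol_vec_intros [hol_vm]:
  "hol_vec U (\<lambda>t. c)"
  "hol_vec U v \<Longrightarrow> hol_vec U w \<Longrightarrow> hol_vec U (\<lambda>t. v t + w t)"
  "hol_vec U v \<Longrightarrow> hol_vec U w \<Longrightarrow> hol_vec U (\<lambda>t. v t - w t)"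
  "f holomorphic_on U \<Longrightarrow> hol_vec U v \<Longrightarrow> hol_vec U (\<lambda>t. f t *s v t)"
  "hol_mat U M \<Longrightarrow> hol_vec U v \<Longrightarrow> hol_vec U (\<lambda>t. M t *v v t)"
  by (auto simp: hol_vec_def hol_mat_def matrix_vector_mult_def intro!: holomorphic_intros)

lemma hol_mat_intros [hol_vm]:
  "hol_mat U (\<lambda>t. C)"
  "hol_mat U M \<Longrightarrow> hol_mat U N \<Longrightarrow> hol_mat U (\<lambda>t. M t + N t)"
  "hol_mat U M \<Longrightarrow> hol_mat U N \<Longrightarrow> hol_mat U (\<lambda>t. M t ** N t)"
  "f holomorphic_on U \<Longrightarrow> hol_mat U R \<Longrightarrow> hol_mat U (\<lambda>t. scale_mat (f t) (R t))"
  by (auto simp: hol_mat_def matrix_matrix_mult_def scale_mat_def intro!: holomorphic_intros)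

lemma hol_bil [hol_vm]: "hol_vec U v \<Longrightarrow> hol_vec U w \<Longrightarrow> (\<lambda>t. v t \<star> w t) holomorphic_on U"
  by (auto simp: hol_vec_def bil_def intro!: holomorphic_intros)

lemma hol_det [hol_vm]: "hol_mat U M \<Longrightarrow> (\<lambda>t. det (M t)) holomorphic_on U"
  by (auto simp: hol_mat_def det_def intro!: holomorphic_intros)

lemma hol_adjugate [hol_vm]:
  fixes M :: "complex \<Rightarrow> complex^'n^'n"
  assumes "hol_mat U M"
  shows "hol_mat U (\<lambda>t. adjugate (M t))"
  unfolding hol_mat_def adjugate_def vec_lambda_beta
proof (intro allI hol_det)
  fix i j :: 'n
  have "(\<lambda>t. if l = i then (if k = j then 1 else 0) else M t $ k $ l) holomorphic_on U" for k l
    using assms by (cases "l = i") (auto simp: hol_mat_def)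
  then show "hol_mat U (\<lambda>t. \<chi> k l. if l = i then if k = j then 1 else 0 else M t $ k $ l)"
    by (simp add: hol_mat_def)
qed

lemma hol_cramer_inv [hol_vm]:
  assumes "hol_mat U M" "\<And>t. t \<in> U \<Longrightarrow> det (M t) \<noteq> 0"
  shows "hol_mat U (\<lambda>t. cramer_inv (M t))"
  unfolding cramer_inv_def using assms by (intro hol_vm holomorphic_intros) auto

text \<open>These are the column relations of the matrix with blocks \<open>P\<close>,
  \<open>Q\<close>, \<open>cnj_mat Q\<close>, \<open>cnj_mat P\<close>. The locale is instantiated
  at the blocks \<open>adj P\<close> and \<open>- transpose Q\<close> of an inverse, for which they
  are the conjugated row relations that define \<open>S_group\<close>.\<close>

locale action_blocks =
  fixes P Q :: "complex^'n^'n"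
  assumes PQ1: "transpose P ** cnj_mat P - transpose (cnj_mat Q) ** Q = mat 1"
    and PQ2: "transpose P ** cnj_mat Q = transpose (cnj_mat Q) ** P"
begin

definition num :: "complex^'n^'n \<Rightarrow> complex^'n^'n" where "num Y = P ** Y + Q"
definition den :: "complex^'n^'n \<Rightarrow> complex^'n^'n" where "den Y = cnj_mat Q ** Y + cnj_mat P"
definition act :: "complex^'n^'n \<Rightarrow> complex^'n^'n" where "act Y = num Y ** cramer_inv (den Y)"
definition actv :: "complex^'n \<Rightarrow> complex^'n^'n \<Rightarrow> complex^'n" where
  "actv y Y = P *v y - act Y *v (cnj_mat Q *v y)"

text \<open>The inverse of \<open>J_chi\<close> times the coherent state at the image point, with
  the exponent of \<open>J_chi\<close> collapsed as in \<open>J_exponent\<close>. For the blocks of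
  the inverse of \<open>k\<close> this is the function obtained by applying \<open>pi_chi\<close> at
  \<open>k\<close> to the coherent state with parameter \<open>v\<close>.\<close>

definition kern :: "real \<Rightarrow> int \<Rightarrow> complex^'n \<Rightarrow> 'n point \<Rightarrow> complex" where
  "kern lam m v = (\<lambda>(y, Y). det (den Y) powi m *
     exp (of_real lam / 4 * (2 * (actv y Y \<star> cnj_vec v) + cnj_vec v \<star> (act Y *v cnj_vec v)
       - actv y Y \<star> (cnj_mat Q *v y))))"

lemma PQ1a: "transpose P ** cnj_mat P = mat 1 + transpose (cnj_mat Q) ** Q"
  using PQ1 by (simp add: diff_eq_eq)

lemma PQ1b: "transpose (cnj_mat P) ** P = mat 1 + transpose Q ** cnj_mat Q"
  using arg_cong[OF PQ1a, of cnj_mat] by (simp add: cnj_mat_mult cnj_mat_transpose)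

lemma PQ2b: "transpose (cnj_mat P) ** Q = transpose Q ** cnj_mat P"
  using arg_cong[OF PQ2, of cnj_mat] by (simp add: cnj_mat_mult cnj_mat_transpose)

text \<open>Invariance of the Hermitian form of signature \<open>(n, n)\<close>. Taken at
  \<open>a = Y *v u\<close> and \<open>b = u\<close>, it is the reason why the denominator is
  invertible and why the action preserves the disc.\<close>

lemma norm_form:
  "(norm (cnj_mat Q *v a + cnj_mat P *v b))\<^sup>2 - (norm (P *v a + Q *v b))\<^sup>2 = (norm b)\<^sup>2 - (norm a)\<^sup>2"
proof -
  let ?\<alpha> = "cnj_mat Q *v a + cnj_mat P *v b" and ?\<beta> = "P *v a + Q *v b"
  have c: "cnj_vec ?\<alpha> = Q *v cnj_vec a + P *v cnj_vec b"
    "cnj_vec ?\<beta> = cnj_mat P *v cnj_vec a + cnj_mat Q *v cnj_vec b"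
    by (simp_all add: cnj_vec_mv)
  have "?\<alpha> \<star> cnj_vec ?\<alpha> - ?\<beta> \<star> cnj_vec ?\<beta> = b \<star> cnj_vec b - a \<star> cnj_vec a"
    unfolding c bil_add_left bil_add_right bil_mv_mv PQ1a PQ1b PQ2 PQ2b
    by (simp add: matrix_vector_mult_add_rdistrib bil_add_right)
  then have "complex_of_real ((norm ?\<alpha>)\<^sup>2 - (norm ?\<beta>)\<^sup>2) = complex_of_real ((norm b)\<^sup>2 - (norm a)\<^sup>2)"
    by (simp only: bil_cnj_self of_real_diff)
  then show ?thesis by (simp only: of_real_eq_iff)
qed

lemma num_den_norm: "(norm (den Y *v u))\<^sup>2 - (norm (num Y *v u))\<^sup>2 = (norm u)\<^sup>2 - (norm (Y *v u))\<^sup>2"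
  using norm_form[of "Y *v u" u]
  by (simp add: den_def num_def matrix_vector_mult_add_rdistrib matrix_vector_mul_assoc)

lemma num_den_norm_less:
  assumes "Y \<in> sym_disc" "u \<noteq> 0"
  shows "norm (num Y *v u) < norm (den Y *v u)"
proof -
  have "(norm (Y *v u))\<^sup>2 < (norm u)\<^sup>2"
    using sym_discD(2)[OF assms] by (intro power_strict_mono) auto
  then have "(norm (num Y *v u))\<^sup>2 < (norm (den Y *v u))\<^sup>2"
    using num_den_norm[of Y u] by linarith
  then show ?thesis by (rule power_less_imp_less_base) simp
qed

lemma det_den:
  assumes "Y \<in> sym_disc"
  shows "det (den Y) \<noteq> 0"
proof (rule det_nz_if_injective, rule ccontr)
  fix u assume "den Y *v u = 0" "u \<noteq> 0"
  then show False using num_den_norm_less[OF assms, of u] by simp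
qed

lemma cramer_inv_den:
  assumes "Y \<in> sym_disc"
  shows "cramer_inv (den Y) ** den Y = mat 1" "den Y ** cramer_inv (den Y) = mat 1"
  using cramer_inv_eq[OF det_den[OF assms]] matrix_inv_mult[OF det_den[OF assms]] by simp_all

lemma act_den:
  assumes "Y \<in> sym_disc" shows "act Y ** den Y = num Y"
  by (simp add: act_def matrix_mul_assoc[symmetric] cramer_inv_den[OF assms])

text \<open>The symmetry of \<open>act Y\<close> with denominators cleared; it expresses invariance
  of the symplectic form.\<close>

lemma transpose_den_num:
  assumes "transpose Y = Y"
  shows "transpose (den Y) ** num Y = transpose (num Y) ** den Y"
proof -
  have PQ2x: "transpose P ** (cnj_mat Q ** Z) = transpose (cnj_mat Q) ** (P ** Z)" for Z :: "complex^'n^'n"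
    by (simp add: matrix_mul_assoc PQ2)
  have PQ1x: "transpose (cnj_mat P) ** (P ** Z) = Z + transpose Q ** (cnj_mat Q ** Z)" for Z :: "complex^'n^'n"
    by (simp add: matrix_mul_assoc PQ1b matrix_mult_add_left)
  show ?thesis
    using assms
    by (simp add: den_def num_def transpose_add matrix_transpose_mul matrix_mult_add_left matrix_add_ldistrib
        matrix_mul_assoc[symmetric] PQ1a PQ2b PQ2x PQ1x)
qed

lemma act_sym_disc:
  assumes Y: "Y \<in> sym_disc"
  shows "act Y \<in> sym_disc"
proof -
  have inv: "transpose (cramer_inv (den Y)) ** transpose (den Y) = mat 1"
    by (simp add: matrix_transpose_mul[symmetric] cramer_inv_den[OF Y] transpose_mat)
  have "act Y = transpose (cramer_inv (den Y)) ** (transpose (den Y) ** num Y) ** cramer_inv (den Y)"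
    by (simp add: matrix_mul_assoc inv act_def)
  also have "\<dots> = transpose (cramer_inv (den Y)) ** transpose (num Y)"
    unfolding transpose_den_num[OF sym_discD(1)[OF Y]]
    by (simp add: matrix_mul_assoc[symmetric] cramer_inv_den[OF Y])
  also have "\<dots> = transpose (act Y)" by (simp add: act_def matrix_transpose_mul)
  finally have "transpose (act Y) = act Y" ..
  moreover have "norm (act Y *v z) < norm z" if "z \<noteq> 0" for z
  proof -
    define u where "u = cramer_inv (den Y) *v z"
    have z: "den Y *v u = z" by (simp add: u_def matrix_vector_mul_assoc cramer_inv_den[OF Y])
    then have "u \<noteq> 0" using that by auto
    moreover have "act Y *v z = num Y *v u"
      by (simp add: act_def u_def matrix_vector_mul_assoc)
    ultimately show ?thesis using num_den_norm_less[OF Y, of u] z by simp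
  qed
  ultimately show ?thesis by (simp add: sym_disc_def)
qed

text \<open>The right side is the denominator of the inverse matrix at \<open>act Y\<close>. It is
  affine in \<open>act Y\<close>, which is again a contraction, and so the inverse of the
  denominator stays bounded up to the boundary of the disc.\<close>

lemma cramer_inv_den_eq:
  assumes Y: "Y \<in> sym_disc"
  shows "cramer_inv (den Y) = transpose P - transpose (cnj_mat Q) ** act Y"
proof -
  have "(transpose P - transpose (cnj_mat Q) ** act Y) ** den Y = transpose P ** den Y - transpose (cnj_mat Q) ** num Y"
    by (simp add: matrix_mult_diff_left matrix_mul_assoc[symmetric] act_den[OF Y])
  also have "\<dots> = mat 1"
    by (simp add: den_def num_def matrix_add_ldistrib matrix_mul_assoc PQ1a PQ2)
  finally show ?thesis
    by (metis cramer_inv_den(2)[OF Y] matrix_mul_assoc matrix_mul_lid matrix_mul_rid)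
qed

lemma actv_eq:
  assumes Y: "Y \<in> sym_disc"
  shows "actv y Y = transpose (cramer_inv (den Y)) *v y"
  unfolding cramer_inv_den_eq[OF Y]
  by (simp add: actv_def transpose_diff matrix_transpose_mul sym_discD(1)[OF act_sym_disc[OF Y]]
      matrix_vector_mult_diff_rdistrib matrix_vector_mul_assoc)

lemma J_exponent:
  assumes Y: "Y \<in> sym_disc"
  shows "y \<star> ((transpose P ** cnj_mat Q) *v y) - (cnj_mat Q *v y) \<star> (act Y *v (cnj_mat Q *v y))
    = actv y Y \<star> (cnj_mat Q *v y)"
  by (simp add: actv_def bil_diff_left bil_mv_mv[symmetric] bil_mv[of "cnj_mat Q *v y"]
      sym_discD(1)[OF act_sym_disc[OF Y]])

text \<open>In the coordinate \<open>x\<close> the action is linear,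
  \<open>x \<mapsto> P *v x + Q *v cnj_vec x\<close>. The change of \<open>quad\<close> is the real
  part of the exponent in \<open>J_exponent\<close>, which is the modulus of the covariance of
  \<open>K_chi\<close> on the diagonal under the factor \<open>J_chi\<close>.\<close>

lemma quad_act:
  fixes x :: "complex^'n"
  assumes Y: "Y \<in> sym_disc"
  defines "y \<equiv> x - Y *v cnj_vec x" and "x' \<equiv> P *v x + Q *v cnj_vec x"
  shows "x' - act Y *v cnj_vec x' = actv y Y"
    and "quad x' (act Y) = quad x Y + Re (actv y Y \<star> (cnj_mat Q *v y))"
proof -
  have c: "cnj_vec x' = den Y *v cnj_vec x + cnj_mat Q *v y"
    by (simp add: x'_def y_def den_def cnj_vec_mv matrix_vector_mult_add_rdistrib
        matrix_vector_mult_diff_distrib matrix_vector_mul_assoc)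
  show 1: "x' - act Y *v cnj_vec x' = actv y Y"
    unfolding c actv_def
    by (simp add: x'_def y_def matrix_vector_right_distrib matrix_vector_mul_assoc act_den[OF Y] num_def
        matrix_vector_mult_add_rdistrib matrix_vector_mult_diff_distrib)
  have "quad x' (act Y) = Re (actv y Y \<star> (den Y *v cnj_vec x)) + Re (actv y Y \<star> (cnj_mat Q *v y))"
    by (simp add: quad_eq 1) (simp add: c bil_add_right)
  also have "actv y Y \<star> (den Y *v cnj_vec x) = y \<star> cnj_vec x"
    unfolding actv_eq[OF Y] bil_mv_mv by (simp add: cramer_inv_den[OF Y])
  finally show "quad x' (act Y) = quad x Y + Re (actv y Y \<star> (cnj_mat Q *v y))"
    by (simp add: quad_eq y_def)
qed

lemma det_cramer_inv_den_bound: "\<exists>B>0. \<forall>Y\<in>sym_disc. cmod (det (cramer_inv (den Y))) \<le> B"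
proof -
  obtain K1 where K1: "K1 > 0" "\<And>z. norm (transpose P *v z) \<le> K1 * norm z"
    using mv_bound[of "transpose P"] by blast
  obtain K2 where K2: "K2 > 0" "\<And>z. norm (transpose (cnj_mat Q) *v z) \<le> K2 * norm z"
    using mv_bound[of "transpose (cnj_mat Q)"] by blast
  have "cmod (det (cramer_inv (den Y))) \<le> fact CARD('n) * (K1 + K2) ^ CARD('n)" if Y: "Y \<in> sym_disc" for Y
  proof (rule cmod_det_le, rule cmod_component_le)
    fix z
    have "norm (cramer_inv (den Y) *v z) \<le> norm (transpose P *v z) + norm (transpose (cnj_mat Q) *v (act Y *v z))"
      unfolding cramer_inv_den_eq[OF Y] matrix_vector_mult_diff_rdistrib
      by (simp add: matrix_vector_mul_assoc norm_triangle_ineq4)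
    also have "\<dots> \<le> K1 * norm z + K2 * norm (act Y *v z)"
      by (intro add_mono K1 K2)
    also have "\<dots> \<le> K1 * norm z + K2 * norm z"
      using K2(1) sym_discD(3)[OF act_sym_disc[OF Y]] by simp
    finally show "norm (cramer_inv (den Y) *v z) \<le> (K1 + K2) * norm z" by (simp add: algebra_simps)
  qed
  moreover have "fact CARD('n) * (K1 + K2) ^ CARD('n) > 0" using K1 K2 by simp
  ultimately show ?thesis by blast
qed

text \<open>As \<open>m \<le> 0\<close>, the determinant power is a nonnegative power of the
  determinant of the inverse, which is bounded. By \<open>quad_act\<close> the automorphy factor
  contributes \<open>quad x Y - q'\<close> to the exponent, where \<open>q'\<close> is
  \<open>quad\<close> at the image point; the coherent state gives back at most
  \<open>q' / 2\<close>, and \<open>q' \<ge> 0\<close>.\<close>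

lemma kern_bound:
  assumes m: "m \<le> 0" and lam: "lam > 0"
  shows "\<exists>K\<ge>0. \<forall>x. \<forall>Y\<in>sym_disc. cmod (kern lam m v (shear_conj (x, Y))) \<le> K * exp (lam / 4 * quad x Y)"
proof -
  obtain B where B: "B > 0" "\<And>Y. Y \<in> sym_disc \<Longrightarrow> cmod (det (cramer_inv (den Y))) \<le> B"
    using det_cramer_inv_den_bound by blast
  define K where "K = B ^ nat (- m) * exp (lam / 4 * (5 * (norm v)\<^sup>2))"
  have "cmod (kern lam m v (shear_conj (x, Y))) \<le> K * exp (lam / 4 * quad x Y)" if Y: "Y \<in> sym_disc" for x Y
  proof -
    define y where "y = x - Y *v cnj_vec x"
    define y' where "y' = actv y Y"
    define q' where "q' = quad (P *v x + Q *v cnj_vec x) (act Y)"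
    note Y' = act_sym_disc[OF Y]
    have "det (den Y) * det (cramer_inv (den Y)) = 1"
      by (metis det_I det_mul cramer_inv_den(2)[OF Y])
    then have "det (den Y) = inverse (det (cramer_inv (den Y)))"
      by (metis inverse_unique mult.commute)
    then have "cmod (det (den Y) powi m) = cmod (det (cramer_inv (den Y))) ^ nat (- m)"
      using m by (cases "m = 0") (simp_all add: norm_power_int power_int_def norm_inverse norm_power)
    also have "\<dots> \<le> B ^ nat (- m)"
      using B(2)[OF Y] by (intro power_mono) auto
    finally have 1: "cmod (det (den Y) powi m) \<le> B ^ nat (- m)" .
    have 2: "Re (2 * (y' \<star> cnj_vec v) + cnj_vec v \<star> (act Y *v cnj_vec v)) \<le> q' / 2 + 5 * (norm v)\<^sup>2"
      using coherent_exponent_le[OF Y', of "P *v x + Q *v cnj_vec x" v] quad_act(1)[OF Y, of x]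
      by (simp add: q'_def y'_def y_def)
    have 3: "q' \<ge> 0" unfolding q'_def by (rule quad_ge(2)[OF Y'])
    have 4: "Re (y' \<star> (cnj_mat Q *v y)) = q' - quad x Y"
      using quad_act(2)[OF Y, of x] by (simp add: q'_def y'_def y_def)
    define E where "E = 2 * (y' \<star> cnj_vec v) + cnj_vec v \<star> (act Y *v cnj_vec v) - y' \<star> (cnj_mat Q *v y)"
    have "Re E \<le> quad x Y + 5 * (norm v)\<^sup>2"
      using 2 3 4 by (simp add: E_def)
    then have "lam / 4 * Re E \<le> lam / 4 * (quad x Y + 5 * (norm v)\<^sup>2)"
      using lam by (intro mult_left_mono) auto
    then have "lam / 4 * Re E \<le> lam / 4 * quad x Y + lam / 4 * (5 * (norm v)\<^sup>2)"
      by (simp only: distrib_left)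
    then have "cmod (exp (of_real lam / 4 * E)) \<le> exp (lam / 4 * quad x Y) * exp (lam / 4 * (5 * (norm v)\<^sup>2))"
      by (simp add: norm_exp_eq_Re exp_add[symmetric])
    then have "cmod (det (den Y) powi m) * cmod (exp (of_real lam / 4 * E)) \<le>
        B ^ nat (- m) * (exp (lam / 4 * quad x Y) * exp (lam / 4 * (5 * (norm v)\<^sup>2)))"
      using B by (intro mult_mono 1) auto
    then show ?thesis
      by (simp add: kern_def shear_conj_def y_def[symmetric] y'_def[symmetric] E_def[symmetric] K_def norm_mult mult_ac)
  qed
  moreover have "K \<ge> 0" using B by (simp add: K_def)
  ultimately show ?thesis by blast
qed

lemma kern_measurable: "kern lam m v \<in> borel_measurable borel"
proof -
  have [measurable]: "fst \<in> borel_measurable (borel :: 'n point measure)" "snd \<in> borel_measurable (borel :: 'n point measure)"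
    by (auto intro!: borel_measurable_continuous_onI continuous_intros)
  show ?thesis
    unfolding kern_def case_prod_unfold actv_def act_def num_def den_def by measurable
qed

lemma kern_hol:
  assumes "hol_vec U y" "hol_mat U Y" "\<And>t. t \<in> U \<Longrightarrow> det (den (Y t)) \<noteq> 0"
  shows "(\<lambda>t. kern lam m v (y t, Y t)) holomorphic_on U"
proof -
  have d: "hol_mat U (\<lambda>t. den (Y t))"
    unfolding den_def using assms by (intro hol_vm)
  then have a: "hol_mat U (\<lambda>t. act (Y t))"
    unfolding act_def num_def using assms by (intro hol_vm)
  then have av: "hol_vec U (\<lambda>t. actv (y t) (Y t))"
    unfolding actv_def using assms by (intro hol_vm)
  show ?thesis
    unfolding kern_def prod.case using assms d a av
    by (intro holomorphic_intros hol_vm) auto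
qed

end

section \<open>Evaluation of the representation\<close>

lemma blk_block_mat [simp]:
  "blk11 (block_mat A B C D) = A" "blk12 (block_mat A B C D) = B"
  "blk21 (block_mat A B C D) = C" "blk22 (block_mat A B C D) = D"
  by (simp_all add: vec_eq_iff blk11_def blk12_def blk21_def blk22_def block_mat_def)

lemma S_groupD:
  assumes "block_mat P Q (cnj_mat Q) (cnj_mat P) \<in> S_group"
  shows "P ** adj P - Q ** adj Q = mat 1" "P ** transpose Q = Q ** transpose P"
proof -
  obtain P' Q' where e: "block_mat P Q (cnj_mat Q) (cnj_mat P) = block_mat P' Q' (cnj_mat Q') (cnj_mat P')"
    and PQ: "P' ** adj P' - Q' ** adj Q' = mat 1" "P' ** transpose Q' = Q' ** transpose P'"
    using assms unfolding S_group_def by blast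
  have "P = P'" "Q = Q'"
    using arg_cong[OF e, of blk11] arg_cong[OF e, of blk12] by simp_all
  with PQ show "P ** adj P - Q ** adj Q = mat 1" "P ** transpose Q = Q ** transpose P" by simp_all
qed

lemma adj_simps: "transpose (adj P) = cnj_mat P" "cnj_mat (adj P) = transpose P" "adj (adj P) = P"
  "adj (transpose P) = cnj_mat P" "adj (- P) = - adj P"
  by (simp_all add: adj_def cnj_mat_transpose transpose_minus)

definition S_inv :: "complex^'n^'n \<Rightarrow> complex^'n^'n \<Rightarrow> 'n::finite block" where
  "S_inv P Q = block_mat (adj P) (- transpose Q) (cnj_mat (- transpose Q)) (cnj_mat (adj P))"

lemma S_inv_facts:
  assumes k: "block_mat P Q (cnj_mat Q) (cnj_mat P) \<in> S_group"
  shows "block_mat P Q (cnj_mat Q) (cnj_mat P) ** S_inv P Q = mat 1"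
    and "S_inv P Q ** block_mat P Q (cnj_mat Q) (cnj_mat P) = mat 1"
    and "S_inv P Q \<in> S_group"
    and "action_blocks (adj P) (- transpose Q)"
proof -
  note S = S_groupD[OF k]
  have S1: "P ** adj P = mat 1 + Q ** adj Q" using S(1) by (simp add: diff_eq_eq)
  have S1c: "cnj_mat P ** transpose P = mat 1 + cnj_mat Q ** transpose Q"
    using arg_cong[OF S1, of cnj_mat] by (simp add: cnj_mat_mult adj_simps)
  have S2c: "cnj_mat P ** adj Q = cnj_mat Q ** adj P"
    using arg_cong[OF S(2), of cnj_mat] by (simp add: cnj_mat_mult cnj_mat_transpose adj_def)
  have cq: "cnj_mat (- transpose Q) = - adj Q" by (simp add: cnj_mat_transpose adj_def)
  show 1: "block_mat P Q (cnj_mat Q) (cnj_mat P) ** S_inv P Q = mat 1"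
    unfolding S_inv_def block_mat_mult block_mat_1[symmetric]
    by (intro arg_cong4[where f = block_mat])
      (simp_all add: cq adj_simps matrix_mult_minus_right S1 S1c S(2) S2c del: cnj_mat_simps(5))
  then show 2: "S_inv P Q ** block_mat P Q (cnj_mat Q) (cnj_mat P) = mat 1"
    using matrix_left_right_inverse by blast
  \<comment> \<open>A right inverse is also a left inverse; this turns the row relations of
    \<open>k\<close> into its column relations, which are the row relations of the inverse.\<close>
  have "adj P ** P - transpose Q ** cnj_mat Q = mat 1" "adj P ** Q = transpose Q ** cnj_mat P"
    using arg_cong[OF 2, of blk11] arg_cong[OF 2, of blk12]
    unfolding S_inv_def block_mat_mult block_mat_1[symmetric]
    by (simp_all add: matrix_mult_minus_left add_eq_0_iff2 eq_neg_iff_add_eq_0)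
  then show "S_inv P Q \<in> S_group"
    unfolding S_group_def S_inv_def
    by (intro CollectI exI[of _ "adj P"] exI[of _ "- transpose Q"] conjI refl)
      (simp_all add: adj_simps matrix_mult_minus_left matrix_mult_minus_right transpose_minus)
  show "action_blocks (adj P) (- transpose Q)"
    by standard
      (simp_all add: adj_simps cq transpose_minus matrix_mult_minus_left matrix_mult_minus_right S1c S2c del: cnj_mat_simps(5))
qed

text \<open>The group inverse is a definite description, so uniqueness belongs to the claim. The
  factor with zero translation part acts trivially on the other components, and the matrix component
  is then determined by associativity.\<close>

lemma jacobi_inv:
  assumes k: "block_mat P Q (cnj_mat Q) (cnj_mat P) \<in> S_group"
  shows "inv\<^bsub>jacobi_group\<^esub> ((0, 0), 0, block_mat P Q (cnj_mat Q) (cnj_mat P)) = ((0, 0), 0, S_inv P Q)"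
    (is "inv\<^bsub>_\<^esub> ?g = ?h")
  unfolding m_inv_def
proof (rule the_equality)
  note S = S_inv_facts[OF k]
  have S0: "S_act M (0, 0) = (0, 0)" for M :: "'a block"
    by (simp add: S_act_def)
  have om: "omega (0, 0) q = 0" "omega q (0, 0) = 0" for q
    by (cases q; simp add: omega_def)+
  have "?h \<in> carrier jacobi_group"
    using S(3) by (simp add: jacobi_group_def)
  then show "?h \<in> carrier jacobi_group \<and> ?g \<otimes>\<^bsub>jacobi_group\<^esub> ?h = \<one>\<^bsub>jacobi_group\<^esub> \<and> ?h \<otimes>\<^bsub>jacobi_group\<^esub> ?g = \<one>\<^bsub>jacobi_group\<^esub>"
    by (simp add: jacobi_group_def S0 om S zero_prod_def)
  fix h assume h: "h \<in> carrier jacobi_group \<and> ?g \<otimes>\<^bsub>jacobi_group\<^esub> h = \<one>\<^bsub>jacobi_group\<^esub> \<and> h \<otimes>\<^bsub>jacobi_group\<^esub> ?g = \<one>\<^bsub>jacobi_group\<^esub>"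
  then obtain z c k2 where hz: "h = ((z, cnj_vec z), c, k2)"
    by (auto simp: jacobi_group_def)
  have 1: "(z, cnj_vec z) = (0, 0)" "c = 0" "block_mat P Q (cnj_mat Q) (cnj_mat P) ** k2 = mat 1"
    using h unfolding hz by (auto simp: jacobi_group_def S0 om zero_prod_def)
  have "k2 = S_inv P Q"
    using 1(3) S(2) by (metis matrix_mul_assoc matrix_mul_lid matrix_mul_rid)
  with 1 show "h = ?h" by (simp add: hz)
qed

text \<open>\<open>e_chi\<close> at a point \<open>(v, 0)\<close>: with second component 0 the
  determinant and the inverse in \<open>K_chi\<close> are 1 and the middle term vanishes. Unlike
  \<open>e_chi\<close> it is given by the formula on the whole type, so that it is Borel measurable
  there.\<close>

definition coherent :: "real \<Rightarrow> complex^'n \<Rightarrow> 'n::finite point \<Rightarrow> complex" where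
  "coherent lam v = (\<lambda>(w, U). exp (of_real lam / 4 * (2 * (w \<star> cnj_vec v) + cnj_vec v \<star> (U *v cnj_vec v))))"

lemma K_chi_coherent: "K_chi lam m Z (v, 0) = coherent lam v Z"
proof (cases Z)
  case (Pair w U)
  have "matrix_inv (mat 1 :: complex^'a^'a) = mat 1" by (rule matrix_inv_unique) simp
  then show ?thesis by (simp add: Pair K_chi_def coherent_def Let_def)
qed

lemma coherent_measurable: "coherent lam v \<in> borel_measurable borel"
proof -
  have [measurable]: "fst \<in> borel_measurable (borel :: 'n::finite point measure)" "snd \<in> borel_measurable (borel :: 'n point measure)"
    by (auto intro!: borel_measurable_continuous_onI continuous_intros)
  show ?thesis unfolding coherent_def case_prod_unfold by measurable
qed

lemma e_chi_eq: "Z \<in> jacobi_dom \<Longrightarrow> e_chi lam m (v, 0) Z = coherent lam v Z"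
  by (simp add: e_chi_def K_chi_coherent)

lemma holomorphic_e_chi: "holomorphic_on_dom (e_chi lam m (v, 0) :: 'n::finite point \<Rightarrow> complex)"
  unfolding holomorphic_on_dom_def
proof (intro ballI exI conjI allI)
  fix Z :: "'n point" assume Z: "Z \<in> jacobi_dom"
  \<comment> \<open>The coherent state is the exponential of a complex-linear form, so its
    derivative at \<open>Z\<close> is \<open>exp (L Z)\<close> times that form.\<close>
  define L where "L = (\<lambda>h :: 'n point. of_real lam / 4 * (2 * (fst h \<star> cnj_vec v) + cnj_vec v \<star> (snd h *v cnj_vec v)))"
  have "linear L"
  proof (rule linearI)
    show "L (a + b) = L a + L b" for a b
      by (simp add: L_def bil_add_left bil_add_right matrix_vector_mult_add_rdistrib algebra_simps add_divide_distrib)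
    show "L (r *\<^sub>R b) = r *\<^sub>R L b" for r b
    proof -
      have "r *\<^sub>R w = of_real r *s w" for w :: "complex^'n"
        by (simp add: vec_eq_iff scaleR_conv_of_real[where 'a = complex])
      moreover have "(r *\<^sub>R U) *v w = of_real r *s (U *v w)" for U :: "complex^'n^'n" and w
        by (simp add: vec_eq_iff matrix_vector_mult_def scaleR_conv_of_real[where 'a = complex] sum_distrib_left mult.assoc)
      ultimately show ?thesis
        by (simp add: L_def bil_scale_left bil_scale_right scaleR_conv_of_real[where 'a = complex] algebra_simps)
    qed
  qed
  then have "bounded_linear L" by (simp add: linear_conv_bounded_linear)
  then have L: "(L has_derivative L) (at Z within jacobi_dom)"
    by (rule bounded_linear_imp_has_derivative)
  have "(exp has_derivative (*) (exp (L Z))) (at (L Z))"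
    using DERIV_exp[of "L Z"] by (simp add: has_field_derivative_def)
  from has_derivative_compose[OF L this]
  have "((\<lambda>x. exp (L x)) has_derivative (\<lambda>h. exp (L Z) * L h)) (at Z within jacobi_dom)" .
  then show "(e_chi lam m (v, 0) has_derivative (\<lambda>h. exp (L Z) * L h)) (at Z within jacobi_dom)"
    by (rule has_derivative_transform[rotated 2])
      (use Z in \<open>auto simp: e_chi_eq coherent_def L_def case_prod_unfold\<close>)
  fix c and u :: "complex^'n" and U :: "complex^'n^'n"
  have "(\<chi> i. c *s (U $ i)) *v cnj_vec v = c *s (U *v cnj_vec v)"
    by (simp add: vec_eq_iff matrix_vector_mult_def sum_distrib_left mult.assoc)
  then show "exp (L Z) * L (c *s u, \<chi> i. c *s (U $ i)) = c * (exp (L Z) * L (u, U))"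
    by (simp add: L_def bil_scale_left bil_scale_right algebra_simps)
qed

text \<open>\<open>pi_chi\<close> is meaningful only on \<open>H_chi\<close>, whence the membership
  hypothesis. The computation joins \<open>K_chi_coherent\<close> at the image point with the
  inverse of the automorphy factor.\<close>

lemma pi_chi_eval:
  assumes k: "block_mat P Q (cnj_mat Q) (cnj_mat P) \<in> S_group"
    and H: "e_chi lam m (v, 0) \<in> H_chi lam m" and Z: "Z \<in> jacobi_dom"
  shows "pi_chi lam m ((0, 0), 0, block_mat P Q (cnj_mat Q) (cnj_mat P)) (e_chi lam m (v, 0)) Z =
    action_blocks.kern (adj P) (- transpose Q) lam m v Z"
proof -
  interpret A: action_blocks "adj P" "- transpose Q" by (rule S_inv_facts(4)[OF k])
  obtain y Y where Zy: "Z = (y, Y)" and Y: "Y \<in> sym_disc"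
    using Z by (auto simp: jacobi_dom_eq)
  note mi = cramer_inv_eq[OF A.det_den[OF Y], unfolded A.den_def, symmetric]
  have act: "jacobi_act ((0, 0), 0, S_inv P Q) Z = (A.actv y Y, A.act Y)"
    by (simp add: jacobi_act_def Let_def S_inv_def Zy A.actv_def A.act_def mi A.num_def A.den_def
       del: cnj_mat_simps(5))
  have dom: "(A.actv y Y, A.act Y) \<in> jacobi_dom"
    using A.act_sym_disc[OF Y] by (simp add: jacobi_dom_eq)
  have "J_chi lam m ((0, 0), 0, S_inv P Q) Z = det (A.den Y) powi (- m) *
     exp (of_real lam / 4 * (y \<star> ((transpose (adj P) ** cnj_mat (- transpose Q)) *v y)
       - (cnj_mat (- transpose Q) *v y) \<star> (A.act Y *v (cnj_mat (- transpose Q) *v y))))"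
    by (simp add: J_chi_def Let_def S_inv_def Zy A.act_def mi A.num_def A.den_def
       del: cnj_mat_simps(5))
  then have "J_chi lam m ((0, 0), 0, S_inv P Q) Z = det (A.den Y) powi (- m) *
     exp (of_real lam / 4 * (A.actv y Y \<star> (cnj_mat (- transpose Q) *v y)))"
    by (simp only: A.J_exponent[OF Y])
  then have "inverse (J_chi lam m ((0, 0), 0, S_inv P Q) Z) = det (A.den Y) powi m *
     exp (of_real lam / 4 * (- (A.actv y Y \<star> (cnj_mat (- transpose Q) *v y))))"
    by (simp add: power_int_minus exp_minus del: cnj_mat_simps(5))
  then show ?thesis
    using Z H unfolding pi_chi_def jacobi_inv[OF k]
    by (simp add: act e_chi_eq[OF dom] del: cnj_mat_simps(5))
      (simp add: Zy coherent_def A.kern_def exp_add[symmetric] algebra_simps del: cnj_mat_simps(5))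
qed

text \<open>At \<open>Y = 0\<close> the denominator is \<open>transpose P\<close> and the numerator
  is \<open>- transpose Q\<close>. The resulting matrices are transposes of those in the claim, and
  a quadratic form takes the same values on a matrix and on its transpose.\<close>

lemma kern_eval:
  assumes k: "block_mat P Q (cnj_mat Q) (cnj_mat P) \<in> S_group"
  shows "action_blocks.kern (adj P) (- transpose Q) lam m v (y, 0) =
    det P powi m * exp (of_real lam / 4 *
      (y \<star> ((cnj_mat Q ** matrix_inv P) *v y)
       + 2 * (y \<star> (matrix_inv (transpose P) *v cnj_vec v))
       - cnj_vec v \<star> ((matrix_inv P ** Q) *v cnj_vec v)))"
proof -
  interpret A: action_blocks "adj P" "- transpose Q" by (rule S_inv_facts(4)[OF k])
  have zero: "(0 :: complex^'a^'a) \<in> sym_disc"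
    by (simp add: sym_disc_def vec_eq_iff transpose_def)
  have den0: "A.den 0 = transpose P" by (simp add: A.den_def adj_simps)
  have dP: "det P \<noteq> 0" using A.det_den[OF zero] by (simp add: den0)
  then have dPt: "det (transpose P) \<noteq> 0" by simp
  have tinv: "matrix_inv (transpose P) = transpose (matrix_inv P)"
    by (rule matrix_inv_unique) (simp add: matrix_transpose_mul[symmetric] matrix_inv_mult[OF dP] transpose_mat)
  have minv0: "cramer_inv (A.den 0) = transpose (matrix_inv P)"
    by (simp add: den0 cramer_inv_eq[OF dPt] tinv)
  have act0: "A.act 0 = - transpose (matrix_inv P ** Q)"
    by (simp add: A.act_def A.num_def minv0 matrix_mult_minus_left matrix_transpose_mul)
  have actv0: "A.actv y 0 = matrix_inv P *v y"
    by (simp only: A.actv_eq[OF zero] minv0 transpose_transpose)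
  have cq: "cnj_mat (- transpose Q) = - transpose (cnj_mat Q)" by (simp add: cnj_mat_transpose)
  have e1: "(matrix_inv P *v y) \<star> cnj_vec v = y \<star> (matrix_inv (transpose P) *v cnj_vec v)"
    by (simp only: bil_mv tinv transpose_transpose)
  have e2: "cnj_vec v \<star> (A.act 0 *v cnj_vec v) = - (cnj_vec v \<star> ((matrix_inv P ** Q) *v cnj_vec v))"
    unfolding act0 mv_minus bil_minus_right bil_mv[of _ "transpose _"] transpose_transpose
    by (simp only: bil_commute)
  have e3: "A.actv y 0 \<star> (cnj_mat (- transpose Q) *v y) = - (y \<star> ((cnj_mat Q ** matrix_inv P) *v y))"
    unfolding actv0 cq mv_minus bil_minus_right bil_mv[of _ "transpose _"] transpose_transpose matrix_vector_mul_assoc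
    by (simp only: bil_commute)
  show ?thesis
    unfolding A.kern_def prod.case e2 e3 unfolding actv0 e1 den0 det_transpose
    by (simp add: algebra_simps)
qed

section \<open>Integrals against the invariant measure\<close>

lemma fst_snd_measurable [measurable]:
  "fst \<in> borel_measurable (borel :: 'n::finite point measure)"
  "snd \<in> borel_measurable (borel :: 'n::finite point measure)"
  by (auto intro!: borel_measurable_continuous_onI continuous_intros)

lemma borel_measurable_mu_L: "borel_measurable mu_L = borel_measurable borel"
  by (rule measurable_cong_sets) simp_all

lemma shear_conj_measurable [measurable]: "shear_conj \<in> borel_measurable borel"
  unfolding shear_conj_def case_prod_unfold by measurable

lemma indicator_disc_measurable [measurable]:
  "(\<lambda>z :: 'n::finite point. indicator sym_disc (snd z) :: real) \<in> borel_measurable borel"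
  by (rule measurable_compose[OF fst_snd_measurable(2)]) (rule borel_measurable_indicator[OF sym_disc_borel])

lemma jacobi_dom_borel: "jacobi_dom \<in> sets borel"
proof -
  have e: "jacobi_dom = snd -` sym_disc \<inter> space borel" by (auto simp: jacobi_dom_eq)
  show ?thesis unfolding e by (rule measurable_sets[OF fst_snd_measurable(2) sym_disc_borel])
qed

lemma nn_integral_shear_mu_L:
  fixes h :: "'n::finite point \<Rightarrow> ennreal"
  assumes [measurable]: "h \<in> borel_measurable borel"
  shows "(\<integral>\<^sup>+z. indicator sym_disc (snd z) * h z \<partial>mu_L) =
    (\<integral>\<^sup>+z. ennreal (indicator sym_disc (snd z) * disc_det (snd z)) * h (shear_conj z) \<partial>mu_L)"
proof -
  have sec: "(\<lambda>x. h (x, Y)) \<in> borel_measurable borel" for Y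
    by (rule measurable_compose[OF _ assms]) (intro borel_measurable_continuous_onI continuous_intros)
  have "(\<integral>\<^sup>+z. indicator sym_disc (snd z) * h z \<partial>mu_L)
      = (\<integral>\<^sup>+Y. \<integral>\<^sup>+x. indicator sym_disc Y * h (x, Y) \<partial>lborel \<partial>sym_lebesgue)"
    by (subst nn_integral_mu_L(2)) simp_all
  also have "\<dots> = (\<integral>\<^sup>+Y. \<integral>\<^sup>+x. ennreal (indicator sym_disc Y * disc_det Y) * h (x - Y *v cnj_vec x, Y) \<partial>lborel \<partial>sym_lebesgue)"
  proof (rule nn_integral_cong)
    fix Y :: "complex^'n^'n"
    show "(\<integral>\<^sup>+x. indicator sym_disc Y * h (x, Y) \<partial>lborel) =
       (\<integral>\<^sup>+x. ennreal (indicator sym_disc Y * disc_det Y) * h (x - Y *v cnj_vec x, Y) \<partial>lborel)"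
    proof (cases "Y \<in> sym_disc")
      case True
      have m: "(\<lambda>x. h (x - Y *v cnj_vec x, Y)) \<in> borel_measurable borel"
        by (rule measurable_compose[OF _ sec]) measurable
      have "cmod (det (mat 1 - Y ** cnj_mat Y)) = disc_det Y"
        using det_eq_disc_det[OF True] disc_det_pos[OF True] by simp
      with nn_integral_shear_conj[OF det_sym_disc_nz[OF True] sec[of Y]] True m
      show ?thesis by (simp add: nn_integral_cmult)
    qed simp
  qed
  also have "\<dots> = (\<integral>\<^sup>+z. ennreal (indicator sym_disc (snd z) * disc_det (snd z)) * h (shear_conj z) \<partial>mu_L)"
    by (subst nn_integral_mu_L(2)) (simp_all add: shear_conj_def)
  finally show ?thesis .
qed

text \<open>Upgrades the identity of nonnegative integrals to one of measures, along which
  integrability and integrals of complex functions can be transported.\<close>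

lemma distr_shear_mu_L:
  "distr (density mu_L (\<lambda>z. ennreal (indicator sym_disc (snd z) * disc_det (snd z)))) borel shear_conj =
   density (mu_L :: 'n::finite point measure) (\<lambda>z. ennreal (indicator sym_disc (snd z)))" (is "?L = ?R")
proof (rule measure_eqI)
  show "sets ?L = sets ?R" by simp
  fix A assume "A \<in> sets ?L"
  then have A [measurable]: "A \<in> sets borel" by simp
  have "shear_conj -` A \<inter> space borel \<in> sets borel"
    by (rule measurable_sets[OF shear_conj_measurable A])
  then have A' [measurable]: "shear_conj -` A \<in> sets borel" by simp
  have "emeasure ?L A = emeasure (density mu_L (\<lambda>z. ennreal (indicator sym_disc (snd z) * disc_det (snd z)))) (shear_conj -` A)"
    by (subst emeasure_distr) (simp_all add: measurable_cong_sets[OF sets_density[THEN trans, OF sets_mu_L] refl])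
  also have "\<dots> = (\<integral>\<^sup>+z. ennreal (indicator sym_disc (snd z) * disc_det (snd z)) * indicator A (shear_conj z) \<partial>mu_L)"
    by (subst emeasure_density) (simp_all add: borel_measurable_mu_L indicator_vimage[symmetric] o_def cong: nn_integral_cong)
  also have "\<dots> = (\<integral>\<^sup>+z. indicator sym_disc (snd z) * indicator A z \<partial>mu_L)"
    by (rule nn_integral_shear_mu_L[symmetric]) measurable
  also have "\<dots> = emeasure ?R A"
    by (subst emeasure_density) (simp_all add: borel_measurable_mu_L ennreal_indicator)
  finally show "emeasure ?L A = emeasure ?R A" .
qed

lemma shear_transfer:
  fixes g :: "'n::finite point \<Rightarrow> complex"
  assumes g [measurable]: "g \<in> borel_measurable borel"
  shows "integrable mu_L (\<lambda>z. indicat_real sym_disc (snd z) *\<^sub>R g z) \<longleftrightarrow>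
      integrable mu_L (\<lambda>z. (indicator sym_disc (snd z) * disc_det (snd z)) *\<^sub>R g (shear_conj z))" (is ?A)
    and "(LINT z|mu_L. indicat_real sym_disc (snd z) *\<^sub>R g z) =
      (LINT z|mu_L. (indicator sym_disc (snd z) * disc_det (snd z)) *\<^sub>R g (shear_conj z))" (is ?B)
proof -
  let ?D = "density mu_L (\<lambda>z :: 'n point. ennreal (indicator sym_disc (snd z) * disc_det (snd z)))"
  have sh: "shear_conj \<in> ?D \<rightarrow>\<^sub>M borel" by (simp add: borel_measurable_mu_L)
  have g1: "(\<lambda>z. indicator sym_disc (snd z) * disc_det (snd z)) \<in> borel_measurable mu_L"
    "(\<lambda>z. indicat_real sym_disc (snd z)) \<in> borel_measurable mu_L"
    "g \<in> borel_measurable mu_L" "(\<lambda>z. g (shear_conj z)) \<in> borel_measurable mu_L"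
    unfolding borel_measurable_mu_L by measurable
  have nn: "0 \<le> indicator sym_disc (snd z) * disc_det (snd z)" for z :: "'n point"
    using disc_det_pos[of "snd z"] by (auto split: split_indicator intro: less_imp_le)
  have "integrable mu_L (\<lambda>z. indicat_real sym_disc (snd z) *\<^sub>R g z) \<longleftrightarrow> integrable (distr ?D borel shear_conj) g"
    unfolding distr_shear_mu_L using g1 by (intro integrable_density[symmetric]) auto
  also have "\<dots> \<longleftrightarrow> integrable ?D (\<lambda>z. g (shear_conj z))"
    using sh by (intro integrable_distr_eq) auto
  also have "\<dots> \<longleftrightarrow> integrable mu_L (\<lambda>z. (indicator sym_disc (snd z) * disc_det (snd z)) *\<^sub>R g (shear_conj z))"
    using g1 nn by (intro integrable_density) auto
  finally show ?A .
  have "(LINT z|mu_L. indicat_real sym_disc (snd z) *\<^sub>R g z) = integral\<^sup>L (distr ?D borel shear_conj) g"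
    unfolding distr_shear_mu_L using g1 by (intro integral_density[symmetric]) auto
  also have "\<dots> = integral\<^sup>L ?D (\<lambda>z. g (shear_conj z))"
    using sh by (intro integral_distr) auto
  also have "\<dots> = (LINT z|mu_L. (indicator sym_disc (snd z) * disc_det (snd z)) *\<^sub>R g (shear_conj z))"
    using g1 nn by (intro integral_density) auto
  finally show ?B .
qed

text \<open>The diagonal of \<open>K_chi\<close> with the Cramer inverse in place of
  \<open>matrix_inv\<close>: equal on the domain and measurable on the whole type.\<close>

definition K_diag :: "real \<Rightarrow> int \<Rightarrow> 'n::finite point \<Rightarrow> complex" where
  "K_diag lam m = (\<lambda>(y, Y).
    det (mat 1 - Y ** cnj_mat Y) powi m *
       exp (of_real lam / 4 *
         (2 * (y \<star> (cramer_inv (mat 1 - cnj_mat Y ** Y) *v cnj_vec y)) + y \<star> ((cramer_inv (mat 1 - cnj_mat Y ** Y) ** cnj_mat Y) *v y)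
          + cnj_vec y \<star> ((Y ** cramer_inv (mat 1 - cnj_mat Y ** Y)) *v cnj_vec y))))"

lemma K_diag_eq:
  assumes "Z \<in> jacobi_dom"
  shows "K_chi lam m Z Z = K_diag lam m Z"
proof -
  obtain y Y where Z: "Z = (y, Y)" and Y: "Y \<in> sym_disc" using assms by (auto simp: jacobi_dom_eq)
  have "det (mat 1 - cnj_mat Y ** Y) \<noteq> 0"
    using det_sym_disc_nz[OF Y] transpose_one_minus[OF sym_discD(1)[OF Y]] det_transpose by metis
  then show ?thesis by (simp add: Z K_chi_def K_diag_def Let_def cramer_inv_eq)
qed

lemma K_diag_measurable [measurable]: "K_diag lam m \<in> borel_measurable borel"
  unfolding K_diag_def case_prod_unfold by measurable

text \<open>The density of the measure with weight \<open>1 / K(Z, Z)\<close> in the coordinates \<open>(x, Y)\<close>, where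
  \<open>p = - m - n - 1\<close>.\<close>
definition weight :: "real \<Rightarrow> nat \<Rightarrow> 'n::finite point \<Rightarrow> real" where
  "weight lam p z = indicator sym_disc (snd z) * (disc_det (snd z) ^ p * exp (- lam / 2 * quad (fst z) (snd z)))"

lemma weight_measurable [measurable]: "weight lam p \<in> borel_measurable borel"
  unfolding weight_def[abs_def] by measurable

lemma mu_transfer:
  fixes g :: "'n::finite point \<Rightarrow> complex"
  assumes g [measurable]: "g \<in> borel_measurable borel" and p: "int p = - m - int CARD('n) - 1"
  shows "integrable mu (\<lambda>Z. g Z * inverse (K_chi lam m Z Z)) \<longleftrightarrow>
      integrable mu_L (\<lambda>z. weight lam p z *\<^sub>R g (shear_conj z))" (is ?A)
    and "(LINT Z|mu. g Z * inverse (K_chi lam m Z Z)) = (LINT z|mu_L. weight lam p z *\<^sub>R g (shear_conj z))" (is ?B)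
proof -
  let ?R = "restrict_space (mu_L :: 'n point measure) jacobi_dom"
  define d where "d z = disc_det (snd z) powi (- (int CARD('n) + 2))" for z :: "'n point"
  define f where "f Z = g Z * inverse (K_diag lam m Z)" for Z
  have [measurable]: "f \<in> borel_measurable borel" unfolding f_def[abs_def] by measurable
  have [measurable]: "d \<in> borel_measurable borel"
    unfolding d_def power_int_def by measurable
  have spR: "space ?R = jacobi_dom" by (simp add: space_restrict_space)
  have dom: "jacobi_dom \<inter> space mu_L \<in> sets (mu_L :: 'n point measure)" using jacobi_dom_borel by simp
  have mR: "h \<in> borel_measurable borel \<Longrightarrow> h \<in> borel_measurable ?R" for h :: "'n point \<Rightarrow> 'b::topological_space"
    by (intro measurable_restrict_space1) (simp add: borel_measurable_mu_L)
  have mu_eq: "mu = density ?R (\<lambda>z. ennreal (d z))"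
    unfolding mu_def d_def disc_det_def by (simp add: case_prod_unfold)
  have dpos: "AE z in ?R. 0 \<le> d z"
  proof (rule AE_I2)
    fix z assume "z \<in> space ?R"
    then have "snd z \<in> sym_disc" unfolding spR by (auto simp: jacobi_dom_eq)
    then show "0 \<le> d z" unfolding d_def by (intro zero_le_power_int less_imp_le[OF disc_det_pos])
  qed
  have ind: "indicat_real jacobi_dom z = indicat_real sym_disc (snd z)" for z :: "'n point"
    by (cases z) (auto simp: jacobi_dom_eq split: split_indicator)
  have spmu: "space (mu :: 'n point measure) = jacobi_dom" by (simp add: mu_eq spR)
  have fK: "g Z * inverse (K_chi lam m Z Z) = f Z" if "Z \<in> space mu" for Z
    using that by (simp add: spmu f_def K_diag_eq)
  have G [measurable]: "(\<lambda>z. d z *\<^sub>R f z) \<in> borel_measurable borel" by measurable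
  have weight: "(indicator sym_disc (snd z) * disc_det (snd z)) *\<^sub>R (d (shear_conj z) *\<^sub>R f (shear_conj z)) = weight lam p z *\<^sub>R g (shear_conj z)" for z
  proof (cases "snd z \<in> sym_disc")
    case True
    obtain x Y where z: "z = (x, Y)" by (cases z)
    with True have Y: "Y \<in> sym_disc" by simp
    have sd: "shear_conj z \<in> jacobi_dom" using Y by (simp add: z shear_conj_def jacobi_dom_eq)
    have pos: "disc_det Y > 0" by (rule disc_det_pos[OF Y])
    have "f (shear_conj z) = g (shear_conj z) * inverse (of_real (disc_det Y powi m * exp (lam / 2 * quad x Y)))"
      using K_diag_eq[OF sd, of lam m] K_chi_diag[OF Y, of lam m x] by (simp add: f_def z)
    then have "f (shear_conj z) = inverse (disc_det Y powi m * exp (lam / 2 * quad x Y)) *\<^sub>R g (shear_conj z)"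
      by (simp add: scaleR_conv_of_real)
    \<comment> \<open>The three sources of the determinant power: 1 from the Jacobian of the shear,
      \<open>-(n + 2)\<close> from \<open>mu\<close>, and \<open>-m\<close> from the inverse of
      \<open>K_chi\<close>.\<close>
    moreover have "disc_det Y * (disc_det Y powi (- (int CARD('n) + 2)) * inverse (disc_det Y powi m * exp (lam / 2 * quad x Y)))
      = disc_det Y ^ p * exp (- lam / 2 * quad x Y)"
    proof -
      have "disc_det Y * (disc_det Y powi (- (int CARD('n) + 2)) * inverse (disc_det Y powi m)) = disc_det Y powi (1 + (- (int CARD('n) + 2) + - m))"
        using pos by (simp only: power_int_add[OF disjI1[OF pos[THEN less_imp_neq, symmetric]]] power_int_minus power_int_1_right)
      also have "1 + (- (int CARD('n) + 2) + - m) = int p" using p by simp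
      finally have e: "disc_det Y * (disc_det Y powi (- (int CARD('n) + 2)) * inverse (disc_det Y powi m)) = disc_det Y ^ p"
        by (simp only: power_int_of_nat)
      have "disc_det Y * (disc_det Y powi (- (int CARD('n) + 2)) * inverse (disc_det Y powi m * exp (lam / 2 * quad x Y)))
        = disc_det Y * (disc_det Y powi (- (int CARD('n) + 2)) * inverse (disc_det Y powi m)) * exp (- lam / 2 * quad x Y)"
        by (simp add: exp_minus inverse_mult_distrib mult_ac)
      then show ?thesis by (simp only: e)
    qed
    moreover have "d (shear_conj z) = disc_det Y powi (- (int CARD('n) + 2))" by (simp add: d_def z shear_conj_def)
    ultimately show ?thesis using Y by (simp only: z snd_conv fst_conv scaleR_scaleR weight_def) (simp add: mult_ac)
  qed (simp add: weight_def)
  have "integrable mu (\<lambda>Z. g Z * inverse (K_chi lam m Z Z)) \<longleftrightarrow> integrable mu f"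
    by (intro Bochner_Integration.integrable_cong refl fK)
  also have "\<dots> \<longleftrightarrow> integrable ?R (\<lambda>z. d z *\<^sub>R f z)"
    unfolding mu_eq by (intro integrable_density mR dpos) measurable
  also have "\<dots> \<longleftrightarrow> integrable mu_L (\<lambda>z. indicat_real sym_disc (snd z) *\<^sub>R (d z *\<^sub>R f z))"
    unfolding integrable_restrict_space[OF dom] ind ..
  also have "\<dots> \<longleftrightarrow> integrable mu_L (\<lambda>z. weight lam p z *\<^sub>R g (shear_conj z))"
    unfolding shear_transfer(1)[OF G] weight ..
  finally show ?A .
  have "(LINT Z|mu. g Z * inverse (K_chi lam m Z Z)) = (LINT Z|mu. f Z)"
    by (intro Bochner_Integration.integral_cong refl fK)
  also have "\<dots> = (LINT z|?R. d z *\<^sub>R f z)"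
    unfolding mu_eq by (intro integral_density mR dpos) measurable
  also have "\<dots> = (LINT z|mu_L. indicat_real sym_disc (snd z) *\<^sub>R (d z *\<^sub>R f z))"
    unfolding integral_restrict_space[OF dom] ind ..
  also have "\<dots> = (LINT z|mu_L. weight lam p z *\<^sub>R g (shear_conj z))"
    unfolding shear_transfer(2)[OF G] weight ..
  finally show ?B .
qed

section \<open>Integrability against the weight\<close>

definition gauss :: "real \<Rightarrow> 'n::finite point \<Rightarrow> real" where
  "gauss c z = indicator sym_disc (snd z) * exp (- c * quad (fst z) (snd z))"

lemma integrable_gauss:
  assumes "c > 0"
  shows "integrable mu_L (gauss c :: 'n::finite point \<Rightarrow> real)"
proof (rule integrableI_bounded)
  show "gauss c \<in> borel_measurable mu_L"
    unfolding borel_measurable_mu_L gauss_def[abs_def] by measurable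
  have "(\<integral>\<^sup>+z. ennreal (norm (gauss c z)) \<partial>(mu_L :: 'n point measure))
     = (\<integral>\<^sup>+z. indicator sym_disc (snd z) * ennreal (exp (- c * quad (fst z) (snd z))) \<partial>(mu_L :: 'n point measure))"
    by (intro nn_integral_cong) (auto simp: gauss_def split: split_indicator)
  also have "\<dots> < \<infinity>" by (rule gauss_finite[OF assms])
  finally show "(\<integral>\<^sup>+z. ennreal (norm (gauss c z)) \<partial>(mu_L :: 'n point measure)) < \<infinity>" .
qed

text \<open>The determinant enters with a natural exponent \<open>p\<close>, hence is bounded on the
  disc and creates no singularity at its boundary.\<close>

lemma weight_bound: "\<exists>B>0. \<forall>z :: 'n::finite point. weight lam p z \<le> B * gauss (lam / 2) z"
proof -
  obtain B where B: "B > 0" "\<And>Y. Y \<in> (sym_disc :: (complex^'n^'n) set) \<Longrightarrow> disc_det Y \<le> B"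
    using disc_det_bound by blast
  have "weight lam p z \<le> B ^ p * gauss (lam / 2) z" for z :: "'n point"
    using B(2)[of "snd z"] disc_det_pos[of "snd z"]
    by (auto simp: weight_def gauss_def split: split_indicator intro!: mult_right_mono power_mono)
  moreover have "B ^ p > 0" using B by simp
  ultimately show ?thesis by blast
qed

lemma weight_nonneg: "weight lam p z \<ge> 0"
  using disc_det_pos[of "snd z"] by (auto simp: weight_def split: split_indicator intro: less_imp_le)

text \<open>\<open>c\<close> is the slack by which the growth of \<open>h\<close> stays below the
  Gaussian exponent \<open>lam / 2\<close> of the weight.\<close>

lemma weight_dominated:
  fixes h :: "'n::finite point \<Rightarrow> complex"
  assumes c: "c > 0" and K: "K \<ge> 0"
    and h: "\<And>x Y. Y \<in> sym_disc \<Longrightarrow> cmod (h (x, Y)) \<le> K * exp ((lam / 2 - c) * quad x Y)"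
  shows "\<exists>B\<ge>0. \<forall>z. norm (weight lam p z *\<^sub>R h z) \<le> B * gauss c z"
proof -
  obtain B where B: "B > 0" "\<And>z :: 'n point. weight lam p z \<le> B * gauss (lam / 2) z"
    using weight_bound by blast
  have "norm (weight lam p z *\<^sub>R h z) \<le> B * K * gauss c z" for z
  proof (cases "snd z \<in> sym_disc")
    case True
    have "norm (weight lam p z *\<^sub>R h z) = weight lam p z * cmod (h z)" using weight_nonneg[of lam p z] by simp
    also have "\<dots> \<le> (B * exp (- lam / 2 * quad (fst z) (snd z))) * (K * exp ((lam / 2 - c) * quad (fst z) (snd z)))"
      using B(2)[of z] h[OF True, of "fst z"] True B(1) by (intro mult_mono) (auto simp: gauss_def)
    also have "\<dots> = B * K * (exp (- lam / 2 * quad (fst z) (snd z)) * exp ((lam / 2 - c) * quad (fst z) (snd z)))"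
      by simp
    also have "exp (- lam / 2 * quad (fst z) (snd z)) * exp ((lam / 2 - c) * quad (fst z) (snd z)) = exp (- c * quad (fst z) (snd z))"
      unfolding exp_add[symmetric] by (simp add: algebra_simps)
    finally show ?thesis using True by (simp add: gauss_def)
  qed (simp add: weight_def gauss_def)
  moreover have "B * K \<ge> 0" using B K by simp
  ultimately show ?thesis by blast
qed

lemma weight_integrable:
  fixes h :: "'n::finite point \<Rightarrow> complex"
  assumes c: "c > 0" and K: "K \<ge> 0" and [measurable]: "h \<in> borel_measurable borel"
    and h: "\<And>x Y. Y \<in> sym_disc \<Longrightarrow> cmod (h (x, Y)) \<le> K * exp ((lam / 2 - c) * quad x Y)"
  shows "integrable mu_L (\<lambda>z. weight lam p z *\<^sub>R h z)"
proof -
  obtain B where B: "B \<ge> 0" "\<And>z. norm (weight lam p z *\<^sub>R h z) \<le> B * gauss c z"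
    using weight_dominated[OF c K h] by blast
  show ?thesis
  proof (rule Bochner_Integration.integrable_bound)
    show "integrable mu_L (\<lambda>z :: 'n point. B * gauss c z)"
      by (intro integrable_mult_right integrable_gauss c)
    show "(\<lambda>z. weight lam p z *\<^sub>R h z) \<in> borel_measurable mu_L"
      unfolding borel_measurable_mu_L by measurable
    show "AE z in mu_L. norm (weight lam p z *\<^sub>R h z) \<le> norm (B * gauss c z)"
      unfolding real_norm_def by (rule AE_I2) (rule order_trans[OF B(2) abs_ge_self])
  qed
qed

text \<open>Supplies a neighbourhood of 0 in the disc, from which its positive mass follows. The
  \<open>n^2\<close> entries together contribute at most half of \<open>norm z\<close>.\<close>

lemma sym_disc_small:
  fixes Y :: "complex^'n^'n"
  assumes "transpose Y = Y" and le: "\<And>i j. cmod (Y $ i $ j) \<le> 1 / (2 * (real CARD('n))\<^sup>2)"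
  shows "Y \<in> sym_disc"
proof -
  have "norm (Y *v z) < norm z" if z: "z \<noteq> 0" for z
  proof -
    let ?n = "real CARD('n)"
    have "norm (Y *v z) \<le> (\<Sum>i\<in>UNIV. cmod ((Y *v z) $ i))"
      unfolding norm_vec_def by (rule L2_set_le_sum) simp
    also have "\<dots> \<le> (\<Sum>i\<in>(UNIV :: 'n set). \<Sum>j\<in>(UNIV :: 'n set). 1 / (2 * ?n\<^sup>2) * norm z)"
    proof -
      have "cmod (Y $ i $ j * z $ j) \<le> 1 / (2 * ?n\<^sup>2) * norm z" for i j
        unfolding norm_mult by (intro mult_mono le Finite_Cartesian_Product.norm_nth_le) auto
      then show ?thesis
        unfolding matrix_vector_mult_def vec_lambda_beta
        by (intro sum_mono order_trans[OF norm_sum])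
    qed
    also have "\<dots> = norm z / 2" by (simp add: power2_eq_square)
    also have "\<dots> < norm z" using z by simp
    finally show ?thesis .
  qed
  with assms(1) show ?thesis by (simp add: sym_disc_def)
qed

lemma emeasure_sym_disc_pos: "emeasure sym_lebesgue (sym_disc :: (complex^'n::finite^'n) set) > 0"
proof -
  define \<delta> where "\<delta> = 1 / (2 * (real CARD('n))\<^sup>2)"
  have \<delta>: "\<delta> > 0" by (simp add: \<delta>_def)
  have "0 < (\<Prod>p\<in>(sym_pairs :: 'n set set). emeasure lborel (cball (0::complex) \<delta>))"
  proof -
    have "emeasure lborel (cball (0::complex) \<delta>) \<noteq> 0"
      using \<delta> emeasure_cball[of \<delta> "0::complex"] by (simp add: unit_ball_vol_def ennreal_eq_0_iff Gamma_eq_zero_iff)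
        (auto simp: not_le intro!: mult_pos_pos divide_pos_pos Gamma_real_pos)
    then show ?thesis by (simp add: zero_less_iff_neq_zero)
  qed
  also have "\<dots> = emeasure (cprod (sym_pairs :: 'n set set)) (\<Pi>\<^sub>E p\<in>sym_pairs. cball 0 \<delta>)"
    by (rule cp.emeasure_PiM[symmetric]) auto
  also have "\<dots> \<le> emeasure (cprod (sym_pairs :: 'n set set)) (sym_of -` sym_disc \<inter> space (cprod sym_pairs))"
  proof (rule emeasure_mono)
    show "(\<Pi>\<^sub>E p\<in>sym_pairs. cball 0 \<delta>) \<subseteq> sym_of -` sym_disc \<inter> space (cprod (sym_pairs :: 'n set set))"
    proof
      fix s assume s: "s \<in> (\<Pi>\<^sub>E p\<in>(sym_pairs :: 'n set set). cball (0::complex) \<delta>)"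
      have "cmod (s {i, j}) \<le> \<delta>" for i j using s sym_pairsI[of i j] by (auto simp: PiE_iff)
      then have "sym_of s \<in> sym_disc"
        by (intro sym_disc_small) (auto simp: sym_of_def transpose_def vec_eq_iff insert_commute \<delta>_def)
      then show "s \<in> sym_of -` sym_disc \<inter> space (cprod (sym_pairs :: 'n set set))"
        using s by (auto simp: space_PiM PiE_iff)
    qed
  qed (intro measurable_sets[OF sym_of_measurable sym_disc_borel])
  also have "\<dots> = emeasure sym_lebesgue (sym_disc :: (complex^'n^'n) set)"
    unfolding sym_lebesgue_eq by (rule emeasure_distr[symmetric]) auto
  finally show ?thesis .
qed

text \<open>Makes \<open>c_chi\<close> a genuine normalisation: were the integral 0, its
  \<open>inverse\<close> would be 0 as well. The weight is integrable and positive over the disc,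
  which has positive measure.\<close>

lemma weight_integral_pos:
  assumes lam: "lam > 0"
  shows "(LINT z|(mu_L :: 'n::finite point measure). weight lam p z) \<noteq> 0"
proof
  assume 0: "(LINT z|(mu_L :: 'n point measure). weight lam p z) = 0"
  have "integrable mu_L (\<lambda>z :: 'n point. weight lam p z *\<^sub>R (1::complex))"
    by (rule weight_integrable[where c = "lam / 2" and K = 1]) (use lam in auto)
  then have "integrable mu_L (\<lambda>z :: 'n point. Re (weight lam p z *\<^sub>R 1))"
    by (rule integrable_Re)
  then have int: "integrable mu_L (weight lam p :: 'n point \<Rightarrow> real)" by simp
  have "AE z in (mu_L :: 'n point measure). weight lam p z = 0"
  proof -
    have "AE z in (mu_L :: 'n point measure). 0 \<le> weight lam p z" by (simp add: weight_nonneg)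
    from integral_nonneg_eq_0_iff_AE[OF int this] 0 show ?thesis by simp
  qed
  then have "AE z in (mu_L :: 'n point measure). indicator sym_disc (snd z) = (0 :: ennreal)"
    by (rule AE_mp) (rule AE_I2, auto simp: weight_def split: split_indicator dest: disc_det_pos)
  then have "(\<integral>\<^sup>+z. indicator sym_disc (snd z) \<partial>(mu_L :: 'n point measure)) = 0"
    by (subst nn_integral_0_iff_AE) (simp_all add: borel_measurable_mu_L)
  moreover have "(\<integral>\<^sup>+z. indicator sym_disc (snd z) \<partial>(mu_L :: 'n point measure)) =
     emeasure sym_lebesgue (sym_disc :: (complex^'n^'n) set) * emeasure (lborel :: (complex^'n) measure) UNIV"
    by (subst nn_integral_mu_L(1)) (simp_all add: sym_disc_borel)
  ultimately show False using emeasure_sym_disc_pos[where 'n = 'n] by simp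
qed

section \<open>Reproducing property and the kernel\<close>

lemma mu_L_preserved:
  fixes f :: "'n::finite point \<Rightarrow> complex"
  assumes T [measurable]: "T \<in> borel_measurable (borel :: 'n point measure)"
    and nn: "\<And>h :: 'n point \<Rightarrow> ennreal. h \<in> borel_measurable borel \<Longrightarrow> (\<integral>\<^sup>+z. h (T z) \<partial>mu_L) = integral\<^sup>N mu_L h"
    and f [measurable]: "f \<in> borel_measurable borel"
  shows "(LINT z|mu_L. f (T z)) = (LINT z|mu_L. f z)"
    and "integrable mu_L (\<lambda>z. f (T z)) \<longleftrightarrow> integrable mu_L f"
proof -
  have Tm: "T \<in> mu_L \<rightarrow>\<^sub>M mu_L"
    using T by (simp add: measurable_cong_sets[OF sets_mu_L sets_mu_L])
  have fm: "f \<in> borel_measurable mu_L" by (simp add: borel_measurable_mu_L)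
  have d: "distr mu_L mu_L T = mu_L"
  proof (rule measure_eqI)
    fix A assume "A \<in> sets (distr mu_L mu_L T)"
    then have A: "A \<in> sets mu_L" by simp
    then have A': "A \<in> sets borel" by simp
    have "emeasure (distr mu_L mu_L T) A = (\<integral>\<^sup>+z. indicator A z \<partial>distr mu_L mu_L T)"
      using A by simp
    also have "\<dots> = (\<integral>\<^sup>+z. indicator A (T z) \<partial>mu_L)"
      using A by (intro nn_integral_distr Tm) simp
    also have "\<dots> = (\<integral>\<^sup>+z. indicator A z \<partial>mu_L)"
      by (rule nn) (rule borel_measurable_indicator[OF A'])
    finally show "emeasure (distr mu_L mu_L T) A = emeasure mu_L A" using A by simp
  qed simp
  show "(LINT z|mu_L. f (T z)) = (LINT z|mu_L. f z)"
    using integral_distr[OF Tm fm] by (simp add: d)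
  show "integrable mu_L (\<lambda>z. f (T z)) \<longleftrightarrow> integrable mu_L f"
    using integrable_distr_eq[OF Tm fm] by (simp add: d)
qed

lemma section_measurable:
  fixes h :: "'n::finite point \<Rightarrow> ennreal"
  assumes "h \<in> borel_measurable borel"
  shows "(\<lambda>x. h (x, Y)) \<in> borel_measurable borel" "(\<lambda>Y. h (x, Y)) \<in> borel_measurable borel"
  by (rule measurable_compose[OF _ assms], intro borel_measurable_continuous_onI continuous_intros)+

lemma nn_integral_mu_L_translate:
  fixes h :: "'n::finite point \<Rightarrow> ennreal"
  assumes [measurable]: "h \<in> borel_measurable borel"
  shows "(\<integral>\<^sup>+z. h (fst z + a, snd z) \<partial>mu_L) = integral\<^sup>N mu_L h"
proof -
  have "(\<integral>\<^sup>+x. h (x + a, Y) \<partial>lborel) = (\<integral>\<^sup>+x. h (x, Y) \<partial>lborel)" for Y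
  proof -
    have "(\<integral>\<^sup>+x. h (x, Y) \<partial>lborel) = (\<integral>\<^sup>+x. h (x, Y) \<partial>distr lborel borel ((+) a))"
      by (simp add: lborel_distr_plus)
    also have "\<dots> = (\<integral>\<^sup>+x. h (a + x, Y) \<partial>lborel)"
      using section_measurable(1)[OF assms] by (intro nn_integral_distr) auto
    finally show ?thesis by (simp add: add.commute)
  qed
  then show ?thesis by (simp add: nn_integral_mu_L(2))
qed

text \<open>Multiplication by \<open>c\<close> acts separately on each coordinate of the product
  over \<open>sym_pairs\<close> and preserves area in each.\<close>

lemma nn_integral_sym_lebesgue_rotate:
  fixes h :: "complex^'n::finite^'n \<Rightarrow> ennreal"
  assumes c: "cmod c = 1" and h [measurable]: "h \<in> borel_measurable borel"
  shows "(\<integral>\<^sup>+Y. h (scale_mat c Y) \<partial>sym_lebesgue) = integral\<^sup>N sym_lebesgue h"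
proof -
  let ?P = "cprod (sym_pairs :: 'n set set)"
  define R where "R s = (\<lambda>p\<in>sym_pairs. c * s p)" for s :: "'n set \<Rightarrow> complex"
  have R [measurable]: "R \<in> ?P \<rightarrow>\<^sub>M ?P"
    unfolding R_def by measurable
  have lb: "emeasure lborel ((*) c -` A) = emeasure lborel A" if A: "A \<in> sets borel" for A
  proof -
    have "(*) c -` A \<inter> space borel \<in> sets borel" by (rule measurable_sets[OF _ A]) measurable
    then have m: "(*) c -` A \<in> sets borel" by simp
    have "emeasure lborel ((*) c -` A) = (\<integral>\<^sup>+z. indicator A (c * z) \<partial>lborel)"
    proof -
      have "(\<lambda>z. indicator A (c * z) :: ennreal) = indicator ((*) c -` A)"
        by (auto split: split_indicator)
      then show ?thesis using m by simp
    qed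
    also have "\<dots> = (\<integral>\<^sup>+z. indicator A z \<partial>lborel)"
      using A by (intro nn_integral_complex_rotate[OF c] borel_measurable_indicator)
    finally show ?thesis using A by simp
  qed
  have d: "distr ?P ?P R = ?P"
  proof (rule cp.PiM_eqI)
    fix A :: "'n set \<Rightarrow> complex set" assume A: "\<And>p. p \<in> sym_pairs \<Longrightarrow> A p \<in> sets lborel"
    have m: "(*) c -` A p \<in> sets borel" if "p \<in> sym_pairs" for p
    proof -
      have "(*) c -` A p \<inter> space borel \<in> sets borel"
        using A[OF that] by (intro measurable_sets[of _ borel borel]) auto
      then show ?thesis by simp
    qed
    have "R -` (Pi\<^sub>E sym_pairs A) \<inter> space ?P = (\<Pi>\<^sub>E p\<in>sym_pairs. (*) c -` A p)"
      by (auto simp: R_def space_PiM PiE_iff)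
    then have "emeasure (distr ?P ?P R) (Pi\<^sub>E sym_pairs A) = emeasure ?P (\<Pi>\<^sub>E p\<in>sym_pairs. (*) c -` A p)"
      using A by (subst emeasure_distr) (auto intro!: sets_PiM_I_finite)
    also have "\<dots> = (\<Prod>p\<in>sym_pairs. emeasure lborel ((*) c -` A p))"
      using m by (intro cp.emeasure_PiM) auto
    also have "\<dots> = (\<Prod>p\<in>sym_pairs. emeasure lborel (A p))"
      using A lb by (intro prod.cong) auto
    finally show "emeasure (distr ?P ?P R) (Pi\<^sub>E sym_pairs A) = (\<Prod>p\<in>sym_pairs. emeasure lborel (A p))" .
  qed simp_all
  have cm: "(\<lambda>Y. h (scale_mat c Y)) \<in> borel_measurable borel" by measurable
  have "(\<integral>\<^sup>+Y. h (scale_mat c Y) \<partial>sym_lebesgue) = (\<integral>\<^sup>+s. h (scale_mat c (sym_of s)) \<partial>?P)"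
    unfolding sym_lebesgue_eq using cm by (intro nn_integral_distr) auto
  also have "\<dots> = (\<integral>\<^sup>+s. h (sym_of (R s)) \<partial>?P)"
    by (simp add: sym_of_def R_def scale_mat_def)
  also have "\<dots> = (\<integral>\<^sup>+s. h (sym_of s) \<partial>distr ?P ?P R)"
    by (rule nn_integral_distr[symmetric]) measurable
  also have "\<dots> = integral\<^sup>N sym_lebesgue h"
    unfolding d sym_lebesgue_eq using h by (intro nn_integral_distr[symmetric]) auto
  finally show ?thesis .
qed

text \<open>For \<open>cmod c = 1\<close> this is the action of the element of \<open>S\<close> with
  \<open>P = c\<close> and \<open>Q = 0\<close>, hence the square on the matrix part. Being
  polynomial in \<open>c\<close>, it extends to the disc \<open>cmod c \<le> 1\<close> and contracts
  every point to the origin.\<close>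

definition rot :: "complex \<Rightarrow> 'n::finite point \<Rightarrow> 'n point" where
  "rot c z = (c *s fst z, scale_mat (c\<^sup>2) (snd z))"

lemma nn_integral_mu_L_rotate:
  fixes h :: "'n::finite point \<Rightarrow> ennreal"
  assumes c: "cmod c = 1" and h [measurable]: "h \<in> borel_measurable borel"
  shows "(\<integral>\<^sup>+z. h (rot c z) \<partial>mu_L) = integral\<^sup>N mu_L h"
proof -
  have cont: "continuous_on UNIV (rot c :: 'n point \<Rightarrow> _)"
    unfolding rot_def[abs_def] scale_mat_def vector_scalar_mult_def by (intro continuous_intros)
  have m: "(\<lambda>z. h (rot c z)) \<in> borel_measurable borel"
    by (rule measurable_compose[OF _ h]) (intro borel_measurable_continuous_onI cont)
  have h': "(\<lambda>z. h (fst z, scale_mat (c\<^sup>2) (snd z))) \<in> borel_measurable borel"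
    by (rule measurable_compose[OF _ h]) (unfold scale_mat_def, intro borel_measurable_continuous_onI continuous_intros)
  have "(\<integral>\<^sup>+z. h (rot c z) \<partial>mu_L) = (\<integral>\<^sup>+Y. \<integral>\<^sup>+x. h (c *s x, scale_mat (c\<^sup>2) Y) \<partial>lborel \<partial>sym_lebesgue)"
    by (subst nn_integral_mu_L(2)[OF m]) (simp add: rot_def)
  also have "\<dots> = (\<integral>\<^sup>+Y. \<integral>\<^sup>+x. h (x, scale_mat (c\<^sup>2) Y) \<partial>lborel \<partial>sym_lebesgue)"
    by (intro nn_integral_cong nn_integral_complex_vec_rotate[OF c section_measurable(1)[OF h]])
  also have "\<dots> = (\<integral>\<^sup>+x. \<integral>\<^sup>+Y. h (x, scale_mat (c\<^sup>2) Y) \<partial>sym_lebesgue \<partial>lborel)"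
    using nn_integral_mu_L[OF h'] by simp
  also have "\<dots> = (\<integral>\<^sup>+x. \<integral>\<^sup>+Y. h (x, Y) \<partial>sym_lebesgue \<partial>lborel)"
    using c by (intro nn_integral_cong nn_integral_sym_lebesgue_rotate section_measurable(2)[OF h]) (simp add: norm_power)
  also have "\<dots> = integral\<^sup>N mu_L h"
    by (rule nn_integral_mu_L(1)[symmetric]) measurable
  finally show ?thesis .
qed

section \<open>The mean value property over the domain\<close>

lemma circle_mean:
  assumes cont: "continuous_on (cball 0 1) g" and hol: "g holomorphic_on ball 0 1"
  shows "(LINT t|lborel. indicat_real {0..1} t *\<^sub>R g (exp (2 * of_real pi * \<i> * of_real t))) = g 0"
proof -
  define e where "e = (\<lambda>t::real. exp (2 * of_real pi * \<i> * of_real t))"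
  have "((\<lambda>u. g u / (u - 0)) has_contour_integral 2 * of_real pi * \<i> * g 0) (circlepath 0 1)"
    by (rule Cauchy_integral_circlepath[OF cont hol]) simp
  then have "((\<lambda>t. g (circlepath 0 1 t) / (circlepath 0 1 t - 0) * vector_derivative (circlepath 0 1) (at t))
      has_integral 2 * of_real pi * \<i> * g 0) {0..1}"
    by (simp only: has_contour_integral)
  then have "((\<lambda>t. g (e t) * (2 * of_real pi * \<i>)) has_integral 2 * of_real pi * \<i> * g 0) {0..1}"
    unfolding vector_derivative_circlepath by (simp add: circlepath e_def mult.assoc)
  from has_integral_mult_left[OF this, of "inverse (2 * of_real pi * \<i>)"]
  have hi: "((\<lambda>t. g (e t)) has_integral g 0) {0..1}"
    by (simp add: field_simps)
  have "continuous_on {0..1} (\<lambda>t. g (e t))"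
    by (rule continuous_on_compose2[OF cont]) (auto simp: e_def intro!: continuous_intros)
  then have "set_integrable lborel {0..1} (\<lambda>t. g (e t))"
    by (rule borel_integrable_atLeastAtMost')
  from set_borel_integral_eq_integral(2)[OF this] integral_unique[OF hi]
  show ?thesis by (simp add: set_lebesgue_integral_def e_def)
qed

lemma quad_rot:
  assumes "cmod c = 1"
  shows "quad (c *s x) (scale_mat (c\<^sup>2) Y) = quad x Y"
proof -
  have cc: "cnj c * c = 1" using assms by (metis complex_norm_square mult.commute of_real_1 power_one)
  have "cnj_vec (c *s x) \<star> (scale_mat (c\<^sup>2) Y *v cnj_vec (c *s x)) = (cnj c * c)\<^sup>2 * (cnj_vec x \<star> (Y *v cnj_vec x))"
    by (simp add: scale_mat_mv mv_scale bil_scale_left bil_scale_right power2_eq_square mult_ac)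
  then show ?thesis using assms by (simp add: quad_def cc norm_scale)
qed

lemma scale_mat_mm: "scale_mat a X ** scale_mat b Y = scale_mat (a * b) (X ** Y)"
  by (simp add: vec_eq_iff scale_mat_def matrix_matrix_mult_def sum_distrib_left mult_ac)

lemma disc_det_rot:
  assumes "cmod c = 1"
  shows "disc_det (scale_mat c Y) = disc_det Y"
proof -
  have "cnj_mat (scale_mat c Y) = scale_mat (cnj c) (cnj_mat Y)"
    by (simp add: vec_eq_iff cnj_mat_def scale_mat_def)
  moreover have "c * cnj c = 1" using assms by (metis complex_norm_square of_real_1 power_one)
  moreover have "scale_mat 1 X = X" for X :: "complex^'a^'a" by (simp add: scale_mat_def vec_eq_iff)
  ultimately show ?thesis by (simp add: disc_det_def scale_mat_mm)
qed

lemma sym_disc_rot: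
  assumes "cmod c = 1"
  shows "scale_mat c Y \<in> sym_disc \<longleftrightarrow> Y \<in> sym_disc"
proof
  assume "scale_mat c Y \<in> sym_disc"
  then have "scale_mat (cnj c) (scale_mat c Y) \<in> sym_disc" by (rule scale_mat_sym_disc) (use assms in simp)
  moreover have "cnj c * c = 1" using assms by (metis complex_norm_square mult.commute of_real_1 power_one)
  then have "scale_mat (cnj c) (scale_mat c Y) = Y" by (simp add: scale_mat_def vec_eq_iff mult.assoc[symmetric])
  ultimately show "Y \<in> sym_disc" by simp
qed (use assms in \<open>auto intro: scale_mat_sym_disc\<close>)

lemma weight_rot:
  assumes "cmod c = 1"
  shows "weight lam p (rot c z) = weight lam p z"
proof -
  have "cmod (c\<^sup>2) = 1" using assms by (simp add: norm_power)
  then show ?thesis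
    using assms by (simp add: weight_def rot_def disc_det_rot quad_rot sym_disc_rot indicator_def)
qed

lemma shear_rot:
  assumes "cmod c = 1"
  shows "shear_conj (rot c z) = rot c (shear_conj z)"
proof -
  have cc: "cnj c * c = 1" using assms by (metis complex_norm_square mult.commute of_real_1 power_one)
  have "scale_mat (c\<^sup>2) Y *v cnj_vec (c *s x) = ((cnj c * c) * c) *s (Y *v cnj_vec x)" for x Y
    by (simp add: scale_mat_mv mv_scale power2_eq_square mult_ac)
  then have "scale_mat (c\<^sup>2) Y *v cnj_vec (c *s x) = c *s (Y *v cnj_vec x)" for x Y by (simp only: cc mult_1)
  then show ?thesis
    by (cases z) (simp add: shear_conj_def rot_def vec_eq_iff right_diff_distrib)
qed

text \<open>The weight is invariant under rotations and \<open>shear_conj\<close> commutes with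
  them. Averaging the integrand over the circle therefore leaves the integral unchanged and, by
  Fubini, replaces \<open>G\<close> at each point by its circle mean, which is
  \<open>G (0, 0)\<close>.\<close>

lemma mean_value_mu:
  fixes G :: "'n::finite point \<Rightarrow> complex"
  assumes c: "c > 0" and lam: "lam > 0" and K: "K \<ge> 0" and G [measurable]: "G \<in> borel_measurable borel"
    and bound: "\<And>x Y. Y \<in> sym_disc \<Longrightarrow> cmod (G (shear_conj (x, Y))) \<le> K * exp ((lam / 2 - c) * quad x Y)"
    and hol: "\<And>w Y. Y \<in> sym_disc \<Longrightarrow> (\<lambda>t. G (rot t (w, Y))) holomorphic_on cball 0 1"
  shows "(LINT z|mu_L. weight lam p z *\<^sub>R G (shear_conj z)) = of_real (LINT z|(mu_L :: 'n point measure). weight lam p z) * G (0, 0)"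
proof -
  define H where "H z = weight lam p z *\<^sub>R G (shear_conj z)" for z
  define e where "e = (\<lambda>t::real. exp (2 * of_real pi * \<i> * of_real t))"
  have e1: "cmod (e t) = 1" for t by (simp add: e_def)
  have Hm [measurable]: "H \<in> borel_measurable borel" unfolding H_def[abs_def] by measurable
  have Hint: "integrable mu_L H"
    unfolding H_def by (rule weight_integrable[OF c K]) (measurable, rule bound)
  have cont: "continuous_on UNIV (\<lambda>q :: real \<times> 'n point. rot (e (fst q)) (snd q))"
    unfolding rot_def scale_mat_def vector_scalar_mult_def e_def by (intro continuous_intros)
  have rotm: "(\<lambda>z. rot (e t) z) \<in> borel_measurable (borel :: 'n point measure)" for t
    unfolding rot_def scale_mat_def vector_scalar_mult_def by (intro borel_measurable_continuous_onI continuous_intros)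
  have sl: "sigma_finite_measure (mu_L :: 'n point measure)"
    unfolding mu_L_def by unfold_locales
  interpret F: pair_sigma_finite "lborel :: real measure" "mu_L :: 'n point measure"
    using sl by (simp add: pair_sigma_finite_def lborel.sigma_finite_measure_axioms)
  define f where "f t z = indicat_real {0..1} t *\<^sub>R H (rot (e t) z)" for t z
  have inv: "(LINT z|mu_L. g (rot (e t) z)) = (LINT z|mu_L. g z)" "integrable mu_L (\<lambda>z. g (rot (e t) z)) \<longleftrightarrow> integrable mu_L g"
    if "g \<in> borel_measurable borel" for g :: "'n point \<Rightarrow> complex" and t
    using mu_L_preserved[OF rotm nn_integral_mu_L_rotate[OF e1] that] by auto
  have fint: "integrable (lborel \<Otimes>\<^sub>M mu_L) (case_prod f)"
  proof (rule F.Fubini_integrable)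
    have "sets ((lborel :: real measure) \<Otimes>\<^sub>M (mu_L :: 'n point measure)) = sets borel"
    proof -
      have "sets ((lborel :: real measure) \<Otimes>\<^sub>M (mu_L :: 'n point measure)) = sets (borel \<Otimes>\<^sub>M borel)"
        by (intro sets_pair_measure_cong) simp_all
      then show ?thesis by (simp only: borel_prod)
    qed
    then have bm: "borel_measurable ((lborel :: real measure) \<Otimes>\<^sub>M (mu_L :: 'n point measure)) = borel_measurable borel"
      by (intro measurable_cong_sets) auto
    have fm: "(\<lambda>q. indicat_real {0..1} (fst q) *\<^sub>R H (rot (e (fst q)) (snd q))) \<in> borel_measurable borel"
    proof (rule borel_measurable_scaleR)
      show "(\<lambda>q :: real \<times> 'n point. indicat_real {0..1} (fst q)) \<in> borel_measurable borel"
        by (rule measurable_compose[of fst _ borel]) (auto intro!: borel_measurable_continuous_onI continuous_intros)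
      show "(\<lambda>q. H (rot (e (fst q)) (snd q))) \<in> borel_measurable borel"
        by (rule measurable_compose[OF borel_measurable_continuous_onI[OF cont] Hm])
    qed
    show "case_prod f \<in> borel_measurable (lborel \<Otimes>\<^sub>M mu_L)"
      unfolding bm f_def case_prod_unfold by (rule fm)
    \<comment> \<open>Rotation invariance makes the inner integral of the norm independent of
      \<open>t\<close>, which settles integrability of the double integral over
      \<open>{0..1}\<close>.\<close>
    have nH: "(LINT z|mu_L. norm (H (rot (e t) z))) = (LINT z|mu_L. norm (H z))" for t
    proof -
      have "(\<lambda>z. complex_of_real (norm (H z))) \<in> borel_measurable borel" by measurable
      from inv(1)[OF this] have "(LINT z|mu_L. complex_of_real (norm (H (rot (e t) z)))) = (LINT z|mu_L. complex_of_real (norm (H z)))" .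
      then show ?thesis by (simp only: integral_complex_of_real of_real_eq_iff)
    qed
    have "(LINT z|mu_L. norm (f t z)) = indicat_real {0..1} t * (LINT z|mu_L. norm (H z))" for t
      by (simp add: f_def nH)
    then show "integrable lborel (\<lambda>t. LINT z|mu_L. norm (case_prod f (t, z)))"
      by simp
    show "AE t in lborel. integrable mu_L (\<lambda>z. case_prod f (t, z))"
      by (rule AE_I2) (simp add: f_def inv(2)[OF Hm] Hint)
  qed
  have 1: "(LINT z|mu_L. H z) = (LINT t|lborel. LINT z|mu_L. f t z)"
    by (simp add: f_def inv(1)[OF Hm])
  have 2: "(LINT t|lborel. f t z) = weight lam p z *\<^sub>R G (0, 0)" for z
  proof (cases "snd z \<in> sym_disc")
    case True
    obtain w where w: "shear_conj z = (w, snd z)" by (cases z) (simp add: shear_conj_def)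
    have h: "(\<lambda>t. G (rot t (w, snd z))) holomorphic_on cball 0 1" by (rule hol[OF True])
    have "(LINT t|lborel. f t z) = (LINT t|lborel. weight lam p z *\<^sub>R (indicat_real {0..1} t *\<^sub>R G (rot (e t) (w, snd z))))"
      by (simp add: f_def H_def weight_rot[OF e1] shear_rot[OF e1] w mult.commute)
    also have "\<dots> = weight lam p z *\<^sub>R (LINT t|lborel. indicat_real {0..1} t *\<^sub>R G (rot (e t) (w, snd z)))"
      by (rule integral_scaleR_right)
    also have "(LINT t|lborel. indicat_real {0..1} t *\<^sub>R G (rot (e t) (w, snd z))) = G (rot 0 (w, snd z))"
      unfolding e_def using h
      by (intro circle_mean[of "\<lambda>t. G (rot t (w, snd z))"] holomorphic_on_imp_continuous_on holomorphic_on_subset[OF h]) auto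
    also have "rot 0 (w, snd z) = (0, 0)" by (simp add: rot_def scale_mat_def vec_eq_iff)
    finally show ?thesis .
  next
    case False
    then have "weight lam p z = 0" by (simp add: weight_def)
    then show ?thesis by (simp add: f_def H_def weight_rot[OF e1])
  qed
  have "(LINT t|lborel. LINT z|mu_L. f t z) = (LINT z|mu_L. LINT t|lborel. f t z)"
    by (rule F.Fubini_integral[OF fint, symmetric])
  also have "\<dots> = (LINT z|(mu_L :: 'n point measure). of_real (weight lam p z) * G (0, 0))"
    by (simp add: 2 scaleR_conv_of_real)
  also have "\<dots> = of_real (LINT z|(mu_L :: 'n point measure). weight lam p z) * G (0, 0)"
    by (simp only: integral_mult_left_zero integral_complex_of_real)
  finally show ?thesis using 1 by (simp only: H_def)
qed

text \<open>Apart from a constant, the change of \<open>quad\<close> is the real part of a function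
  holomorphic in \<open>(w, Y)\<close> with \<open>w = x - Y *v cnj_vec x\<close>. Its growth can
  therefore be compensated by a holomorphic exponential.\<close>

lemma quad_translate:
  assumes "transpose Y = Y"
  shows "quad (x + a) Y = quad x Y + (norm a)\<^sup>2
    + Re (2 * ((x - Y *v cnj_vec x) \<star> cnj_vec a) - cnj_vec a \<star> (Y *v cnj_vec a))"
proof -
  define w where "w = x - Y *v cnj_vec x"
  have s: "(Y *v b) \<star> c = b \<star> (Y *v c)" for b c by (simp only: bil_mv assms)
  have "(a - Y *v cnj_vec a) \<star> cnj_vec x = a \<star> cnj_vec x - cnj_vec a \<star> (Y *v cnj_vec x)"
    by (simp add: bil_diff_left s)
  moreover have "Re (a \<star> cnj_vec x) = Re (cnj_vec a \<star> x)"
  proof -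
    have "cnj_vec a \<star> x = cnj (a \<star> cnj_vec x)" by (simp add: cnj_bil)
    then show ?thesis by simp
  qed
  ultimately have 1: "Re ((a - Y *v cnj_vec a) \<star> cnj_vec x) = Re (w \<star> cnj_vec a)"
    by (simp add: w_def bil_diff_right bil_diff_left bil_commute[of _ "cnj_vec a"])
  have "quad (x + a) Y = Re ((w + (a - Y *v cnj_vec a)) \<star> (cnj_vec x + cnj_vec a))"
    by (simp add: quad_eq w_def matrix_vector_right_distrib algebra_simps)
  also have "\<dots> = Re (w \<star> cnj_vec x) + Re (w \<star> cnj_vec a) + Re ((a - Y *v cnj_vec a) \<star> cnj_vec x) + Re ((a - Y *v cnj_vec a) \<star> cnj_vec a)"
    by (simp add: bil_add_left bil_add_right)
  also have "Re (w \<star> cnj_vec x) = quad x Y" by (simp add: quad_eq w_def)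
  also have "(a - Y *v cnj_vec a) \<star> cnj_vec a = of_real ((norm a)\<^sup>2) - cnj_vec a \<star> (Y *v cnj_vec a)"
    by (simp add: bil_diff_left bil_cnj_self s)
  finally show ?thesis unfolding 1 by (simp add: w_def)
qed

section \<open>Growth of the coherent states and the kernel\<close>

lemma coherent_bound:
  assumes lam: "lam > 0" and Y: "Y \<in> sym_disc"
  shows "cmod (coherent lam v (shear_conj (x, Y))) \<le> exp (lam / 4 * (5 * (norm v)\<^sup>2)) * exp (lam / 8 * quad x Y)"
proof -
  define y where "y = x - Y *v cnj_vec x"
  define E where "E = 2 * (y \<star> cnj_vec v) + cnj_vec v \<star> (Y *v cnj_vec v)"
  have "Re E \<le> quad x Y / 2 + 5 * (norm v)\<^sup>2"
    unfolding E_def y_def by (rule coherent_exponent_le[OF Y])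
  then have "lam / 4 * Re E \<le> lam / 4 * (quad x Y / 2 + 5 * (norm v)\<^sup>2)"
    using lam by (intro mult_left_mono) auto
  then have "lam / 4 * Re E \<le> lam / 4 * (5 * (norm v)\<^sup>2) + lam / 8 * quad x Y"
    by (simp add: algebra_simps)
  then show ?thesis
    by (simp add: coherent_def shear_conj_def y_def[symmetric] E_def[symmetric] norm_exp_eq_Re exp_add[symmetric])
qed

text \<open>The squared modulus of the coherent state grows at most like
  \<open>exp (lam / 4 * quad x Y)\<close>, half the exponent available in the weight.\<close>

lemma e_chi_in_H_chi:
  assumes lam: "lam > 0" and m: "m \<le> - int CARD('n) - 1"
  shows "e_chi lam m (v, 0 :: complex^'n^'n) \<in> H_chi lam m"
proof -
  obtain p where p: "int p = - m - int CARD('n) - 1"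
    using m zero_le_imp_eq_int[of "- m - int CARD('n) - 1"] by auto
  define g where "g Z = complex_of_real ((cmod (coherent lam v Z))\<^sup>2)" for Z :: "'n point"
  have [measurable]: "g \<in> borel_measurable borel"
    unfolding g_def[abs_def] using coherent_measurable[of lam v] by measurable
  have "integrable mu_L (\<lambda>z. weight lam p z *\<^sub>R g (shear_conj z))"
  proof (rule weight_integrable[where c = "lam / 4" and K = "(exp (lam / 4 * (5 * (norm v)\<^sup>2)))\<^sup>2"])
    fix x and Y :: "complex^'n^'n" assume Y: "Y \<in> sym_disc"
    have "cmod (g (shear_conj (x, Y))) = (cmod (coherent lam v (shear_conj (x, Y))))\<^sup>2" by (simp add: g_def norm_power)
    also have "\<dots> \<le> (exp (lam / 4 * (5 * (norm v)\<^sup>2)) * exp (lam / 8 * quad x Y))\<^sup>2"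
      by (intro power_mono coherent_bound[OF lam Y]) auto
    also have "\<dots> = (exp (lam / 4 * (5 * (norm v)\<^sup>2)))\<^sup>2 * exp ((lam / 2 - lam / 4) * quad x Y)"
      by (simp add: power_mult_distrib exp_double[symmetric] mult.assoc[symmetric])
    finally show "cmod (g (shear_conj (x, Y))) \<le> (exp (lam / 4 * (5 * (norm v)\<^sup>2)))\<^sup>2 * exp ((lam / 2 - lam / 4) * quad x Y)" .
  qed (use lam in auto)
  then have "integrable mu (\<lambda>Z. g Z * inverse (K_chi lam m Z Z))"
    using mu_transfer(1)[OF _ p, of g lam] by simp
  moreover have "space (mu :: 'n point measure) = jacobi_dom"
    by (simp add: mu_def space_restrict_space)
  ultimately have "integrable mu (\<lambda>Z :: 'n point. of_real ((cmod (e_chi lam m (v, 0) Z))\<^sup>2) * inverse (K_chi lam m Z Z))"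
    by (subst Bochner_Integration.integrable_cong[OF refl]) (auto simp: g_def e_chi_eq)
  then show ?thesis
    by (simp add: H_chi_def holomorphic_e_chi) (simp add: e_chi_def)
qed

theorem proposition6p2:
  fixes lam :: real and m :: int
    and P Q :: "complex^'n^'n" and k :: "complex^('n + 'n)^('n + 'n)"
    and y v :: "complex^'n"
  assumes "lam > 0"
    and "real_of_int m + real CARD('n) + 1 / 2 < 0"
    and "k = block_mat P Q (cnj_mat Q) (cnj_mat P)"
    and "k \<in> S_group"
  shows "kernel_chi lam m (pi_chi lam m ((0, 0), 0, k)) (y, 0) (v, 0) =
    det P powi m *
    exp (of_real lam / 4 *
      (y \<star> ((cnj_mat Q ** matrix_inv P) *v y)
       + 2 * (y \<star> (matrix_inv (transpose P) *v cnj_vec v))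
       - cnj_vec v \<star> ((matrix_inv P ** Q) *v cnj_vec v)))"
proof -
  note lam = assms(1)
  have k: "block_mat P Q (cnj_mat Q) (cnj_mat P) \<in> S_group" using assms(3,4) by simp
  interpret A: action_blocks "adj P" "- transpose Q" by (rule S_inv_facts(4)[OF k])
  \<comment> \<open>For an integer \<open>m\<close> the hypothesis with \<open>1 / 2\<close> means
    exactly this bound, so the determinant exponent \<open>p\<close> below is a natural
    number.\<close>
  have m: "m \<le> - int CARD('n) - 1" using assms(2) by linarith
  then have m0: "m \<le> 0" by linarith
  obtain p where p: "int p = - m - int CARD('n) - 1"
    using m zero_le_imp_eq_int[of "- m - int CARD('n) - 1"] by auto
  define f where "f = A.kern lam m v"
  have fm [measurable]: "f \<in> borel_measurable borel" unfolding f_def by (rule A.kern_measurable)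
  have em [measurable]: "coherent lam y \<in> borel_measurable borel" by (rule coherent_measurable)
  have [measurable]: "(\<lambda>Z. cnj (coherent lam y Z)) \<in> borel_measurable borel"
    by (rule measurable_compose[OF em]) (intro borel_measurable_continuous_onI continuous_intros)
  define g where "g Z = f Z * cnj (coherent lam y Z)" for Z
  have gm [measurable]: "g \<in> borel_measurable borel" unfolding g_def[abs_def] by measurable
  \<comment> \<open>Chosen so that translating \<open>x\<close> by \<open>y\<close> adds
    \<open>(norm y)^2 + Re \<xi>\<close> to \<open>quad\<close>. The weight then gains
    \<open>exp (- lam / 2 * ((norm y)^2 + Re \<xi>))\<close> and the conjugated coherent state
    becomes \<open>exp (lam / 4 * (cnj \<xi> + 2 * (norm y)^2))\<close>. The constants cancel, and
    \<open>- Re \<xi> / 2 + cnj \<xi> / 4 = - \<xi> / 4\<close> is holomorphic; this is the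
    exponential in \<open>G\<close>.\<close>
  define \<xi> where "\<xi> = (\<lambda>(w, Y). 2 * (w \<star> cnj_vec y) - cnj_vec y \<star> (Y *v cnj_vec y))"
  define G where "G = (\<lambda>Z. f (fst Z + y - snd Z *v cnj_vec y, snd Z) * exp (- of_real lam / 4 * \<xi> Z))"
  have Gm [measurable]: "G \<in> borel_measurable borel"
  proof -
    have "(\<lambda>Z. f (fst Z + y - snd Z *v cnj_vec y, snd Z)) \<in> borel_measurable borel"
      by (rule measurable_compose[OF _ fm]) measurable
    then show ?thesis unfolding G_def \<xi>_def case_prod_unfold by measurable
  qed
  define I where "I = (LINT z|(mu_L :: 'n point measure). weight lam p z)"
  have I0: "I \<noteq> 0" unfolding I_def by (rule weight_integral_pos[OF lam])
  \<comment> \<open>The integrand 1 under the same transfer: \<open>c_chi\<close> is the inverse of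
    the very mass \<open>I\<close> that the mean value property produces.\<close>
  have "(LINT Z|(mu :: 'n point measure). 1 * inverse (K_chi lam m Z Z)) = (LINT z|(mu_L :: 'n point measure). weight lam p z *\<^sub>R 1)"
    by (rule mu_transfer(2)[OF _ p]) simp
  also have "\<dots> = of_real I"
    by (simp only: I_def scaleR_conv_of_real mult_1_right integral_complex_of_real)
  finally have c: "c_chi TYPE('n) lam m = inverse (of_real I)" by (simp add: c_chi_def)
  have shear_y: "shear_conj (fst z + y, snd z) = (fst (shear_conj z) + y - snd (shear_conj z) *v cnj_vec y, snd (shear_conj z))"
    for z :: "'n point"
    by (cases z) (simp add: shear_conj_def matrix_vector_right_distrib)
  have shift: "weight lam p (fst z + y, snd z) *\<^sub>R g (shear_conj (fst z + y, snd z)) = weight lam p z *\<^sub>R G (shear_conj z)" for z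
  proof (cases "snd z \<in> sym_disc")
    case True
    obtain x Y where z: "z = (x, Y)" by (cases z)
    with True have Y: "Y \<in> sym_disc" by simp
    note tY = sym_discD(1)[OF Y]
    define w where "w = x - Y *v cnj_vec x"
    have s: "(Y *v b) \<star> c = b \<star> (Y *v c)" for b c by (simp only: bil_mv tY)
    have q: "quad (x + y) Y = quad x Y + (norm y)\<^sup>2 + Re (\<xi> (w, Y))"
      unfolding quad_translate[OF tY] by (simp add: \<xi>_def w_def)
    have E: "2 * ((w + y - Y *v cnj_vec y) \<star> cnj_vec y) + cnj_vec y \<star> (Y *v cnj_vec y) = \<xi> (w, Y) + of_real (2 * (norm y)\<^sup>2)"
      by (simp add: \<xi>_def bil_add_left bil_diff_left bil_cnj_self s algebra_simps)
    have "of_real (exp (- lam / 2 * quad (x + y) Y)) * cnj (exp (of_real lam / 4 * (\<xi> (w, Y) + of_real (2 * (norm y)\<^sup>2))))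
      = of_real (exp (- lam / 2 * quad x Y)) * exp (- of_real lam / 4 * \<xi> (w, Y))"
      unfolding exp_of_real[symmetric] exp_cnj exp_add[symmetric] q
      by (rule arg_cong[where f = exp]) (simp add: complex_eq_iff algebra_simps)
    then have "of_real (weight lam p (x + y, Y)) * cnj (exp (of_real lam / 4 * (\<xi> (w, Y) + of_real (2 * (norm y)\<^sup>2))))
      = of_real (weight lam p (x, Y)) * exp (- of_real lam / 4 * \<xi> (w, Y))"
      using Y by (simp add: weight_def mult.assoc)
    then have "of_real (weight lam p (x + y, Y)) * cnj (coherent lam y (w + y - Y *v cnj_vec y, Y))
      = of_real (weight lam p (x, Y)) * exp (- of_real lam / 4 * \<xi> (w, Y))"
      unfolding coherent_def prod.case E .
    moreover have "shear_conj z = (w, Y)" by (simp add: z shear_conj_def w_def)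
    ultimately show ?thesis
      unfolding shear_y by (simp add: z g_def G_def scaleR_conv_of_real mult_ac)
  qed (simp add: weight_def)
  have "(LINT Z|mu. g Z * inverse (K_chi lam m Z Z)) = (LINT z|mu_L. weight lam p z *\<^sub>R g (shear_conj z))"
    by (rule mu_transfer(2)[OF gm p])
  also have "\<dots> = (LINT z|mu_L. weight lam p (fst z + y, snd z) *\<^sub>R g (shear_conj (fst z + y, snd z)))"
    by (rule mu_L_preserved(1)[where T = "\<lambda>z. (fst z + y, snd z)" and f = "\<lambda>z. weight lam p z *\<^sub>R g (shear_conj z)", symmetric])
      (auto intro!: borel_measurable_continuous_onI continuous_intros nn_integral_mu_L_translate, measurable)
  also have "\<dots> = (LINT z|mu_L. weight lam p z *\<^sub>R G (shear_conj z))"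
    by (simp only: shift)
  also have "\<dots> = of_real I * G (0, 0)"
  proof -
    obtain K where K: "K \<ge> 0" "\<And>x Y. Y \<in> sym_disc \<Longrightarrow> cmod (f (shear_conj (x, Y))) \<le> K * exp (lam / 4 * quad x Y)"
      using A.kern_bound[OF m0 lam, of v] unfolding f_def by blast
    show ?thesis
      unfolding I_def
    \<comment> \<open>\<open>kern_bound\<close> grows with \<open>lam / 4\<close>, which leaves the
      slack \<open>c = lam / 4\<close>. The factor \<open>exp (- lam / 4 * \<xi>)\<close> offsets
      the change of \<open>quad\<close> under the translation up to the constant in
      \<open>norm y\<close>.\<close>
    proof (rule mean_value_mu[where c = "lam / 4" and K = "K * exp (lam / 4 * (norm y)\<^sup>2)"])
      fix x :: "complex^'n" and Y :: "complex^'n^'n" assume Y: "Y \<in> sym_disc"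
      define w where "w = x - Y *v cnj_vec x"
      have "cmod (G (shear_conj (x, Y))) = cmod (f (shear_conj (x + y, Y))) * exp (- lam / 4 * Re (\<xi> (w, Y)))"
        using shear_y[of "(x, Y)"] by (simp add: G_def norm_mult norm_exp_eq_Re) (simp add: shear_conj_def w_def)
      also have "\<dots> \<le> (K * exp (lam / 4 * quad (x + y) Y)) * exp (- lam / 4 * Re (\<xi> (w, Y)))"
        by (intro mult_right_mono K(2) Y) simp
      also have "quad (x + y) Y = quad x Y + (norm y)\<^sup>2 + Re (\<xi> (w, Y))"
        unfolding quad_translate[OF sym_discD(1)[OF Y]] by (simp add: \<xi>_def w_def)
      also have "(K * exp (lam / 4 * (quad x Y + (norm y)\<^sup>2 + Re (\<xi> (w, Y))))) * exp (- lam / 4 * Re (\<xi> (w, Y)))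
         = K * exp (lam / 4 * (norm y)\<^sup>2) * exp ((lam / 2 - lam / 4) * quad x Y)"
        unfolding mult.assoc exp_add[symmetric] by (simp add: algebra_simps)
      finally show "cmod (G (shear_conj (x, Y))) \<le> K * exp (lam / 4 * (norm y)\<^sup>2) * exp ((lam / 2 - lam / 4) * quad x Y)" .
    next
      fix w :: "complex^'n" and Y :: "complex^'n^'n" assume Y: "Y \<in> sym_disc"
      have "scale_mat (t\<^sup>2) Y \<in> sym_disc" if "t \<in> cball 0 1" for t
        using that by (intro scale_mat_sym_disc[OF Y]) (simp add: norm_power power_le_one)
      then have d: "det (A.den (scale_mat (t\<^sup>2) Y)) \<noteq> 0" if "t \<in> cball 0 1" for t
        using that A.det_den by blast
      have "(\<lambda>t. f (t *s w + y - scale_mat (t\<^sup>2) Y *v cnj_vec y, scale_mat (t\<^sup>2) Y)) holomorphic_on cball 0 1"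
        unfolding f_def by (intro A.kern_hol hol_vm holomorphic_intros d)
      moreover have "(\<lambda>t. \<xi> (t *s w, scale_mat (t\<^sup>2) Y)) holomorphic_on cball 0 1"
        unfolding \<xi>_def prod.case by (intro hol_vm holomorphic_intros)
      ultimately show "(\<lambda>t. G (rot t (w, Y))) holomorphic_on cball 0 1"
        unfolding G_def rot_def fst_conv snd_conv by (intro holomorphic_intros)
    qed (use lam K(1) in auto)
  qed
  \<comment> \<open>\<open>\<xi>\<close> vanishes at the origin, and the translation carries the
    origin to \<open>(y, 0)\<close>.\<close>
  also have "G (0, 0) = f (y, 0)"
    by (simp add: G_def \<xi>_def)
  finally have int: "(LINT Z|mu. g Z * inverse (K_chi lam m Z Z)) = of_real I * f (y, 0)" .
  have sp: "space (mu :: 'n point measure) = jacobi_dom"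
    by (simp add: mu_def space_restrict_space)
  have "kernel_chi lam m (pi_chi lam m ((0, 0), 0, k)) (y, 0) (v, 0)
      = (LINT Z|mu. g Z * inverse (K_chi lam m Z Z) * c_chi TYPE('n) lam m)"
    unfolding kernel_chi_def inner_chi_def
  proof (rule Bochner_Integration.integral_cong[OF refl])
    fix Z :: "'n point" assume "Z \<in> space mu"
    then have Z: "Z \<in> jacobi_dom" by (simp only: sp)
    show "pi_chi lam m ((0, 0), 0, k) (e_chi lam m (v, 0)) Z * cnj (e_chi lam m (y, 0) Z) * inverse (K_chi lam m Z Z) * c_chi TYPE('n) lam m
       = g Z * inverse (K_chi lam m Z Z) * c_chi TYPE('n) lam m"
      unfolding assms(3) pi_chi_eval[OF k e_chi_in_H_chi[OF lam m] Z] e_chi_eq[OF Z] g_def f_def ..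
  qed
  also have "\<dots> = (LINT Z|mu. g Z * inverse (K_chi lam m Z Z)) * c_chi TYPE('n) lam m"
    by (rule integral_mult_left_zero)
  also have "\<dots> = f (y, 0)"
    using I0 by (simp add: int c)
  finally show ?thesis unfolding f_def kern_eval[OF k] .
qed

end
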